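(* For every integer $m\geq 3$, there is a smooth ($C^\infty$) closed embedded hypersurface $\Sigma\subset\mathbb{R}^{m+1}$ of dimension $m$, diffeomorphic to the sphere $\mathbb{S}^m$, such that the Riemannian metric $g$ induced on $\Sigma$ from the Euclidean metric of $\mathbb{R}^{m+1}$ satisfies: (1) $\sec_g\geq 0$ everywhere, i.e. every two-plane tangent to $\Sigma$ at any point has nonnegative sectional curvature; (2) the set $\Sigma\setminus\mathcal{Z}(g)$ is open and dense in $\Sigma$, and at each of its points every tangent two-plane has strictly positive sectional curvature; (3) $\dim_{\mathrm{H}}\mathcal{Z}(g)=\tfrac12$. In fact, $\Sigma$ can be taken so that moreover $\mathcal{Z}(g)$ is bi-Lipschitz equivalent to a self-similar Cantor set of Hausdorff dimension $1/2$.
   Context: For a Riemannian manifold $(M,g)$ with nonnegative sectional curvature, the zero-curvature point locus is $$\mathcal{Z}(g):=\{p\in M:\text{there is a two-plane }\Pi\subset T_pM\text{ with }\sec_g(\Pi)=0\},$$ a subset of $M$ (not of the Grassmann bundle of two-planes). Here $\sec_g(\Pi)$ denotes the sectional curvature of $\Pi$, and $\dim_{\mathrm{H}}$ denotes Hausdorff dimension, taken with respect to the Riemannian distance of $g$. Since $\Sigma$ is a compact embedded submanifold, this distance is bi-Lipschitz equivalent to the Euclidean distance restricted to $\Sigma$, so either may be used. Two metric spaces are bi-Lipschitz equivalent if there is a bijection between them that is Lipschitz with Lipschitz inverse. A self-similar Cantor set is a nonempty compact subset of $\mathbb{R}$ that is homeomorphic to the standard Cantor set and is the union of finitely many (at least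 two) pairwise disjoint images of itself under contracting similarities. *)

theory Defs
  imports "HOL-Analysis.Analysis"
begin

text \<open>Intended for open \<open>U\<close>: all iterated directional derivatives of order at most \<open>k\<close> exist
  (as Frechet derivatives) and are continuous.\<close>

primrec Ck_on :: "nat \<Rightarrow> ('a::euclidean_space \<Rightarrow> 'b::euclidean_space) \<Rightarrow> 'a set \<Rightarrow> bool" where
  "Ck_on 0 f U \<longleftrightarrow> continuous_on U f"
| "Ck_on (Suc k) f U \<longleftrightarrow>
     (\<forall>x\<in>U. f differentiable (at x)) \<and> (\<forall>v. Ck_on k (\<lambda>x. frechet_derivative f (at x) v) U)"

definition smooth_on_open :: "('a::euclidean_space \<Rightarrow> 'b::euclidean_space) \<Rightarrow> 'a set \<Rightarrow> bool" where
  "smooth_on_open f U \<longleftrightarrow> open U \<and> (\<forall>k. Ck_on k f U)"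

text \<open>Smoothness on an arbitrary subset (such as an embedded submanifold): local existence of
  smooth extensions to the ambient space.\<close>

definition smooth_map_on :: "('a::euclidean_space \<Rightarrow> 'b::euclidean_space) \<Rightarrow> 'a set \<Rightarrow> bool" where
  "smooth_map_on f X \<longleftrightarrow>
     (\<forall>x\<in>X. \<exists>V F. x \<in> V \<and> smooth_on_open F V \<and> (\<forall>y\<in>V \<inter> X. F y = f y))"

definition diffeomorphic :: "'a::euclidean_space set \<Rightarrow> 'b::euclidean_space set \<Rightarrow> bool" where
  "diffeomorphic X Y \<longleftrightarrow>
     (\<exists>f g. homeomorphism X Y f g \<and> smooth_map_on f X \<and> smooth_map_on g Y)"

definition local_parametrization ::
  "('m::euclidean_space \<Rightarrow> 'a::euclidean_space) \<Rightarrow> 'm set \<Rightarrow> 'a set \<Rightarrow> bool" where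
  "local_parametrization \<phi> U S \<longleftrightarrow>
     smooth_on_open \<phi> U \<and>
     (\<forall>x\<in>U. inj (frechet_derivative \<phi> (at x))) \<and>
     (\<exists>\<psi>. homeomorphism U (\<phi> ` U) \<phi> \<psi>) \<and>
     openin (top_of_set S) (\<phi> ` U)"

text \<open>The type argument \<open>'m\<close> is the model space; the dimension of the submanifold is
  \<open>DIM('m)\<close>.\<close>

definition embedded_submanifold ::
  "'m::euclidean_space itself \<Rightarrow> 'a::euclidean_space set \<Rightarrow> bool" where
  "embedded_submanifold _ S \<longleftrightarrow>
     (\<forall>p\<in>S. \<exists>(\<phi> :: 'm \<Rightarrow> 'a) U. local_parametrization \<phi> U S \<and> p \<in> \<phi> ` U)"

definition tangent_space ::
  "'m::euclidean_space itself \<Rightarrow> 'a::euclidean_space set \<Rightarrow> 'a \<Rightarrow> 'a set" where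
  "tangent_space _ S p =
     {frechet_derivative \<phi> (at x) u | (\<phi> :: 'm \<Rightarrow> 'a) U x u.
        local_parametrization \<phi> U S \<and> x \<in> U \<and> \<phi> x = p}"

definition tangent_planes ::
  "'m::euclidean_space itself \<Rightarrow> 'a::euclidean_space set \<Rightarrow> 'a \<Rightarrow> 'a set set" where
  "tangent_planes T S p = {P. subspace P \<and> dim P = 2 \<and> P \<subseteq> tangent_space T S p}"

text \<open>A metric on an open subset of \<open>'m\<close> is a function \<open>g\<close> with \<open>g x u v\<close> the inner product of
  the vectors \<open>u\<close>, \<open>v\<close> at \<open>x\<close>.  Vectors of \<open>'m\<close> are regarded as constant, hence commuting, vector
  fields.  The Levi-Civita connection is then \<open>\<nabla>\<^sub>u v = \<Gamma>(u,v)\<close>, where \<open>\<Gamma>\<close> is given by the Koszul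
  formula; in the standard basis the components of \<open>\<Gamma>\<close> are the Christoffel symbols.\<close>

definition christoffel ::
  "('m::euclidean_space \<Rightarrow> 'm \<Rightarrow> 'm \<Rightarrow> real) \<Rightarrow> 'm \<Rightarrow> 'm \<Rightarrow> 'm \<Rightarrow> 'm" where
  "christoffel g x u v =
     (THE w. \<forall>z. g x w z =
        (frechet_derivative (\<lambda>y. g y v z) (at x) u
         + frechet_derivative (\<lambda>y. g y u z) (at x) v
         - frechet_derivative (\<lambda>y. g y u v) (at x) z) / 2)"

text \<open>\<open>R(u,v)w = \<nabla>\<^sub>u \<nabla>\<^sub>v w - \<nabla>\<^sub>v \<nabla>\<^sub>u w\<close>\<close>

definition riemann_curvature ::
  "('m::euclidean_space \<Rightarrow> 'm \<Rightarrow> 'm \<Rightarrow> real) \<Rightarrow> 'm \<Rightarrow> 'm \<Rightarrow> 'm \<Rightarrow> 'm \<Rightarrow> 'm" where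
  "riemann_curvature g x u v w =
     frechet_derivative (\<lambda>y. christoffel g y v w) (at x) u
     - frechet_derivative (\<lambda>y. christoffel g y u w) (at x) v
     + christoffel g x u (christoffel g x v w)
     - christoffel g x v (christoffel g x u w)"

definition coord_sectional_curvature ::
  "('m::euclidean_space \<Rightarrow> 'm \<Rightarrow> 'm \<Rightarrow> real) \<Rightarrow> 'm \<Rightarrow> 'm \<Rightarrow> 'm \<Rightarrow> real" where
  "coord_sectional_curvature g x u v =
     g x (riemann_curvature g x u v v) u / (g x u u * g x v v - (g x u v)\<^sup>2)"

definition induced_metric ::
  "('m::euclidean_space \<Rightarrow> 'a::euclidean_space) \<Rightarrow> 'm \<Rightarrow> 'm \<Rightarrow> 'm \<Rightarrow> real" where
  "induced_metric \<phi> x u v = frechet_derivative \<phi> (at x) u \<bullet> frechet_derivative \<phi> (at x) v"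

text \<open>Sectional curvature, at \<open>p\<close>, of the tangent plane \<open>P\<close>.  The value does not depend on the
  choice of the parametrization or of the basis of \<open>P\<close>, which justifies the definite
  description.\<close>

definition sectional_curvature ::
  "'m::euclidean_space itself \<Rightarrow> 'a::euclidean_space set \<Rightarrow> 'a \<Rightarrow> 'a set \<Rightarrow> real" where
  "sectional_curvature _ S p P =
     (THE s. \<exists>(\<phi> :: 'm \<Rightarrow> 'a) U x u v.
        local_parametrization \<phi> U S \<and> x \<in> U \<and> \<phi> x = p \<and>
        span {frechet_derivative \<phi> (at x) u, frechet_derivative \<phi> (at x) v} = P \<and>
        s = coord_sectional_curvature (induced_metric \<phi>) x u v)"

definition zero_curvature_locus ::
  "'m::euclidean_space itself \<Rightarrow> 'a::euclidean_space set \<Rightarrow> 'a set" where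
  "zero_curvature_locus T S =
     {p \<in> S. \<exists>P \<in> tangent_planes T S p. sectional_curvature T S p P = 0}"

text \<open>The library's \<open>diameter\<close> is only meaningful for bounded sets, so boundedness of the covering
  sets is required explicitly.\<close>

definition hausdorff_premeasure :: "real \<Rightarrow> real \<Rightarrow> 'a::metric_space set \<Rightarrow> ennreal" where
  "hausdorff_premeasure s \<delta> A =
     (INF C \<in> {C :: nat \<Rightarrow> 'a set. A \<subseteq> (\<Union>i. C i) \<and> (\<forall>i. bounded (C i) \<and> diameter (C i) \<le> \<delta>)}.
        \<Sum>i. ennreal (diameter (C i) powr s))"

definition hausdorff_measure :: "real \<Rightarrow> 'a::metric_space set \<Rightarrow> ennreal" where
  "hausdorff_measure s A = (SUP \<delta> \<in> {0<..}. hausdorff_premeasure s \<delta> A)"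

text \<open>Restricting to \<open>s > 0\<close> does not change the infimum and avoids the convention
  \<open>0 powr 0 = 0\<close>.\<close>

definition hausdorff_dim :: "'a::metric_space set \<Rightarrow> ennreal" where
  "hausdorff_dim A = Inf {ennreal s | s. 0 < s \<and> hausdorff_measure s A = 0}"

definition bilipschitz_equivalent :: "'a::metric_space set \<Rightarrow> 'b::metric_space set \<Rightarrow> bool" where
  "bilipschitz_equivalent A B \<longleftrightarrow>
     (\<exists>f K L. bij_betw f A B \<and> K-lipschitz_on A f \<and> L-lipschitz_on B (inv_into A f))"

primrec cantor_stage :: "nat \<Rightarrow> real set" where
  "cantor_stage 0 = {0..1}"
| "cantor_stage (Suc n) =
     (\<lambda>x. x / 3) ` cantor_stage n \<union> (\<lambda>x. (x + 2) / 3) ` cantor_stage n"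

definition standard_cantor_set :: "real set" where
  "standard_cantor_set = (\<Inter>n. cantor_stage n)"

definition contracting_similarity :: "(real \<Rightarrow> real) \<Rightarrow> bool" where
  "contracting_similarity f \<longleftrightarrow> (\<exists>r. 0 < r \<and> r < 1 \<and> (\<forall>x y. dist (f x) (f y) = r * dist x y))"

definition self_similar_cantor_set :: "real set \<Rightarrow> bool" where
  "self_similar_cantor_set C \<longleftrightarrow>
     C \<noteq> {} \<and> compact C \<and> C homeomorphic standard_cantor_set \<and>
     (\<exists>(N::nat) f. 2 \<le> N \<and> (\<forall>i<N. contracting_similarity (f i)) \<and>
        disjoint_family_on (\<lambda>i. f i ` C) {..<N} \<and>
        C = (\<Union>i<N. f i ` C))"

end

theory Submission
  imports Defs
begin

text \<open>The hypersurface is a level set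
  \<open>{x. h t + (1 + t\<^sup>2 / 100) |y|\<^sup>2 + l z = 1}\<close>, where \<open>t\<close> and \<open>z\<close> are the coordinates along two
  orthonormal vectors, \<open>y\<close> is the remaining component, and \<open>h\<close>, \<open>l\<close> are smooth convex functions
  such that \<open>h''\<close> vanishes exactly on a Cantor set and \<open>l''\<close> exactly on a half-line.
  By the Gauss equation the curvature of a tangent plane is a positive multiple of the determinant
  of the Hessian on it. The factor \<open>1 + t\<^sup>2 / 100\<close> makes the Hessian positive definite on
  the tangent space wherever \<open>y \<noteq> 0\<close>, and where \<open>y = 0\<close> the Hessian degenerates precisely when
  both \<open>h''(t)\<close> and \<open>l''(z)\<close> vanish. This leaves one point over each point of the Cantor set.
  Since \<open>h\<close> and \<open>l\<close> are squares of diffeomorphisms of the line, the level set is mapped onto the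
  unit sphere by an explicit diffeomorphism of the ambient space.\<close>

subsection \<open>Calculus of iterated derivatives\<close>

text \<open>A kernel of the Hessian matters only where it meets the tangent space. At
  \<open>y = 0\<close>, if just one of \<open>h''\<close>, \<open>l''\<close> vanishes, the kernel
  is a line transverse to the level set, because \<open>h'\<close> and \<open>l'\<close> vanish only
  at \<open>0\<close>, where both second derivatives equal 2. If both vanish, the kernel is a plane,
  and a plane meets every hyperplane in a nonzero vector; this is why two profiles are used. Without
  the warping factor the same would happen for every \<open>y\<close>, and the locus would contain a
  whole cap over each point of the Cantor set; the factor adds |y|^2 / 50 to the Hessian in the
  direction of \<open>t\<close>. The zero set of \<open>l''\<close> is a half-line rather than a
  second Cantor set, so that no two Cantor sets have to be matched: at \<open>y = 0\<close> the
  equation h t + l z = 1 determines the \<open>z\<close> in the half-line from \<open>t\<close>, by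
  a bi-Lipschitz dependence of the point on \<open>t\<close>. The Cantor set has two pieces of ratio
  1/4, since 2 * (1/4)^s = 1 exactly for s = 1/2.\<close>

lemma Ck_onI:
  assumes "\<And>x. x \<in> U \<Longrightarrow> (f has_derivative f' x) (at x)"
    and "\<And>v. Ck_on k (\<lambda>x. f' x v) U" and "open U"
  shows "Ck_on (Suc k) f U"
proof -
  \<comment> \<open>\<open>Ck_on\<close> is phrased with \<open>frechet_derivative\<close>, which
    matches \<open>f'\<close> only on \<open>U\<close>. Exchange of functions on an open set is
    proved here directly, since \<open>Ck_on_cong\<close> is itself derived from this rule.\<close>
  have cong: "open U \<Longrightarrow> Ck_on k f U \<Longrightarrow> (\<And>x. x \<in> U \<Longrightarrow> f x = g x) \<Longrightarrow> Ck_on k g U"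
    for f g :: "'a \<Rightarrow> 'b" and k
  proof (induction k arbitrary: f g)
    case 0
    then show ?case by (simp cong: continuous_on_cong_simp)
  next
    case (Suc k)
    have d: "(g has_derivative frechet_derivative f (at x)) (at x)" if "x \<in> U" for x
    proof (rule has_derivative_transform_within_open)
      show "(f has_derivative frechet_derivative f (at x)) (at x)"
        using Suc.prems(2) that frechet_derivative_works by fastforce
    qed (use Suc.prems that in blast)+
    have "Ck_on k (\<lambda>x. frechet_derivative g (at x) v) U" for v
      by (rule Suc.IH[OF Suc.prems(1), of "\<lambda>x. frechet_derivative f (at x) v"])
        (use Suc.prems(2) in \<open>auto simp flip: frechet_derivative_at[OF d]\<close>)
    then show ?case using d by (auto simp: differentiable_def)
  qed
  have "Ck_on k (\<lambda>x. frechet_derivative f (at x) v) U" for v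
    by (rule cong[OF assms(3) assms(2)[of v]]) (auto simp flip: frechet_derivative_at[OF assms(1)])
  then show ?thesis using assms(1) by (auto simp: differentiable_def)
qed

lemma Ck_on_cong:
  assumes "open U" "Ck_on k f U" "\<And>x. x \<in> U \<Longrightarrow> f x = g x"
  shows "Ck_on k g U"
proof (cases k)
  case 0
  then show ?thesis using assms by (simp cong: continuous_on_cong_simp)
next
  case (Suc j)
  show ?thesis unfolding Suc
  proof (rule Ck_onI)
    show "(g has_derivative frechet_derivative f (at x)) (at x)" if "x \<in> U" for x
    proof (rule has_derivative_transform_within_open)
      show "(f has_derivative frechet_derivative f (at x)) (at x)"
        using assms(2) Suc that frechet_derivative_works by fastforce
    qed (use assms that in blast)+
  qed (use assms Suc in auto)
qed

lemma Ck_on_continuous: "Ck_on k f U \<Longrightarrow> continuous_on U f"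
proof (cases k)
  case (Suc j)
  assume "Ck_on k f U"
  then show ?thesis unfolding Suc
    by (auto intro!: continuous_at_imp_continuous_on dest: differentiable_imp_continuous_within)
qed simp

lemma Ck_on_Suc_imp: "Ck_on (Suc k) f U \<Longrightarrow> Ck_on k f U"
proof (induction k arbitrary: f)
  case 0
  then show ?case by (metis Ck_on_continuous Ck_on.simps(1))
next
  case (Suc k)
  then show ?case by (metis Ck_on.simps(2))
qed

lemma Ck_on_has_derivative:
  "Ck_on (Suc k) f U \<Longrightarrow> x \<in> U \<Longrightarrow> (f has_derivative frechet_derivative f (at x)) (at x)"
  by (simp add: frechet_derivative_works)

lemma Ck_on_const: "open U \<Longrightarrow> Ck_on k (\<lambda>x. c) U"
  by (induction k arbitrary: c) (auto simp del: Ck_on.simps(2) intro!: Ck_onI[where f'="\<lambda>x v. 0"])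

lemma Ck_on_bounded_linear:
  assumes "open U" "bounded_linear L"
  shows "Ck_on k L U"
proof (cases k)
  case 0
  then show ?thesis using assms by (simp add: linear_continuous_on)
next
  case (Suc j)
  show ?thesis unfolding Suc
    by (rule Ck_onI[where f'="\<lambda>x. L"])
      (use assms in \<open>auto intro: bounded_linear_imp_has_derivative Ck_on_const\<close>)
qed

lemma Ck_on_add:
  assumes "open U"
  shows "Ck_on k f U \<Longrightarrow> Ck_on k g U \<Longrightarrow> Ck_on k (\<lambda>x. f x + g x) U"
proof (induction k arbitrary: f g)
  case 0
  then show ?case by (simp add: continuous_on_add)
next
  case (Suc k)
  show ?case
    by (rule Ck_onI[where f'="\<lambda>x v. frechet_derivative f (at x) v + frechet_derivative g (at x) v"])
      (use Suc assms in \<open>auto intro!: has_derivative_add simp: frechet_derivative_works\<close>)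
qed

lemma Ck_on_sum:
  assumes "open U" "\<And>i. i \<in> I \<Longrightarrow> Ck_on k (f i) U"
  shows "Ck_on k (\<lambda>x. \<Sum>i\<in>I. f i x) U"
  using assms(2) by (induction I rule: infinite_finite_induct)
    (auto intro: Ck_on_add Ck_on_const assms(1))

lemma Ck_on_bilinear:
  assumes "bounded_bilinear B" "open U"
  shows "Ck_on k f U \<Longrightarrow> Ck_on k g U \<Longrightarrow> Ck_on k (\<lambda>x. B (f x) (g x)) U"
proof (induction k arbitrary: f g)
  case 0
  then show ?case by (simp add: bounded_bilinear.continuous_on[OF assms(1)])
next
  case (Suc k)
  have "Ck_on k (\<lambda>x. B (f x) (frechet_derivative g (at x) v)
      + B (frechet_derivative f (at x) v) (g x)) U"
    for v using Suc.prems by (intro Ck_on_add[OF assms(2)] Suc.IH) (auto dest: Ck_on_Suc_imp simp del: Ck_on.simps, auto)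
  then show ?case
    by (intro Ck_onI[where f'="\<lambda>x v. B (f x) (frechet_derivative g (at x) v)
        + B (frechet_derivative f (at x) v) (g x)"] assms(2))
      (use Suc.prems in \<open>simp_all add: frechet_derivative_works bounded_bilinear.FDERIV[OF assms(1)]\<close>)
qed

lemmas Ck_on_mult = Ck_on_bilinear[OF bounded_bilinear_mult]
lemmas Ck_on_scaleR = Ck_on_bilinear[OF bounded_bilinear_scaleR]
lemmas Ck_on_inner = Ck_on_bilinear[OF bounded_bilinear_inner]

lemma Ck_on_subset: "Ck_on k f U \<Longrightarrow> V \<subseteq> U \<Longrightarrow> Ck_on k f V"
  by (induction k arbitrary: f) (auto intro: continuous_on_subset)

lemma frechet_derivative_eq_sum_Basis:
  fixes f :: "'a::euclidean_space \<Rightarrow> 'b::real_normed_vector"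
  assumes "f differentiable (at x)"
  shows "frechet_derivative f (at x) v = (\<Sum>b\<in>Basis. (v \<bullet> b) *\<^sub>R frechet_derivative f (at x) b)"
proof -
  have "linear (frechet_derivative f (at x))" by (rule linear_frechet_derivative[OF assms])
  then show ?thesis
    by (subst (1) euclidean_representation[of v, symmetric]) (simp add: linear_sum linear_scale)
qed

text \<open>The chain rule evaluates the derivative of \<open>g\<close> in a direction that varies
  with the point, whereas \<open>Ck_on\<close> only knows fixed directions. Expanding that direction
  in the basis leaves products of a scalar function with a derivative of \<open>g\<close> in a fixed
  direction, to which the induction hypothesis applies.\<close>

lemma Ck_on_compose:
  assumes "open U" "open V"
  shows "Ck_on k f U \<Longrightarrow> Ck_on k g V \<Longrightarrow> f ` U \<subseteq> V \<Longrightarrow> Ck_on k (\<lambda>x. g (f x)) U"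
proof (induction k arbitrary: f g)
  case 0
  then show ?case by (auto intro: continuous_on_compose2)
next
  case (Suc k)
  show ?case
  proof (rule Ck_onI[OF _ _ assms(1)])
    show "((\<lambda>x. g (f x)) has_derivative (\<lambda>v. \<Sum>b\<in>Basis.
        (frechet_derivative f (at x) v \<bullet> b) *\<^sub>R frechet_derivative g (at (f x)) b)) (at x)"
      if "x \<in> U" for x
    proof -
      have "g differentiable (at (f x))" using Suc.prems that by auto
      moreover have "((\<lambda>x. g (f x)) has_derivative
          (\<lambda>v. frechet_derivative g (at (f x)) (frechet_derivative f (at x) v))) (at x)"
        using Suc.prems that
        by (intro has_derivative_compose[where f=f and g=g]) (auto simp: frechet_derivative_works)
      ultimately show ?thesis by (simp flip: frechet_derivative_eq_sum_Basis)
    qed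
    show "Ck_on k (\<lambda>x. \<Sum>b\<in>Basis.
        (frechet_derivative f (at x) v \<bullet> b) *\<^sub>R frechet_derivative g (at (f x)) b) U" for v
      using Suc.prems Ck_on_Suc_imp[OF Suc.prems(1)]
      by (intro Ck_on_sum Ck_on_scaleR Ck_on_inner Ck_on_const assms Suc.IH[of f "\<lambda>y. frechet_derivative g (at y) _"]) auto
  qed
qed

lemma Ck_on_minus: "open U \<Longrightarrow> Ck_on k f U \<Longrightarrow> Ck_on k (\<lambda>x. - f x) U"
  using Ck_on_scaleR[OF _ Ck_on_const[of U k "-1"]] by force

lemma Ck_on_linear_compose:
  "open U \<Longrightarrow> bounded_linear L \<Longrightarrow> Ck_on k f U \<Longrightarrow> Ck_on k (\<lambda>x. L (f x)) U"
  by (rule Ck_on_compose[of _ UNIV]) (auto intro: Ck_on_bounded_linear)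

lemma Ck_on_real:
  fixes f :: "real \<Rightarrow> real"
  assumes "\<And>x. x \<in> U \<Longrightarrow> (f has_real_derivative f' x) (at x)" "Ck_on k f' U" "open U"
  shows "Ck_on (Suc k) f U"
  by (rule Ck_onI[where f'="\<lambda>x v. f' x * v"])
    (use assms in \<open>auto simp: has_field_derivative_def intro!: Ck_on_mult Ck_on_const\<close>)

lemma Ck_on_real_deriv:
  fixes f :: "real \<Rightarrow> real"
  assumes "\<And>x. x \<in> U \<Longrightarrow> (f has_real_derivative f' x) (at x)" "Ck_on (Suc k) f U" "open U"
  shows "Ck_on k f' U"
proof -
  have "Ck_on k (\<lambda>x. frechet_derivative f (at x) 1) U" using assms(2) by simp
  moreover have "frechet_derivative f (at x) 1 = f' x" if "x \<in> U" for x
    using frechet_derivative_at[OF assms(1)[OF that, unfolded has_field_derivative_def]]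
    by (metis mult.right_neutral)
  ultimately show ?thesis using Ck_on_cong[OF assms(3)] by blast
qed

lemma Ck_on_real_inverse: "open U \<Longrightarrow> 0 \<notin> U \<Longrightarrow> Ck_on k (inverse :: real \<Rightarrow> real) U"
proof (induction k)
  case 0
  then show ?case by (auto intro!: continuous_intros)
next
  case (Suc k)
  show ?case
    by (rule Ck_on_real[where f'="\<lambda>x. - (inverse x * inverse x)"])
      (use Suc in \<open>auto intro!: Ck_on_minus Ck_on_mult derivative_eq_intros simp: power2_eq_square\<close>)
qed

lemma Ck_on_inverse:
  fixes f :: "'a::euclidean_space \<Rightarrow> real"
  assumes "open U" "Ck_on k f U" "\<And>x. x \<in> U \<Longrightarrow> f x \<noteq> 0"
  shows "Ck_on k (\<lambda>x. inverse (f x)) U"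
  by (rule Ck_on_compose[of _ "- {0}"]) (use assms in \<open>auto intro!: Ck_on_real_inverse\<close>)

lemma Ck_on_real_sqrt: "Ck_on k sqrt {0<..}"
proof (induction k)
  case 0
  then show ?case by (auto intro!: continuous_intros)
next
  case (Suc k)
  have "Ck_on k (\<lambda>x. inverse (sqrt x) * (1 / 2)) {0<..}"
    using Suc by (intro Ck_on_inverse Ck_on_mult Ck_on_const) auto
  then show ?case
    by (rule Ck_on_real[rotated]) (auto simp: divide_simps intro: DERIV_real_sqrt[THEN DERIV_cong])
qed

lemma Ck_on_sqrt:
  fixes f :: "'a::euclidean_space \<Rightarrow> real"
  assumes "open U" "Ck_on k f U" "\<And>x. x \<in> U \<Longrightarrow> f x > 0"
  shows "Ck_on k (\<lambda>x. sqrt (f x)) U"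
  by (rule Ck_on_compose[of _ "{0<..}"]) (use assms in \<open>auto intro!: Ck_on_real_sqrt\<close>)

lemma Ck_on_Un:
  assumes "Ck_on k f U" "Ck_on k f V" "open U" "open V"
  shows "Ck_on k f (U \<union> V)"
  using assms(1,2) by (induction k arbitrary: f) (auto intro: continuous_on_open_Un assms)

text \<open>Bootstrapping: the derivative of \<open>g\<close> is 1 / f'(g y), so each order of
  regularity of \<open>g\<close> yields the next one.\<close>

lemma Ck_on_real_inverse_function:
  fixes f g :: "real \<Rightarrow> real"
  assumes df: "\<And>x. (f has_real_derivative f' x) (at x)" and f': "\<And>k. Ck_on k f' UNIV"
    and nz: "\<And>x. f' x \<noteq> 0" and gf: "\<And>x. g (f x) = x" and fg: "\<And>y. f (g y) = y"
    and cont: "continuous_on UNIV g"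
  shows "Ck_on k g UNIV"
proof -
  have dg: "(g has_real_derivative inverse (f' (g y))) (at y)" for y
  proof (rule DERIV_inverse_function[where f=f and a="y - 1" and b="y + 1"])
    show "isCont g y" using cont by (simp add: continuous_on_eq_continuous_within)
  qed (use df nz fg in auto)
  show ?thesis
  proof (induction k)
    case 0
    then show ?case using cont by simp
  next
    case (Suc k)
    show ?case
      by (rule Ck_on_real[OF dg])
        (auto intro!: Ck_on_inverse Ck_on_compose[of _ UNIV _ g f'] Suc f' nz)
  qed
qed

subsection \<open>Smooth functions with prescribed zero set\<close>

text \<open>The classical flat function exp (-1/x) is the case \<open>n = 0\<close>; the powers of
  1/x close the family under differentiation.\<close>

definition flat :: "nat \<Rightarrow> real \<Rightarrow> real" where
  "flat n x = (if x > 0 then exp (- inverse x) * inverse x ^ n else 0)"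

text \<open>A single term of the series of exp (1/x) already dominates x^-(n+2), up to the
  factorial. The quadratic bound makes the difference quotient at \<open>0\<close> tend to
  0.\<close>

lemma flat_le: "\<bar>flat n x\<bar> \<le> fact (n + 2) * x\<^sup>2"
proof (cases "x > 0")
  case True
  have s: "(\<lambda>k. inverse x ^ k /\<^sub>R fact k) sums exp (inverse x)" by (rule exp_converges)
  have "inverse x ^ (n + 2) / fact (n + 2) \<le> exp (inverse x)"
    using sum_le_suminf[OF sums_summable[OF s], of "{n + 2}"] sums_unique[OF s] True
    by (simp add: divide_inverse mult.commute)
  then have "inverse x ^ (n + 2) \<le> fact (n + 2) * exp (inverse x)"
    by (simp only: pos_divide_le_eq[OF fact_gt_zero] mult.commute)
  then have "inverse x ^ (n + 2) * (exp (- inverse x) * x\<^sup>2)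
      \<le> fact (n + 2) * exp (inverse x) * (exp (- inverse x) * x\<^sup>2)"
    by (intro mult_right_mono) auto
  also have "\<dots> = fact (n + 2) * x\<^sup>2" by (simp add: exp_minus)
  also have "inverse x ^ (n + 2) * (exp (- inverse x) * x\<^sup>2) = flat n x"
  proof -
    have "inverse x ^ (n + 2) * x\<^sup>2 = inverse x ^ n"
      using True by (simp add: power_add divide_simps power2_eq_square)
    then show ?thesis using True by (simp add: flat_def mult_ac)
  qed
  finally show ?thesis using True by (simp add: flat_def)
qed (simp add: flat_def)

lemma DERIV_flat: "(flat n has_real_derivative flat (n + 2) x - n * flat (n + 1) x) (at x)"
proof (cases x "0::real" rule: linorder_cases)
  case greater
  have *: "((\<lambda>u. exp (- u) * u ^ n) has_real_derivative
      (- exp (- u) * u ^ n + real n * exp (- u) * u ^ (n - 1))) (at u)" for u :: real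
    by (auto intro!: derivative_eq_intros)
  have "(inverse has_real_derivative - (inverse x)\<^sup>2) (at x)"
    using greater by (auto intro!: derivative_eq_intros simp: power2_eq_square)
  from DERIV_chain2[OF * this] have "((\<lambda>x. exp (- inverse x) * inverse x ^ n) has_real_derivative
      flat (n + 2) x - n * flat (n + 1) x) (at x)"
    by (rule DERIV_cong) (use greater in \<open>cases n, auto simp: flat_def algebra_simps power2_eq_square\<close>)
  then show ?thesis
    by (rule has_field_derivative_transform_within_open[where S="{0<..}"])
      (use greater in \<open>auto simp: flat_def\<close>)
next
  case less
  have "((\<lambda>x. 0) has_real_derivative flat (n + 2) x - n * flat (n + 1) x) (at x)"
    using less by (simp add: flat_def)
  then show ?thesis
    by (rule has_field_derivative_transform_within_open[where S="{..<0}"])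
      (use less in \<open>auto simp: flat_def\<close>)
next
  case equal
  have "((\<lambda>h. flat n h / h) \<longlongrightarrow> 0) (at 0)"
  proof (rule Lim_null_comparison)
    show "\<forall>\<^sub>F h in at 0. norm (flat n h / h) \<le> fact (n + 2) * \<bar>h\<bar>"
    proof (intro always_eventually allI)
      fix h :: real
      show "norm (flat n h / h) \<le> fact (n + 2) * \<bar>h\<bar>"
        using flat_le[of n h]
        by (cases "h = 0") (auto simp: divide_simps power2_eq_square abs_mult mult.assoc)
    qed
    show "((\<lambda>h. fact (n + 2) * \<bar>h\<bar>) \<longlongrightarrow> (0::real)) (at 0)"
      by (auto intro!: tendsto_eq_intros)
  qed
  then show ?thesis using equal by (simp add: DERIV_def flat_def)
qed

lemma Ck_on_flat: "Ck_on k (flat n) UNIV"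
proof (induction k arbitrary: n)
  case 0
  then show ?case
    using DERIV_flat DERIV_continuous by (force intro: continuous_at_imp_continuous_on)
next
  case (Suc k)
  have "Ck_on k (\<lambda>x. flat (n + 2) x + - (real n * flat (n + 1) x)) UNIV"
    by (intro Ck_on_add Ck_on_minus Ck_on_mult Ck_on_const Suc) auto
  then show ?case by (intro Ck_on_real[OF DERIV_flat]) auto
qed

lemma flat_pos_iff: "flat n x > 0 \<longleftrightarrow> x > 0"
  by (simp add: flat_def)

lemma flat_nonneg: "flat n x \<ge> 0"
  by (simp add: flat_def)

lemma Ck_on_deriv_iterate:
  fixes f :: "real \<Rightarrow> real"
  assumes "\<And>k. Ck_on k f UNIV"
  shows "Ck_on k ((deriv ^^ n) f) UNIV"
    and "((deriv ^^ n) f has_real_derivative (deriv ^^ Suc n) f x) (at x)"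
proof -
  have d: "(g has_real_derivative deriv g x) (at x)" if "Ck_on (Suc k) g UNIV"
    for g :: "real \<Rightarrow> real" and x k
    using that by (simp add: DERIV_deriv_iff_real_differentiable)
  have ck: "\<forall>k. Ck_on k ((deriv ^^ n) f) UNIV" for n
  proof (induction n)
    case (Suc n)
    then have *: "Ck_on (Suc k) ((deriv ^^ n) f) UNIV" for k by blast
    show ?case using Ck_on_real_deriv[OF d[OF *] *] by simp
  qed (use assms in auto)
  then show "Ck_on k ((deriv ^^ n) f) UNIV" by blast
  show "((deriv ^^ n) f has_real_derivative (deriv ^^ Suc n) f x) (at x)"
    using d[OF ck[rule_format, of "Suc 0" n]] by simp
qed

definition bump :: "real \<Rightarrow> real" where
  "bump x = flat 0 (1 - x\<^sup>2)"

lemma bump_nonneg: "bump x \<ge> 0"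
  and bump_pos_iff: "bump x > 0 \<longleftrightarrow> \<bar>x\<bar> < 1"
  by (auto simp: bump_def flat_pos_iff flat_nonneg abs_square_less_1)

lemma Ck_on_bump: "Ck_on k bump UNIV"
proof -
  have "Ck_on k (\<lambda>x::real. 1 + - (x * x)) UNIV"
    by (intro Ck_on_add Ck_on_minus Ck_on_mult Ck_on_const Ck_on_bounded_linear) auto
  from Ck_on_compose[OF _ _ this Ck_on_flat] show ?thesis
    by (simp add: bump_def[abs_def] power2_eq_square)
qed

lemma bounded_deriv_iterate_bump: "\<exists>M. \<forall>x. \<bar>(deriv ^^ n) bump x\<bar> \<le> M"
proof -
  have zero: "(deriv ^^ n) bump x = 0" if "\<bar>x\<bar> > 1" for x
    using that
  proof (induction n arbitrary: x)
    case 0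
    then show ?case using bump_pos_iff[of x] bump_nonneg[of x] by simp
  next
    case (Suc n)
    have op: "open {x::real. \<bar>x\<bar> > 1}" by (intro open_Collect_less continuous_intros)
    have "((deriv ^^ n) bump has_real_derivative 0) (at x)"
      by (rule has_field_derivative_transform_within_open[where f="\<lambda>x. 0", OF _ op])
        (use Suc in auto)
    then show ?case by (simp add: DERIV_imp_deriv)
  qed
  have "continuous_on {-1..1} ((deriv ^^ n) bump)"
    using Ck_on_deriv_iterate(1)[OF Ck_on_bump, of 0 n] by (auto intro: continuous_on_subset)
  then have "bounded ((deriv ^^ n) bump ` {-1..1})"
    by (intro compact_imp_bounded compact_continuous_image) auto
  then obtain M where M: "\<forall>x\<in>{-1..1}. \<bar>(deriv ^^ n) bump x\<bar> \<le> M"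
    by (auto simp: bounded_iff)
  have "\<bar>(deriv ^^ n) bump x\<bar> \<le> max M 0" for x
  proof (cases "x \<in> {-1..1}")
    case False
    then show ?thesis using zero[of x] by auto
  qed (use M in force)
  then show ?thesis by blast
qed

lemma Ck_on_UNIV_if_DERIV_sequence:
  fixes D :: "nat \<Rightarrow> real \<Rightarrow> real"
  assumes "\<And>n x. (D n has_real_derivative D (Suc n) x) (at x)"
  shows "Ck_on k (D n) UNIV"
proof (induction k arbitrary: n)
  case 0
  then show ?case
    using assms DERIV_continuous by (force intro: continuous_at_imp_continuous_on)
next
  case (Suc k)
  then show ?case by (intro Ck_on_real[OF assms]) auto
qed

text \<open>The weights \<open>r\<^sup>n / 2\<^sup>n\<close> beat the factors \<open>r\<^sup>-\<^sup>j\<close> created by \<open>j\<close> differentiations.\<close>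

lemma smooth_function_with_zero_set:
  fixes K :: "real set"
  assumes "closed K"
  obtains B :: "real \<Rightarrow> real" where "\<And>k. Ck_on k B UNIV" "\<And>x. B x \<ge> 0" "\<And>x. B x = 0 \<longleftrightarrow> x \<in> K"
proof -
  define q :: "nat \<Rightarrow> rat" where "q = from_nat"
  have q: "surj q" by (simp add: q_def surj_from_nat)
  \<comment> \<open>As \<open>n\<close> varies, these are all pairs of a rational centre and a
    radius 1 / (m + 1), so the balls indexed by \<open>J\<close> exhaust the complement of
    \<open>K\<close>.\<close>
  define c where "c n = (of_rat (q (fst (prod_decode n))) :: real)" for n
  define r where "r n = inverse (real (Suc (snd (prod_decode n))))" for n
  define J where "J = {n. ball (c n) (r n) \<subseteq> - K}"
  have r: "0 < r n" "r n \<le> 1" for n by (auto simp: r_def field_simps)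
  define w where "w n = (if n \<in> J then (r n / 2) ^ n else 0)" for n
  define b where "b j x n = w n * inverse (r n) ^ j * (deriv ^^ j) bump ((x - c n) / r n)"
    for j n and x :: real
  define D where "D j x = (\<Sum>n. b j x n)" for j and x :: real
  have w: "0 \<le> w n" for n using r[of n] by (auto simp: w_def)
  have wsum: "summable (\<lambda>n. w n * inverse (r n) ^ j)" for j
  proof (rule summable_comparison_test_ev)
    show "summable (\<lambda>n. (1 / 2) ^ n :: real)" by simp
    show "\<forall>\<^sub>F n in sequentially. norm (w n * inverse (r n) ^ j) \<le> (1 / 2) ^ n"
      using eventually_ge_at_top[of j]
    proof eventually_elim
      case (elim n)
      have "w n * inverse (r n) ^ j \<le> (r n / 2) ^ n * inverse (r n) ^ j"
        using r[of n] by (auto simp: w_def)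
      also have "\<dots> = r n ^ (n - j) * (1 / 2) ^ n"
        using r[of n] elim by (simp add: power_divide power_diff field_simps)
      also have "\<dots> \<le> (1 / 2) ^ n"
        using r[of n] by (intro mult_left_le_one_le power_le_one) auto
      finally show ?case using w[of n] r[of n] by (simp add: abs_mult)
    qed
  qed
  have db: "((\<lambda>x. b j x n) has_real_derivative b (Suc j) x n) (at x)" for j n x
  proof -
    have "((\<lambda>x. (x - c n) / r n) has_real_derivative inverse (r n)) (at x)"
      using r[of n] by (auto intro!: derivative_eq_intros simp: divide_simps)
    from DERIV_cmult[OF DERIV_chain2[OF Ck_on_deriv_iterate(2)[OF Ck_on_bump] this],
        of "w n * inverse (r n) ^ j"]
    show ?thesis by (simp add: b_def mult_ac)
  qed
  have bb: "\<exists>L. summable L \<and> (\<forall>n x. \<bar>b j x n\<bar> \<le> L n)" for j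
  proof -
    obtain M where M: "\<And>x. \<bar>(deriv ^^ j) bump x\<bar> \<le> M" using bounded_deriv_iterate_bump by blast
    show ?thesis
    proof (intro exI[of _ "\<lambda>n. w n * inverse (r n) ^ j * M"] conjI allI)
      show "summable (\<lambda>n. w n * inverse (r n) ^ j * M)" by (intro summable_mult2 wsum)
      show "\<bar>b j x n\<bar> \<le> w n * inverse (r n) ^ j * M" for n x
        using M[of "(x - c n) / r n"] w[of n] r[of n] unfolding b_def
        by (simp add: abs_mult mult_left_mono)
    qed
  qed
  have bs: "summable (b j x)" for j x
    using bb[of j] by (auto intro: summable_comparison_test')
  have dD: "(D j has_real_derivative D (Suc j) x) (at x)" for j x
  proof -
    obtain L where L: "summable L" "\<And>n x. \<bar>b (Suc j) x n\<bar> \<le> L n" using bb by blast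
    show ?thesis unfolding D_def[abs_def]
    proof (rule DERIV_series'[where a="x - 1" and b="x + 1" and L=L])
      show "\<bar>b j y n - b j z n\<bar> \<le> L n * \<bar>y - z\<bar>" for n y z
        using field_differentiable_bound[of UNIV "\<lambda>x. b j x n" "\<lambda>x. b (Suc j) x n" "L n" y z]
          db L(2) by auto
    qed (use db bs L in auto)
  qed
  show ?thesis
  proof (rule that[of "D 0"])
    show "Ck_on k (D 0) UNIV" for k by (rule Ck_on_UNIV_if_DERIV_sequence[of D, OF dD])
    have b0: "b 0 x n \<ge> 0" for x n using w[of n] by (simp add: b_def bump_nonneg)
    then show "D 0 x \<ge> 0" for x unfolding D_def by (intro suminf_nonneg bs)
    have "D 0 x = 0 \<longleftrightarrow> (\<forall>n. b 0 x n = 0)" for x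
      unfolding D_def using suminf_eq_zero_iff[OF bs b0] by blast
    moreover have "b 0 x n = 0 \<longleftrightarrow> n \<notin> J \<or> x \<notin> ball (c n) (r n)" for x n
      using bump_pos_iff[of "(x - c n) / r n"] bump_nonneg[of "(x - c n) / r n"] r[of n]
      by (auto simp: b_def w_def dist_real_def abs_minus_commute)
    moreover have "\<exists>n\<in>J. x \<in> ball (c n) (r n)" if x: "x \<notin> K" for x
    proof -
      obtain e where e: "e > 0" "ball x e \<subseteq> - K"
        using assms x open_Compl openE[of "- K" x] by blast
      obtain m where m: "inverse (real (Suc m)) < e / 2"
        using reals_Archimedean[of "e / 2"] e by auto
      obtain s :: rat where s: "\<bar>of_rat s - x\<bar> < inverse (real (Suc m))"
      proof -
        obtain s where "x < of_rat s" "of_rat s < x + inverse (real (Suc m))"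
          using Rats_dense_in_real[of x "x + inverse (real (Suc m))"] by (auto elim!: Rats_cases)
        then show ?thesis using that[of s] by simp
      qed
      obtain i where i: "q i = s" using q by (metis surjD)
      define n where "n = prod_encode (i, m)"
      have cn: "c n = of_rat s" "r n = inverse (real (Suc m))"
        using i by (auto simp: c_def r_def n_def)
      have "ball (c n) (r n) \<subseteq> ball x e"
        using s m unfolding cn by (auto simp: dist_real_def)
      then show ?thesis using s e cn
        by (intro bexI[of _ n]) (auto simp: J_def dist_real_def)
    qed
    moreover have "x \<notin> K" if "n \<in> J" "x \<in> ball (c n) (r n)" for n x
      using that by (auto simp: J_def)
    ultimately show "D 0 x = 0 \<longleftrightarrow> x \<in> K" for x
      by metis
  qed
qed

subsection \<open>Convex profiles\<close>

lemma antiderivative_real: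
  fixes f :: "real \<Rightarrow> real"
  assumes "continuous_on UNIV f"
  obtains F where "F c = 0" "\<And>x. (F has_real_derivative f x) (at x)"
proof -
  have "isCont f x" for x using assms by (simp add: continuous_on_eq_continuous_within)
  then obtain F where F: "\<And>x. (F has_real_derivative f x) (at x)"
    using einterval_antiderivative[of "-\<infinity>" \<infinity> f]
    by (auto simp: has_real_derivative_iff_has_vector_derivative)
  have "((\<lambda>x. F x - F c) has_real_derivative f x) (at x)" for x
    using DERIV_diff[OF F[of x] DERIV_const[of "F c"]] by simp
  then show ?thesis using that[of "\<lambda>x. F x - F c"] by simp
qed

lemma DERIV_le_imp_diff_le:
  fixes f g :: "real \<Rightarrow> real"
  assumes "a \<le> b" "\<And>x. a \<le> x \<Longrightarrow> x \<le> b \<Longrightarrow> (f has_real_derivative f' x) (at x)"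
    and "\<And>x. a \<le> x \<Longrightarrow> x \<le> b \<Longrightarrow> (g has_real_derivative g' x) (at x)"
    and "\<And>x. a \<le> x \<Longrightarrow> x \<le> b \<Longrightarrow> f' x \<le> g' x"
  shows "f b - f a \<le> g b - g a"
proof -
  have "g a - f a \<le> g b - f b"
  proof (rule DERIV_nonneg_imp_nondecreasing[where f="\<lambda>x. g x - f x", OF assms(1)])
    show "\<exists>y. ((\<lambda>x. g x - f x) has_real_derivative y) (at x) \<and> 0 \<le> y"
      if "a \<le> x" "x \<le> b" for x
      using assms(4)[OF that] by (intro exI[of _ "g' x - f' x"] conjI DERIV_diff assms that) auto
  qed
  then show ?thesis by simp
qed

text \<open>The normalisation \<open>w t = 2\<close> up to 1/4 forces h t = t^2 there, which gives
  \<open>h\<close> the smooth square root \<open>t\<close> around its minimum. The bound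
  \<open>w t \<le> 2\<close> keeps \<open>h t\<close> below t^2 for \<open>t \<ge> 0\<close>, which
  leaves room on the level set above the points of \<open>K\<close>.\<close>

locale profile =
  fixes K :: "real set" and h h' w :: "real \<Rightarrow> real"
  assumes DERIV_h: "(h has_real_derivative h' t) (at t)"
    and DERIV_h': "(h' has_real_derivative w t) (at t)"
    and Ck_w: "Ck_on n w UNIV"
    and w_nonneg: "w t \<ge> 0"
    and w_eq_0_iff: "w t = 0 \<longleftrightarrow> t \<in> K"
    and w_le_2: "w t \<le> 2"
    and w_eq_2: "t \<le> 1 / 4 \<Longrightarrow> w t = 2"
    and h_0: "h 0 = 0"
    and h'_0: "h' 0 = 0"

text \<open>The quotient 2 B / (A + B) is a smooth Urysohn function: \<open>B\<close> vanishes
  exactly on \<open>K\<close> and \<open>A\<close> exactly up to 1/4. These sets are disjoint, so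
  the denominator is positive everywhere.\<close>

lemma profile_exists:
  assumes "closed K" "K \<subseteq> {1 / 2..}"
  shows "\<exists>h h' w. profile K h h' w"
proof -
  obtain B :: "real \<Rightarrow> real" where B: "\<And>k. Ck_on k B UNIV" "\<And>x. B x \<ge> 0" "\<And>x. B x = 0 \<longleftrightarrow> x \<in> K"
    using smooth_function_with_zero_set[OF assms(1)] by metis
  define A :: "real \<Rightarrow> real" where "A t = flat 0 (t + - (1 / 4))" for t
  have A: "A t \<ge> 0" "A t > 0 \<longleftrightarrow> t > 1 / 4" for t
    by (auto simp: A_def flat_pos_iff flat_nonneg)
  have CkA: "Ck_on k A UNIV" for k
    unfolding A_def[abs_def]
    by (rule Ck_on_compose[OF open_UNIV open_UNIV _ Ck_on_flat])
      (intro Ck_on_add Ck_on_bounded_linear[OF _ bounded_linear_ident] Ck_on_const, auto)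
  have pos: "A t + B t > 0" for t
  proof (cases "t > 1 / 4")
    case False
    then have "t \<notin> K" using assms(2) by auto
    then show ?thesis using A(1)[of t] B(2,3)[of t] by linarith
  qed (use A[of t] B(2)[of t] in linarith)
  define w where "w t = 2 * B t * inverse (A t + B t)" for t
  have Ckw: "Ck_on k w UNIV" for k
    unfolding w_def[abs_def] using pos
    by (intro Ck_on_mult Ck_on_inverse Ck_on_add B CkA Ck_on_const) (auto simp: less_le)
  obtain h' where h': "h' 0 = 0" "\<And>x. (h' has_real_derivative w x) (at x)"
    using antiderivative_real[OF Ck_on_continuous[OF Ckw]] by metis
  have "continuous_on UNIV h'"
    using h'(2) DERIV_continuous by (force intro: continuous_at_imp_continuous_on)
  then obtain h where h: "h 0 = 0" "\<And>x. (h has_real_derivative h' x) (at x)"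
    using antiderivative_real by metis
  have "profile K h h' w"
  proof
    show "w t \<ge> 0" "w t = 0 \<longleftrightarrow> t \<in> K" "w t \<le> 2" for t
      using pos[of t] A(1)[of t] B(2,3)[of t] by (auto simp: w_def divide_simps)
    show "w t = 2" if "t \<le> 1 / 4" for t
      using A[of t] pos[of t] that by (auto simp: w_def divide_simps)
  qed (use h h' Ckw in auto)
  then show ?thesis by blast
qed

context profile
begin

lemma Ck_h': "Ck_on n h' UNIV"
  by (rule Ck_on_Suc_imp, rule Ck_on_real[OF DERIV_h' Ck_w]) auto

lemma Ck_h: "Ck_on n h UNIV"
  by (rule Ck_on_Suc_imp, rule Ck_on_real[OF DERIV_h Ck_h']) auto

lemma h'_mono: "s \<le> t \<Longrightarrow> h' s \<le> h' t"
  using DERIV_nonneg_imp_nondecreasing DERIV_h' w_nonneg by metis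

lemma h'_eq:
  assumes "t \<le> 1 / 4"
  shows "h' t = 2 * t"
proof -
  have d: "((\<lambda>t. 2 * t) has_real_derivative 2) (at t)" for t :: real
    by (auto intro!: derivative_eq_intros)
  have "h' t - h' s = 2 * t - 2 * s" if "s \<le> t" "t \<le> 1 / 4" for s t
    using that DERIV_le_imp_diff_le[OF that(1) DERIV_h' d] DERIV_le_imp_diff_le[OF that(1) d DERIV_h']
    by (force simp: w_eq_2)
  from this[of t 0] this[of 0 t] show ?thesis using assms by (cases "t \<le> 0") (auto simp: h'_0)
qed

lemma h_eq:
  assumes "t \<le> 1 / 4"
  shows "h t = t\<^sup>2"
proof -
  have d: "((\<lambda>t. t\<^sup>2) has_real_derivative 2 * t) (at t)" for t :: real
    by (auto intro!: derivative_eq_intros)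
  have "h t - h s = t\<^sup>2 - s\<^sup>2" if "s \<le> t" "t \<le> 1 / 4" for s t
    using that DERIV_le_imp_diff_le[OF that(1) DERIV_h d] DERIV_le_imp_diff_le[OF that(1) d DERIV_h]
    by (force simp: h'_eq)
  from this[of t 0] this[of 0 t] show ?thesis using assms by (cases "t \<le> 0") (auto simp: h_0)
qed

lemma h'_le:
  assumes "0 \<le> t"
  shows "h' t \<le> 2 * t"
proof -
  have d: "((\<lambda>t. 2 * t) has_real_derivative 2) (at t)" for t :: real
    by (auto intro!: derivative_eq_intros)
  show ?thesis using DERIV_le_imp_diff_le[OF assms DERIV_h' d] w_le_2 by (simp add: h'_0)
qed

lemma h_le:
  assumes "0 \<le> t"
  shows "h t \<le> t\<^sup>2"
proof -
  have d: "((\<lambda>t. t\<^sup>2) has_real_derivative 2 * t) (at t)" for t :: real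
    by (auto intro!: derivative_eq_intros)
  show ?thesis using DERIV_le_imp_diff_le[OF assms DERIV_h d] h'_le by (simp add: h_0)
qed

lemma h'_ge: "1 / 4 \<le> t \<Longrightarrow> 1 / 2 \<le> h' t"
  using h'_mono[of "1 / 4" t] h'_eq[of "1 / 4"] by simp

lemma h'_eq_0_iff: "h' t = 0 \<longleftrightarrow> t = 0"
  using h'_eq[of t] h'_ge[of t] by (cases "t \<le> 1 / 4") auto

text \<open>By convexity the slope from 1/4 on stays at least \<open>h' (1 / 4)\<close>, which is
  1/2, even where \<open>w\<close> vanishes.\<close>

lemma h_expanding:
  assumes "1 / 4 \<le> s" "s \<le> t"
  shows "(t - s) / 2 \<le> h t - h s"
proof -
  have d: "((\<lambda>t. t / 2) has_real_derivative 1 / 2) (at t)" for t :: real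
    by (auto intro!: derivative_eq_intros)
  have "t / 2 - s / 2 \<le> h t - h s"
    using DERIV_le_imp_diff_le[OF assms(2) d DERIV_h] h'_ge assms by force
  then show ?thesis by argo
qed

lemma h_Lipschitz:
  assumes "0 \<le> s" "s \<le> t"
  shows "h t - h s \<le> 2 * t * (t - s)" "h t - h s \<ge> 0"
proof -
  have d: "((\<lambda>x. 2 * t * x) has_real_derivative 2 * t) (at x)" for x :: real
    by (auto intro!: derivative_eq_intros)
  have "h' x \<le> 2 * t" if "x \<le> t" for x using that h'_mono[OF that] h'_le[of t] assms by linarith
  then have "h t - h s \<le> 2 * t * t - 2 * t * s"
    using DERIV_le_imp_diff_le[OF assms(2) DERIV_h d] by force
  then show "h t - h s \<le> 2 * t * (t - s)" by argo
  have d: "((\<lambda>x. 0) has_real_derivative 0) (at x)" for x :: real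
    by (auto intro!: derivative_eq_intros)
  have "h' x \<ge> 0" if "x \<ge> 0" for x using h'_mono[OF that] h'_0 by simp
  then show "h t - h s \<ge> 0"
    using DERIV_le_imp_diff_le[OF assms(2) d DERIV_h] assms by force
qed

lemma h_pos:
  assumes "t > 0"
  shows "h t > 0"
proof (cases "t \<le> 1 / 4")
  case False
  then show ?thesis using h_expanding[of "1 / 4" t] h_eq[of "1 / 4"] by (simp add: power2_eq_square)
qed (use h_eq assms in auto)

lemma h_nonneg: "h t \<ge> 0"
  using h_pos[of t] h_eq[of t] by (cases "t > 0") auto

lemma bounded_if_h_le_1:
  assumes "h t \<le> 1"
  shows "\<bar>t\<bar> < 3"
proof (cases "t \<le> 1 / 4")
  case True
  then have "t\<^sup>2 \<le> 1" using assms h_eq by simp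
  then show ?thesis using abs_square_le_1[of t] by simp
next
  case False
  then show ?thesis
    using h_expanding[of "1 / 4" t] h_eq[of "1 / 4"] assms by (simp add: power2_eq_square)
qed

text \<open>The square root of \<open>h\<close> taken with the sign of \<open>t\<close>. The plain
  \<open>sqrt (h t)\<close> has a corner at \<open>0\<close>; the branches agree for 0 < t < 1/4, so
  smoothness can be checked on two overlapping open half-lines.\<close>

definition k :: "real \<Rightarrow> real" where
  "k t = (if t < 1 / 4 then t else sqrt (h t))"

definition k' :: "real \<Rightarrow> real" where
  "k' t = (if t < 1 / 4 then 1 else h' t * inverse (2 * sqrt (h t)))"

lemma k_squared: "(k t)\<^sup>2 = h t"
  using h_eq[of t] h_nonneg[of t] by (auto simp: k_def)

lemma k_eq_sqrt: "t > 0 \<Longrightarrow> k t = sqrt (h t)"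
  by (auto simp: k_def h_eq)

lemma k'_eq: "t > 0 \<Longrightarrow> k' t = h' t * inverse (2 * sqrt (h t))"
  by (auto simp: k'_def h_eq h'_eq)

lemma DERIV_k: "(k has_real_derivative k' t) (at t)"
proof (cases "t < 1 / 4")
  case True
  have "((\<lambda>x. x) has_real_derivative k' t) (at t)"
    using True by (simp add: k'_def)
  then show ?thesis
    by (rule has_field_derivative_transform_within_open[where S="{..<1 / 4}"])
      (use True in \<open>auto simp: k_def\<close>)
next
  case False
  then have t: "t > 0" by simp
  have "((\<lambda>x. sqrt (h x)) has_real_derivative inverse (sqrt (h t)) / 2 * h' t) (at t)"
    by (rule DERIV_chain2[OF DERIV_real_sqrt DERIV_h]) (use h_pos[OF t] in auto)
  then have "((\<lambda>x. sqrt (h x)) has_real_derivative k' t) (at t)"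
    by (rule DERIV_cong) (simp add: k'_eq[OF t] field_simps)
  then show ?thesis
    by (rule has_field_derivative_transform_within_open[where S="{0<..}"])
      (use t in \<open>auto simp: k_eq_sqrt\<close>)
qed

lemma Ck_k': "Ck_on n k' UNIV"
proof -
  have "Ck_on n k' {..<1 / 4}"
    by (rule Ck_on_cong[OF _ Ck_on_const[of _ _ 1]]) (auto simp: k'_def)
  moreover have "Ck_on n k' {0<..}"
  proof (rule Ck_on_cong)
    show "Ck_on n (\<lambda>t. h' t * inverse (2 * sqrt (h t))) {0<..}"
      using h_pos by (intro Ck_on_mult Ck_on_inverse Ck_on_sqrt Ck_on_const
          Ck_on_subset[OF Ck_h] Ck_on_subset[OF Ck_h']) (auto simp: less_le)
  qed (auto simp: k'_eq)
  ultimately have "Ck_on n k' ({..<1 / 4} \<union> {0<..})" by (rule Ck_on_Un) auto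
  moreover have "{..<1 / 4} \<union> {0<..} = (UNIV :: real set)" by auto
  ultimately show ?thesis by simp
qed

lemma Ck_k: "Ck_on n k UNIV"
  by (rule Ck_on_Suc_imp, rule Ck_on_real[OF DERIV_k Ck_k']) auto

lemma k'_pos: "k' t > 0"
proof (cases "t < 1 / 4")
  case False
  then show ?thesis using h'_ge[of t] h_pos[of t] by (simp add: k'_def)
qed (simp add: k'_def)

lemma k_strict_mono: "s < t \<Longrightarrow> k s < k t"
  using DERIV_pos_imp_increasing DERIV_k k'_pos by metis

lemma bij_k: "bij k"
proof (rule bijI)
  show "inj k"
    by (rule strict_mono_imp_inj_on) (simp add: strict_mono_def k_strict_mono)
  show "surj k"
  proof -
    have "\<exists>t. y = k t" for y
    proof (cases "y < 1 / 4")
      case True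
      then show ?thesis by (intro exI[of _ y]) (simp add: k_def)
    next
      case False
      \<comment> \<open>Chosen so that \<open>h_expanding\<close>, applied from 1/4 to
        \<open>T\<close>, gives h T \<ge> (T - 1/4) / 2 = y^2.\<close>
      define T where "T = 1 / 4 + 2 * y\<^sup>2"
      have "\<exists>t\<ge>1 / 4. t \<le> T \<and> h t = y\<^sup>2"
      proof (rule IVT)
        have "(1 / 4 :: real)\<^sup>2 \<le> y\<^sup>2" using False by (intro power_mono) auto
        then show "h (1 / 4) \<le> y\<^sup>2" by (simp add: h_eq)
        show "y\<^sup>2 \<le> h T" using h_expanding[of "1 / 4" T] h_nonneg[of "1 / 4"] by (simp add: T_def)
      qed (use DERIV_h DERIV_isCont in \<open>auto simp: T_def\<close>)
      then obtain t where "t \<ge> 1 / 4" "h t = y\<^sup>2" by blast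
      then show ?thesis using False by (intro exI[of _ t]) (simp add: k_def)
    qed
    then show ?thesis by (simp add: surj_def)
  qed
qed

definition a :: "real \<Rightarrow> real" where "a = inv k"

lemma a_k: "a (k t) = t" and k_a: "k (a s) = s"
  using bij_k by (simp_all add: a_def bij_is_inj bij_is_surj surj_f_inv_f)

lemma Ck_a: "Ck_on n a UNIV"
proof (rule Ck_on_real_inverse_function[OF DERIV_k Ck_k' _ a_k k_a])
  have "isCont a (k t)" for t
    by (rule isCont_inverse_function[of 1 t a k]) (use a_k DERIV_isCont[OF DERIV_k] in auto)
  then have "isCont a s" for s by (metis k_a)
  then show "continuous_on UNIV a" by (simp add: continuous_at_imp_continuous_on)
qed (use k'_pos in \<open>auto simp: less_le\<close>)

end

subsection \<open>Cantor sets and Hausdorff dimension\<close>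

primrec stage :: "real \<Rightarrow> nat \<Rightarrow> real set" where
  "stage r 0 = {0..1}"
| "stage r (Suc n) = (\<lambda>x. r * x) ` stage r n \<union> (\<lambda>x. r * x + (1 - r)) ` stage r n"

definition cantor :: "real \<Rightarrow> real set" where
  "cantor r = (\<Inter>n. stage r n)"

text \<open>The address map of the two contractions \<open>r * x\<close> and
  \<open>r * x + (1 - r)\<close>: the sequence \<open>d\<close> tells which contraction is applied
  at each level. The digits 0 and 1 - r make the sums fill out the range from 0 to 1.\<close>

definition digit_sum :: "real \<Rightarrow> (nat \<Rightarrow> bool) \<Rightarrow> real" where
  "digit_sum r d = (\<Sum>i. (1 - r) * of_bool (d i) * r ^ i)"

lemma cantor_stage_eq: "cantor_stage n = stage (1 / 3) n"
  by (induction n) (simp_all add: field_simps)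

lemma standard_cantor_set_eq: "standard_cantor_set = cantor (1 / 3)"
  by (simp add: standard_cantor_set_def cantor_def cantor_stage_eq)

context
  fixes r :: real
  assumes r: "0 < r" "r \<le> 1 / 2"
begin

lemma summable_digits: "summable (\<lambda>i. (1 - r) * of_bool (d i) * r ^ i)"
proof (rule summable_comparison_test')
  show "summable (\<lambda>i. r ^ i)" using r by simp
  show "norm ((1 - r) * of_bool (d n) * r ^ n) \<le> r ^ n" for n
    using r by (auto simp: abs_mult mult_left_le_one_le)
qed

lemma digit_sum_bounds: "0 \<le> digit_sum r d" "digit_sum r d \<le> 1"
proof -
  show "0 \<le> digit_sum r d"
    unfolding digit_sum_def using r by (intro suminf_nonneg summable_digits) auto
  have "digit_sum r d \<le> (\<Sum>i. (1 - r) * r ^ i)"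
    unfolding digit_sum_def using r
    by (intro suminf_le summable_digits summable_mult) (auto simp: mult_left_le)
  also have "\<dots> = 1" using r by (simp add: suminf_mult suminf_geometric)
  finally show "digit_sum r d \<le> 1" .
qed

lemma digit_sum_unfold: "digit_sum r d = (1 - r) * of_bool (d 0) + r * digit_sum r (\<lambda>i. d (Suc i))"
proof -
  have "digit_sum r d = (\<Sum>i. (1 - r) * of_bool (d (Suc i)) * r ^ Suc i) + (1 - r) * of_bool (d 0)"
    unfolding digit_sum_def by (subst suminf_split_head[OF summable_digits]) simp
  also have "(\<Sum>i. (1 - r) * of_bool (d (Suc i)) * r ^ Suc i) = r * digit_sum r (\<lambda>i. d (Suc i))"
    unfolding digit_sum_def
    by (subst suminf_mult[OF summable_digits[of "\<lambda>i. d (Suc i)"], symmetric]) (simp add: mult_ac)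
  finally show ?thesis by simp
qed

lemma digit_sum_diff_le:
  assumes "\<And>i. i < n \<Longrightarrow> d i = e i"
  shows "\<bar>digit_sum r d - digit_sum r e\<bar> \<le> r ^ n"
  using assms
proof (induction n arbitrary: d e)
  case 0
  then show ?case using digit_sum_bounds[of d] digit_sum_bounds[of e] by auto
next
  case (Suc n)
  have "digit_sum r d - digit_sum r e
      = r * (digit_sum r (\<lambda>i. d (Suc i)) - digit_sum r (\<lambda>i. e (Suc i)))"
    using Suc.prems[of 0] by (simp add: digit_sum_unfold[of d] digit_sum_unfold[of e] algebra_simps)
  then show ?case using Suc.IH[of "\<lambda>i. d (Suc i)" "\<lambda>i. e (Suc i)"] Suc.prems r
    by (simp add: abs_mult)
qed

text \<open>At the first differing digit one sum lies in [0, r] and the other in [1 - r, 1], at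
  distance at least 1 - 2 r; the common digits before it scale this gap by r^n.\<close>

lemma digit_sum_diff_ge:
  assumes "\<And>i. i < n \<Longrightarrow> d i = e i" "d n \<noteq> e n"
  shows "\<bar>digit_sum r d - digit_sum r e\<bar> \<ge> (1 - 2 * r) * r ^ n"
  using assms
proof (induction n arbitrary: d e)
  case 0
  have "0 \<le> r * digit_sum r x" "r * digit_sum r x \<le> r" for x
    using digit_sum_bounds[of x] r by (auto simp: mult_left_le)
  from this[of "\<lambda>i. d (Suc i)"] this[of "\<lambda>i. e (Suc i)"] 0 show ?case
    by (cases "d 0"; cases "e 0") (auto simp: digit_sum_unfold[of d] digit_sum_unfold[of e])
next
  case (Suc n)
  have "digit_sum r d - digit_sum r e
      = r * (digit_sum r (\<lambda>i. d (Suc i)) - digit_sum r (\<lambda>i. e (Suc i)))"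
    using Suc.prems(1)[of 0] by (simp add: digit_sum_unfold[of d] digit_sum_unfold[of e] algebra_simps)
  then show ?case using Suc.IH[of "\<lambda>i. d (Suc i)" "\<lambda>i. e (Suc i)"] Suc.prems r
    by (simp add: abs_mult)
qed

lemma stage_compact: "compact (stage r n)"
  by (induction n) (auto intro!: compact_Un compact_continuous_image continuous_intros)

lemma stage_subset: "stage r n \<subseteq> {0..1}"
proof (induction n)
  case (Suc n)
  have "r * x \<in> {0..1}" "r * x + (1 - r) \<in> {0..1}" if "x \<in> stage r n" for x
  proof -
    have "0 \<le> r * x" "r * x \<le> r" using Suc that r by (auto simp: mult_left_le)
    then show "r * x \<in> {0..1}" "r * x + (1 - r) \<in> {0..1}"
      unfolding atLeastAtMost_iff using r by linarith+
  qed
  then show ?case by auto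
qed simp

lemma digit_sum_in_stage: "digit_sum r d \<in> stage r n"
proof (induction n arbitrary: d)
  case 0
  then show ?case using digit_sum_bounds by simp
next
  case (Suc n)
  then show ?case by (subst digit_sum_unfold) (auto simp: image_iff intro!: bexI[OF _ Suc])
qed

lemma stage_decseq: "m \<le> n \<Longrightarrow> stage r n \<subseteq> stage r m"
proof (rule lift_Suc_antimono_le[of "stage r"])
  show "stage r (Suc n) \<subseteq> stage r n" for n
  proof (induction n)
    case 0
    show ?case using stage_subset[of "Suc 0"] by (simp only: stage.simps(1))
  next
    case (Suc n)
    have "(\<lambda>x. r * x) ` stage r (Suc n) \<union> (\<lambda>x. r * x + (1 - r)) ` stage r (Suc n)
        \<subseteq> (\<lambda>x. r * x) ` stage r n \<union> (\<lambda>x. r * x + (1 - r)) ` stage r n"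
      by (intro Un_mono image_mono Suc)
    then show ?case by (simp only: stage.simps(2))
  qed
qed

lemma cantor_compact: "compact (cantor r)"
  unfolding cantor_def by (intro compact_Inter) (auto intro: stage_compact)

lemma cantor_subset: "cantor r \<subseteq> {0..1}"
  using stage_subset by (auto simp: cantor_def)

lemma cantor_unfold:
  "cantor r = (\<lambda>x. r * x) ` cantor r \<union> (\<lambda>x. r * x + (1 - r)) ` cantor r" (is "?L = ?R")
proof
  show "?R \<subseteq> ?L"
  proof
    fix x assume "x \<in> ?R"
    then have "x \<in> stage r (Suc n)" for n by (auto simp: cantor_def)
    then show "x \<in> ?L" using stage_decseq[of _ "Suc _"] by (auto simp: cantor_def) (meson le_SucI le_refl subsetD)
  qed
  show "?L \<subseteq> ?R"
  proof
    fix x assume x: "x \<in> ?L"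
    have c: "\<exists>n. y \<notin> stage r n" if "y \<notin> cantor r" for y using that by (auto simp: cantor_def)
    show "x \<in> ?R"
    proof (rule ccontr)
      assume "x \<notin> ?R"
      then have "x / r \<notin> cantor r" "(x - (1 - r)) / r \<notin> cantor r" using r by (auto simp: image_iff)
      then obtain m n where "x / r \<notin> stage r m" "(x - (1 - r)) / r \<notin> stage r n" using c by meson
      \<comment> \<open>The stages decrease, so one common level excludes both preimages at once.
        This lets the intersection pass through the union of the two images.\<close>
      then have "x / r \<notin> stage r (max m n)" "(x - (1 - r)) / r \<notin> stage r (max m n)"
        using stage_decseq by (meson max.cobounded1 max.cobounded2 subsetD)+
      then have "x \<notin> stage r (Suc (max m n))" using r by (auto simp: image_iff)
      then show False using x by (auto simp: cantor_def simp del: stage.simps)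
    qed
  qed
qed

text \<open>Undoing the contractions gives a map \<open>N\<close> of the set into itself, and
  \<open>b\<close> records which branch was undone. Reading \<open>b\<close> along the orbit of
  \<open>x\<close> yields the digits; after \<open>n\<close> steps the remaining error is scaled by
  r^n.\<close>

lemma cantor_eq_range: "cantor r = range (digit_sum r)"
proof
  show "range (digit_sum r) \<subseteq> cantor r" using digit_sum_in_stage by (auto simp: cantor_def)
  show "cantor r \<subseteq> range (digit_sum r)"
  proof
    fix x assume "x \<in> cantor r"
    have step: "\<exists>z b. z \<in> cantor r \<and> y = r * z + (1 - r) * of_bool b" if y: "y \<in> cantor r" for y
    proof -
      from y consider z where "z \<in> cantor r" "y = r * z"
        | z where "z \<in> cantor r" "y = r * z + (1 - r)" by (subst (asm) cantor_unfold) auto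
      then show ?thesis by cases (auto intro: exI[of _ False] exI[of _ True])
    qed
    then obtain N b where N: "\<And>y. y \<in> cantor r \<Longrightarrow> N y \<in> cantor r \<and> y = r * N y + (1 - r) * of_bool (b y)"
      by metis
    define y where "y n = (N ^^ n) x" for n
    have y: "y n \<in> cantor r" for n
      by (induction n) (use \<open>x \<in> cantor r\<close> N in \<open>auto simp: y_def\<close>)
    have eq: "x - digit_sum r (\<lambda>i. b (y i)) = r ^ n * (y n - digit_sum r (\<lambda>i. b (y (i + n))))" for n
    proof (induction n)
      case 0
      then show ?case by (simp add: y_def)
    next
      case (Suc n)
      have "y n = r * y (Suc n) + (1 - r) * of_bool (b (y n))" using N[OF y[of n]] by (simp add: y_def)
      then show ?case using Suc by (subst (asm) digit_sum_unfold[of "\<lambda>i. b (y (i + n))"])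
        (simp add: algebra_simps)
    qed
    have "\<bar>x - digit_sum r (\<lambda>i. b (y i))\<bar> \<le> r ^ n" for n
    proof -
      have "\<bar>y n - digit_sum r (\<lambda>i. b (y (i + n)))\<bar> \<le> 1"
        using subsetD[OF cantor_subset y[of n]] digit_sum_bounds[of "\<lambda>i. b (y (i + n))"] by (simp add: abs_le_iff)
      then show ?thesis using r by (simp add: eq[of n] abs_mult mult_left_le)
    qed
    moreover have "(\<lambda>n. r ^ n) \<longlonglongrightarrow> 0" using r by (intro LIMSEQ_power_zero) auto
    ultimately have "\<bar>x - digit_sum r (\<lambda>i. b (y i))\<bar> \<le> 0"
      by (intro LIMSEQ_le_const) auto
    then show "x \<in> range (digit_sum r)" by auto
  qed
qed

lemma stage_cover: "\<exists>c :: nat \<Rightarrow> real. stage r n \<subseteq> (\<Union>i<2 ^ n. {c i..c i + r ^ n})"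
proof (induction n)
  case 0
  show ?case by (intro exI[of _ "\<lambda>_. 0"]) (auto simp: lessThan_empty_iff)
next
  case (Suc n)
  then obtain c :: "nat \<Rightarrow> real" where c: "stage r n \<subseteq> (\<Union>i<2 ^ n. {c i..c i + r ^ n})" ..
  define c' where "c' i = (if i < 2 ^ n then r * c i else r * c (i - 2 ^ n) + (1 - r))" for i :: nat
  show ?case
  proof (intro exI[of _ c'] subsetI)
    fix x assume "x \<in> stage r (Suc n)"
    then obtain y b where y: "y \<in> stage r n" "x = r * y + (if b then 1 - r else 0)"
      by (auto simp: image_iff) (metis add.right_neutral, metis)
    obtain i where i: "i < 2 ^ n" "c i \<le> y" "y \<le> c i + r ^ n" using c y(1) by auto
    have "r * c i \<le> r * y" "r * y \<le> r * c i + r ^ Suc n"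
      using i(2,3) r mult_left_mono[of y "c i + r ^ n" r] by (auto simp: algebra_simps)
    then show "x \<in> (\<Union>i<2 ^ Suc n. {c' i..c' i + r ^ Suc n})"
      using i(1) y(2) by (intro UN_I[of "if b then i + 2 ^ n else i"]) (auto simp: c'_def)
  qed
qed

end

text \<open>The limiting ratio, where the two pieces touch. It provides the set of known Lebesgue
  measure against which the dimension of the Cantor set is bounded from below.\<close>

lemma cantor_half: "cantor (1 / 2) = {0..1}"
proof -
  have "stage (1 / 2) n = {0..1}" for n
  proof (induction n)
    case (Suc n)
    have "x \<in> (\<lambda>x. 1 / 2 * x) ` {0..1} \<union> (\<lambda>x. 1 / 2 * x + (1 - 1 / 2)) ` {0..1}"
      if "x \<in> {0..1}" for x :: real
    proof (cases "x \<le> 1 / 2")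
      case True
      then show ?thesis using that by (intro UnI1 image_eqI[of _ _ "2 * x"]) auto
    next
      case False
      then show ?thesis using that by (intro UnI2 image_eqI[of _ _ "2 * x - 1"]) (auto simp: field_simps)
    qed
    moreover have "stage (1 / 2) (Suc n) \<subseteq> {0..1}" by (rule stage_subset) auto
    ultimately show ?case using Suc by (auto simp only: stage.simps(2))
  qed simp
  then show ?thesis by (simp add: cantor_def)
qed

text \<open>A point is written in its \<open>r\<close>-digits, and the same digits are summed with
  ratio \<open>s\<close>. The index \<open>n\<close> is the first place where the digits of
  \<open>x\<close> and \<open>y\<close> differ, which controls both distances. For
  \<open>r < 1 / 2\<close> the digits are unique; \<open>s = 1 / 2\<close> is allowed in order to
  reach the unit interval.\<close>

lemma cantor_map_exists:
  assumes r: "0 < r" "r < 1 / 2" and s: "0 < s" "s \<le> 1 / 2"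
  obtains f :: "real \<Rightarrow> real" where "f ` cantor r = cantor s"
    "\<And>x y. x \<in> cantor r \<Longrightarrow> y \<in> cantor r \<Longrightarrow> x \<noteq> y \<Longrightarrow>
      \<exists>n. (1 - 2 * r) * r ^ n \<le> \<bar>x - y\<bar> \<and> \<bar>f x - f y\<bar> \<le> s ^ n \<and> \<bar>f x - f y\<bar> \<ge> (1 - 2 * s) * s ^ n"
proof -
  have r': "r \<le> 1 / 2" using r by simp
  define D where "D x = (SOME d. digit_sum r d = x)" for x
  have D: "digit_sum r (D x) = x" if "x \<in> cantor r" for x
  proof -
    obtain d where "digit_sum r d = x" using \<open>x \<in> cantor r\<close> cantor_eq_range[OF r(1) r'] by auto
    then show ?thesis unfolding D_def by (rule someI[of "\<lambda>d. digit_sum r d = x"])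
  qed
  have first: "\<exists>n. (\<forall>i<n. d i = e i) \<and> d n \<noteq> e n" if "d \<noteq> e" for d e :: "nat \<Rightarrow> bool"
    using that exists_least_iff[of "\<lambda>n. d n \<noteq> e n"] by auto
  have inj: "d = e" if "digit_sum r d = digit_sum r e" for d e
  proof (rule ccontr)
    assume "d \<noteq> e"
    then obtain n where "\<forall>i<n. d i = e i" "d n \<noteq> e n" using first by blast
    then have "(1 - 2 * r) * r ^ n \<le> 0" using digit_sum_diff_ge[OF r(1) r', of n d e] that by simp
    moreover have "(1 - 2 * r) * r ^ n > 0" using r by simp
    ultimately show False by linarith
  qed
  show ?thesis
  proof (rule that[of "\<lambda>x. digit_sum s (D x)"])
    have "D (digit_sum r d) = d" for d
      by (rule inj) (use D cantor_eq_range[OF r(1) r'] in auto)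
    then show "(\<lambda>x. digit_sum s (D x)) ` cantor r = cantor s"
      unfolding cantor_eq_range[OF r(1) r'] cantor_eq_range[OF s] by (simp add: image_image)
    fix x y assume xy: "x \<in> cantor r" "y \<in> cantor r" "x \<noteq> y"
    then have "D x \<noteq> D y" using D by metis
    then obtain n where n: "\<forall>i<n. D x i = D y i" "D x n \<noteq> D y n" using first by blast
    then show "\<exists>n. (1 - 2 * r) * r ^ n \<le> \<bar>x - y\<bar> \<and> \<bar>digit_sum s (D x) - digit_sum s (D y)\<bar> \<le> s ^ n
        \<and> \<bar>digit_sum s (D x) - digit_sum s (D y)\<bar> \<ge> (1 - 2 * s) * s ^ n"
      using digit_sum_diff_ge[OF r(1) r', of n "D x" "D y"] digit_sum_diff_le[OF s, of n "D x" "D y"]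
        digit_sum_diff_ge[OF s, of n "D x" "D y"]
      by (intro exI[of _ n]) (simp add: D xy)
  qed
qed

text \<open>Points closer than (1 - 2 r) r^N share their first \<open>N\<close> digits, so their
  images are within s^N. This gives continuity, and compactness supplies the continuous
  inverse.\<close>

lemma cantor_homeomorphic:
  assumes r: "0 < r" "r < 1 / 2" and s: "0 < s" "s < 1 / 2"
  shows "cantor r homeomorphic cantor s"
proof -
  have s': "s \<le> 1 / 2" and r': "r \<le> 1 / 2" using r s by auto
  obtain f where f: "f ` cantor r = cantor s"
    "\<And>x y. x \<in> cantor r \<Longrightarrow> y \<in> cantor r \<Longrightarrow> x \<noteq> y \<Longrightarrow>
      \<exists>n. (1 - 2 * r) * r ^ n \<le> \<bar>x - y\<bar> \<and> \<bar>f x - f y\<bar> \<le> s ^ n \<and> \<bar>f x - f y\<bar> \<ge> (1 - 2 * s) * s ^ n"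
    using cantor_map_exists[OF r s(1) s'] by metis
  have "inj_on f (cantor r)"
  proof (rule inj_onI, rule ccontr)
    fix x y assume "x \<in> cantor r" "y \<in> cantor r" "f x = f y" "x \<noteq> y"
    then obtain n where "(1 - 2 * s) * s ^ n \<le> 0" using f(2)[of x y] by auto
    moreover have "(1 - 2 * s) * s ^ n > 0" using s by simp
    ultimately show False by linarith
  qed
  moreover have "continuous_on (cantor r) f"
    unfolding continuous_on_iff
  proof (intro ballI allI impI)
    fix x e :: real assume x: "x \<in> cantor r" and "0 < e"
    then obtain N where N: "s ^ N < e" using s real_arch_pow_inv[of e s] by auto
    show "\<exists>d>0. \<forall>y\<in>cantor r. dist y x < d \<longrightarrow> dist (f y) (f x) < e"
    proof (intro exI[of _ "(1 - 2 * r) * r ^ N"] conjI ballI impI)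
      show "(1 - 2 * r) * r ^ N > 0" using r by simp
      fix y assume y: "y \<in> cantor r" and d: "dist y x < (1 - 2 * r) * r ^ N"
      show "dist (f y) (f x) < e"
      proof (cases "x = y")
        case False
        then obtain n where n: "(1 - 2 * r) * r ^ n \<le> \<bar>y - x\<bar>" "\<bar>f y - f x\<bar> \<le> s ^ n"
          using f(2)[OF y x] by auto
        then have "(1 - 2 * r) * r ^ n < (1 - 2 * r) * r ^ N" using d by (simp add: dist_real_def)
        then have "r ^ n < r ^ N" using r by (simp add: mult_less_cancel_left)
        then have "N \<le> n" using r power_decreasing[of n N r] by (cases "N \<le> n") auto
        then have "s ^ n \<le> s ^ N" using s by (intro power_decreasing) auto
        then show ?thesis using n N by (simp add: dist_real_def)
      qed (use \<open>0 < e\<close> in simp)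
    qed
  qed
  ultimately show ?thesis
    using homeomorphic_compact[OF cantor_compact[OF r(1) r'] _ f(1)] by blast
qed

lemma cantor_self_similar: "self_similar_cantor_set (cantor (1 / 4))"
proof -
  let ?K = "cantor (1 / 4)"
  define f where "f i x = (if i = 0 then x / 4 else x / 4 + 3 / 4)" for i :: nat and x :: real
  have U: "?K = f 0 ` ?K \<union> f 1 ` ?K"
    using cantor_unfold[of "1 / 4"] by (simp add: f_def[abs_def])
  have D: "f 0 ` ?K \<inter> f 1 ` ?K = {}"
  proof -
    have "x \<noteq> y + 3" if "x \<in> ?K" "y \<in> ?K" for x y
      using subsetD[OF cantor_subset[of "1 / 4"], of x] subsetD[OF cantor_subset[of "1 / 4"], of y] that
      by auto
    then show ?thesis by (auto simp: f_def field_simps)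
  qed
  have I: "{..<2::nat} = {0, 1}" by auto
  show ?thesis unfolding self_similar_cantor_set_def
  proof (intro conjI exI[of _ 2] exI[of _ f])
    show "?K \<noteq> {}" by (simp add: cantor_eq_range)
    show "compact ?K" by (simp add: cantor_compact)
    show "?K homeomorphic standard_cantor_set"
      unfolding standard_cantor_set_eq by (rule cantor_homeomorphic) auto
    show "\<forall>i<2. contracting_similarity (f i)"
      unfolding contracting_similarity_def
      by (intro allI impI exI[of _ "1 / 4"]) (auto simp: f_def dist_real_def abs_if)
    show "disjoint_family_on (\<lambda>i. f i ` ?K) {..<2}"
      using D by (auto simp: disjoint_family_on_def I)
    show "?K = (\<Union>i<2. f i ` ?K)" using U by (simp add: I)
  qed simp
qed

section \<open>Hausdorff null sets and the dimension of the Cantor set\<close>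

lemma hausdorff_measure_eq_0_iff:
  fixes A :: "'a::metric_space set"
  shows "hausdorff_measure s A = 0 \<longleftrightarrow> (\<forall>\<delta>>0. \<forall>e>0. \<exists>C :: nat \<Rightarrow> 'a set. A \<subseteq> (\<Union>i. C i) \<and>
     (\<forall>i. bounded (C i) \<and> diameter (C i) \<le> \<delta>) \<and> (\<Sum>i. ennreal (diameter (C i) powr s)) < ennreal e)"
    (is "_ \<longleftrightarrow> (\<forall>\<delta>>0. ?P \<delta>)")
proof -
  have *: "hausdorff_measure s A = 0 \<longleftrightarrow> (\<forall>\<delta>>0. hausdorff_premeasure s \<delta> A = 0)"
    unfolding hausdorff_measure_def by (auto simp: SUP_bot_conv simp flip: bot_ennreal)
  have **: "hausdorff_premeasure s \<delta> A = 0 \<longleftrightarrow> ?P \<delta>" for \<delta>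
  proof
    assume *: "hausdorff_premeasure s \<delta> A = 0"
    show "?P \<delta>"
    proof (intro allI impI)
      fix e :: real assume "e > 0"
      then have "hausdorff_premeasure s \<delta> A < ennreal e" using * by simp
      then show "\<exists>C :: nat \<Rightarrow> 'a set. A \<subseteq> (\<Union>i. C i) \<and> (\<forall>i. bounded (C i) \<and> diameter (C i) \<le> \<delta>)
          \<and> (\<Sum>i. ennreal (diameter (C i) powr s)) < ennreal e"
        unfolding hausdorff_premeasure_def INF_less_iff by blast
    qed
  next
    assume *: "?P \<delta>"
    have "hausdorff_premeasure s \<delta> A \<le> 0"
    proof (rule ennreal_le_epsilon)
      fix e :: real assume "e > 0"
      then have "hausdorff_premeasure s \<delta> A < ennreal e"
        using * unfolding hausdorff_premeasure_def INF_less_iff by blast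
      then show "hausdorff_premeasure s \<delta> A \<le> 0 + ennreal e" by simp
    qed
    then show "hausdorff_premeasure s \<delta> A = 0" by simp
  qed
  show ?thesis unfolding * ** ..
qed

lemma hausdorff_measure_Lipschitz_null:
  fixes f :: "'a::metric_space \<Rightarrow> 'b::metric_space"
  assumes f: "L-lipschitz_on A f" and s: "0 < s" and A: "hausdorff_measure s A = 0"
  shows "hausdorff_measure s (f ` A) = 0"
  unfolding hausdorff_measure_eq_0_iff
proof (intro allI impI)
  fix \<delta> e :: real assume "0 < \<delta>" "0 < e"
  \<comment> \<open>Raising the constant makes it positive even if \<open>L = 0\<close>, so that
    \<open>\<delta> / M\<close> is a legitimate scale. Below, the covering sets are cut down to
    \<open>A\<close>, where alone the Lipschitz bound is available.\<close>
  define M where "M = L + 1"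
  have M: "M > 0" using lipschitz_on_nonneg[OF f] by (simp add: M_def)
  have lip: "dist (f x) (f y) \<le> M * dist x y" if "x \<in> A" "y \<in> A" for x y
    using lipschitz_onD[OF f that] zero_le_dist[of x y] unfolding M_def distrib_right by linarith
  obtain C where C: "A \<subseteq> (\<Union>i. C i)" "\<And>i. bounded (C i)" "\<And>i. diameter (C i) \<le> \<delta> / M"
    "(\<Sum>i. ennreal (diameter (C i) powr s)) < ennreal (e / M powr s)"
  proof -
    have "0 < \<delta> / M" "0 < e / M powr s" using \<open>0 < \<delta>\<close> \<open>0 < e\<close> M by auto
    from A[unfolded hausdorff_measure_eq_0_iff, rule_format, OF this]
    show ?thesis by (elim exE conjE) (rule that, auto)
  qed
  have le: "dist u v \<le> M * diameter (C i)" if uv: "u \<in> f ` (C i \<inter> A)" "v \<in> f ` (C i \<inter> A)" for i u v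
  proof -
    obtain x y where x: "x \<in> C i" "x \<in> A" "u = f x" and y: "y \<in> C i" "y \<in> A" "v = f y"
      using uv by auto
    have "dist u v \<le> M * dist x y" using lip x y by simp
    also have "\<dots> \<le> M * diameter (C i)"
      using M diameter_bounded_bound[OF C(2) x(1) y(1)] by simp
    finally show ?thesis .
  qed
  have diam: "diameter (f ` (C i \<inter> A)) \<le> M * diameter (C i)" for i
  proof (cases "C i \<inter> A = {}")
    case True
    then show ?thesis using M diameter_ge_0[OF C(2)] by simp
  next
    case False
    then show ?thesis unfolding diameter_def[of "f ` (C i \<inter> A)"] by (auto intro!: cSUP_least le)
  qed
  have bd: "bounded (f ` (C i \<inter> A))" for i
    unfolding bounded_two_points using le by blast
  show "\<exists>C. f ` A \<subseteq> (\<Union>i. C i) \<and> (\<forall>i. bounded (C i) \<and> diameter (C i) \<le> \<delta>)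
      \<and> (\<Sum>i. ennreal (diameter (C i) powr s)) < ennreal e"
  proof (intro exI[of _ "\<lambda>i. f ` (C i \<inter> A)"] conjI allI bd)
    show "f ` A \<subseteq> (\<Union>i. f ` (C i \<inter> A))" using C(1) by blast
    show "diameter (f ` (C i \<inter> A)) \<le> \<delta>" for i
      using diam[of i] C(3)[of i] M by (simp add: field_simps)
    have "(\<Sum>i. ennreal (diameter (f ` (C i \<inter> A)) powr s))
        \<le> (\<Sum>i. ennreal (M powr s) * ennreal (diameter (C i) powr s))"
    proof (rule suminf_le)
      show "ennreal (diameter (f ` (C i \<inter> A)) powr s)
          \<le> ennreal (M powr s) * ennreal (diameter (C i) powr s)" for i
        using diam[of i] M s diameter_ge_0[OF bd[of i]] diameter_ge_0[OF C(2)[of i]]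
        by (auto simp flip: ennreal_mult' powr_mult intro!: ennreal_leI powr_mono2)
    qed auto
    also have "\<dots> = ennreal (M powr s) * (\<Sum>i. ennreal (diameter (C i) powr s))"
      by simp
    also have "\<dots> < ennreal (M powr s) * ennreal (e / M powr s)"
      using C(4) M by (intro ennreal_mult_strict_left_mono) auto
    also have "\<dots> = ennreal e" using M \<open>0 < e\<close> by (simp flip: ennreal_mult')
    finally show "(\<Sum>i. ennreal (diameter (f ` (C i \<inter> A)) powr s)) < ennreal e" .
  qed
qed

lemma hausdorff_dim_bilipschitz:
  assumes "bilipschitz_equivalent A B"
  shows "hausdorff_dim A = hausdorff_dim B"
proof -
  obtain f K L where f: "bij_betw f A B" "K-lipschitz_on A f" "L-lipschitz_on B (inv_into A f)"
    using assms by (auto simp: bilipschitz_equivalent_def)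
  have "f ` A = B" "inv_into A f ` B = A"
    using f(1) bij_betw_inv_into[OF f(1)] by (auto simp: bij_betw_def)
  then have "hausdorff_measure s A = 0 \<longleftrightarrow> hausdorff_measure s B = 0" if "0 < s" for s
    using hausdorff_measure_Lipschitz_null[OF f(2) that] hausdorff_measure_Lipschitz_null[OF f(3) that]
    by auto
  then show ?thesis unfolding hausdorff_dim_def by (metis (no_types, lifting))
qed

text \<open>The 2^n intervals of length 4^-n at stage \<open>n\<close> have sum (2 * 4^-s)^n, and
  the base is below 1 for \<open>s > 1 / 2\<close>.\<close>

lemma cantor_measure_null:
  assumes "s > 1 / 2"
  shows "hausdorff_measure s (cantor (1 / 4)) = 0"
  unfolding hausdorff_measure_eq_0_iff
proof (intro allI impI)
  fix \<delta> e :: real assume "0 < \<delta>" "0 < e"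
  define q where "q = 2 * (1 / 4) powr s"
  have "(1 / 4 :: real) powr s < (1 / 4) powr (1 / 2)" using assms by (intro powr_less_mono') auto
  also have "\<dots> = 1 / 2" by (simp add: powr_half_sqrt real_sqrt_divide)
  finally have q: "0 \<le> q" "q < 1" by (auto simp: q_def)
  have "(\<lambda>n. q ^ n) \<longlonglongrightarrow> 0" "(\<lambda>n. (1 / 4 :: real) ^ n) \<longlonglongrightarrow> 0"
    using q by (auto intro!: LIMSEQ_power_zero)
  then have "\<forall>\<^sub>F n in sequentially. q ^ n < e" "\<forall>\<^sub>F n in sequentially. (1 / 4) ^ n < \<delta>"
    using \<open>0 < \<delta>\<close> \<open>0 < e\<close> by (auto dest: order_tendstoD(2))
  then have "\<forall>\<^sub>F n in sequentially. q ^ n < e \<and> (1 / 4) ^ n < \<delta>"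
    by (rule eventually_conj)
  then obtain n where n: "q ^ n < e" "(1 / 4) ^ n < \<delta>"
    unfolding eventually_sequentially by blast
  obtain c :: "nat \<Rightarrow> real" where c: "stage (1 / 4) n \<subseteq> (\<Union>i<2 ^ n. {c i..c i + (1 / 4) ^ n})"
    using stage_cover[of "1 / 4" n] by auto
  \<comment> \<open>Covers are indexed by all natural numbers; padding with empty sets adds nothing
    to the sum, as their diameter is 0.\<close>
  define C where "C i = (if i < 2 ^ n then {c i..c i + (1 / 4) ^ n} else {})" for i :: nat
  have diam: "diameter (C i) = (if i < 2 ^ n then (1 / 4) ^ n else 0)" for i
    by (simp add: C_def)
  show "\<exists>C. cantor (1 / 4) \<subseteq> (\<Union>i. C i) \<and> (\<forall>i. bounded (C i) \<and> diameter (C i) \<le> \<delta>)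
      \<and> (\<Sum>i. ennreal (diameter (C i) powr s)) < ennreal e"
  proof (intro exI[of _ C] conjI allI)
    have "cantor (1 / 4) \<subseteq> stage (1 / 4) n" by (auto simp: cantor_def)
    then show "cantor (1 / 4) \<subseteq> (\<Union>i. C i)" using c by (force simp: C_def)
    show "bounded (C i)" for i by (simp add: C_def)
    show "diameter (C i) \<le> \<delta>" for i using n \<open>0 < \<delta>\<close> by (simp add: diam)
    have "(\<Sum>i. ennreal (diameter (C i) powr s)) = (\<Sum>i<2 ^ n. ennreal (diameter (C i) powr s))"
      by (rule suminf_finite) (auto simp: diam)
    also have "\<dots> = ennreal (2 ^ n * ((1 / 4) ^ n) powr s)"
      by (simp add: diam ennreal_mult' flip: ennreal_numeral ennreal_power)
    also have "2 ^ n * ((1 / 4) ^ n) powr s = q ^ n"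
      by (simp add: q_def power_mult_distrib powr_power powr_powr mult.commute flip: powr_realpow)
    finally show "(\<Sum>i. ennreal (diameter (C i) powr s)) < ennreal e"
      using n q \<open>0 < e\<close> by (simp add: ennreal_lessI)
  qed
qed

text \<open>The digit map onto the unit interval is Hoelder continuous with exponent \<open>1 / 2\<close>, so a cover
  of the Cantor set yields a cover of the interval.\<close>

lemma cantor_measure_not_null:
  assumes s: "0 < s" "s < 1 / 2"
  shows "hausdorff_measure s (cantor (1 / 4)) \<noteq> 0"
proof
  let ?K = "cantor (1 / 4)"
  assume "hausdorff_measure s ?K = 0"
  \<comment> \<open>An image of a set of diameter \<open>d\<close> will lie in an interval of length
    2 sqrt (2 d), and 2 sqrt 2 \<le> 3. Diameters at most 1 allow sqrt d to be replaced by the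
    larger \<open>d powr s\<close>. A sum below 1/3 then covers the unit interval with total length
    below 1.\<close>
  then obtain C where C: "?K \<subseteq> (\<Union>i. C i)" "\<And>i. bounded (C i)" "\<And>i. diameter (C i) \<le> 1"
    "(\<Sum>i. ennreal (diameter (C i) powr s)) < ennreal (1 / 3)"
    unfolding hausdorff_measure_eq_0_iff by (meson zero_less_divide_1_iff zero_less_numeral zero_less_one)
  obtain f :: "real \<Rightarrow> real" where f: "f ` ?K = {0..1}"
    "\<And>x y. x \<in> ?K \<Longrightarrow> y \<in> ?K \<Longrightarrow> x \<noteq> y \<Longrightarrow>
      \<exists>n. (1 - 2 * (1 / 4)) * (1 / 4) ^ n \<le> \<bar>x - y\<bar> \<and> \<bar>f x - f y\<bar> \<le> (1 / 2) ^ n"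
  proof (rule cantor_map_exists[of "1 / 4" "1 / 2"])
    fix g assume g: "g ` ?K = cantor (1 / 2)" "\<And>x y. x \<in> ?K \<Longrightarrow> y \<in> ?K \<Longrightarrow> x \<noteq> y \<Longrightarrow>
      \<exists>n. (1 - 2 * (1 / 4)) * (1 / 4) ^ n \<le> \<bar>x - y\<bar> \<and> \<bar>g x - g y\<bar> \<le> (1 / 2) ^ n
        \<and> (1 - 2 * (1 / 2)) * (1 / 2) ^ n \<le> \<bar>g x - g y\<bar>"
    show thesis by (rule that[of g]) (use g(1) cantor_half in simp, use g(2) in blast)
  qed auto
  have holder: "\<bar>f x - f y\<bar> \<le> sqrt (2 * \<bar>x - y\<bar>)" if xy: "x \<in> ?K" "y \<in> ?K" for x y
  proof (cases "x = y")
    case False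
    then obtain n where n: "(1 / 4) ^ n \<le> 2 * \<bar>x - y\<bar>" "\<bar>f x - f y\<bar> \<le> (1 / 2) ^ n"
      using f(2)[OF xy] by (auto simp: mult.commute)
    have "((1 / 2) ^ n)\<^sup>2 = (1 / 4 :: real) ^ n"
      by (simp add: power2_eq_square flip: power_mult_distrib)
    then have "(1 / 2) ^ n = sqrt ((1 / 4) ^ n)" by (metis real_sqrt_unique zero_le_divide_1_iff zero_le_numeral zero_le_power)
    then show ?thesis using n by (metis order_trans real_sqrt_le_mono)
  qed simp
  define d where "d i = diameter (C i)" for i
  have d: "0 \<le> d i" "d i \<le> 1" for i using C(2,3) by (auto simp: d_def diameter_ge_0)
  \<comment> \<open>Measurability of the image is not at hand, so it is enclosed in an interval
    centred at the image of one point \<open>p\<close>.\<close>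
  have "\<exists>I. f ` (C i \<inter> ?K) \<subseteq> I \<and> I \<in> sets lborel \<and> emeasure lborel I \<le> ennreal 3 * ennreal (d i powr s)" for i
  proof (cases "C i \<inter> ?K = {}")
    case False
    then obtain p where p: "p \<in> C i" "p \<in> ?K" by blast
    have sq: "sqrt (d i) \<le> d i powr s"
    proof (cases "d i = 0")
      case False
      then show ?thesis using d[of i] s powr_mono'[of s "1 / 2" "d i"] by (simp add: powr_half_sqrt)
    qed simp
    have "2 * sqrt 2 \<le> (3 :: real)" by (rule power2_le_imp_le) (auto simp: power_mult_distrib)
    then have "2 * sqrt (2 * d i) \<le> 3 * (d i powr s)"
      using mult_mono[OF _ sq, of "2 * sqrt 2" 3] d[of i] by (simp add: real_sqrt_mult)
    moreover have "f ` (C i \<inter> ?K) \<subseteq> {f p - sqrt (2 * d i)..f p + sqrt (2 * d i)}"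
    proof
      fix z assume "z \<in> f ` (C i \<inter> ?K)"
      then obtain x where x: "x \<in> C i" "x \<in> ?K" "z = f x" by auto
      have "\<bar>x - p\<bar> \<le> d i"
        using diameter_bounded_bound[OF C(2) x(1) p(1)] by (simp add: d_def dist_real_def)
      then have "\<bar>f x - f p\<bar> \<le> sqrt (2 * d i)"
        using holder[OF x(2) p(2)] by (meson mult_left_mono order_trans real_sqrt_le_mono zero_le_numeral)
      then show "z \<in> {f p - sqrt (2 * d i)..f p + sqrt (2 * d i)}" using x by auto
    qed
    moreover have "ennreal (3 * (d i powr s)) = ennreal 3 * ennreal (d i powr s)"
      by (rule ennreal_mult) auto
    ultimately show ?thesis using d[of i] ennreal_leI[of "2 * sqrt (2 * d i)" "3 * (d i powr s)"]
      by (intro exI[of _ "{f p - sqrt (2 * d i)..f p + sqrt (2 * d i)}"]) auto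
  qed (auto intro: exI[of _ "{}"])
  note cover = this
  define P where "P i I \<longleftrightarrow> f ` (C i \<inter> ?K) \<subseteq> I \<and> I \<in> sets lborel
      \<and> emeasure lborel I \<le> ennreal 3 * ennreal (d i powr s)" for i and I :: "real set"
  define I where "I i = (SOME I. P i I)" for i
  have "P i (I i)" for i
    unfolding I_def by (rule someI_ex) (unfold P_def, rule cover)
  then have I: "\<And>i. f ` (C i \<inter> ?K) \<subseteq> I i" "\<And>i. I i \<in> sets lborel"
    "\<And>i. emeasure lborel (I i) \<le> ennreal 3 * ennreal (d i powr s)" unfolding P_def by simp_all
  have "ennreal 1 = emeasure lborel {0..1 :: real}" by simp
  also have "\<dots> \<le> emeasure lborel (\<Union>i. I i)"
  proof (rule emeasure_mono)
    show "{0..1} \<subseteq> (\<Union>i. I i)"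
    proof
      fix y :: real assume "y \<in> {0..1}"
      then obtain x where x: "x \<in> ?K" "y = f x" using f(1) by blast
      then obtain i where "x \<in> C i" using C(1) by blast
      then show "y \<in> (\<Union>i. I i)" using I(1)[of i] x by blast
    qed
    show "(\<Union>i. I i) \<in> sets lborel" by (intro sets.countable_UN) (use I(2) in auto)
  qed
  also have "\<dots> \<le> (\<Sum>i. emeasure lborel (I i))"
    using I(2) by (intro emeasure_subadditive_countably) auto
  also have "\<dots> \<le> (\<Sum>i. ennreal 3 * ennreal (d i powr s))"
    by (intro suminf_le I(3)) auto
  also have "\<dots> = ennreal 3 * (\<Sum>i. ennreal (d i powr s))" by simp
  also have "\<dots> < ennreal 3 * ennreal (1 / 3)"
    using C(4) by (intro ennreal_mult_strict_left_mono) (auto simp: d_def)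
  also have "\<dots> = ennreal 1" by (subst ennreal_mult[symmetric]) auto
  finally show False by simp
qed

lemma hausdorff_dim_cantor: "hausdorff_dim (cantor (1 / 4)) = ennreal (1 / 2)"
  unfolding hausdorff_dim_def
proof (rule antisym)
  let ?S = "{ennreal s |s. 0 < s \<and> hausdorff_measure s (cantor (1 / 4)) = 0}"
  show "Inf ?S \<le> ennreal (1 / 2)"
  proof (rule ennreal_le_epsilon)
    fix e :: real assume "e > 0"
    then have "Inf ?S \<le> ennreal (1 / 2 + e)"
      by (intro Inf_lower) (auto intro!: exI[of _ "1 / 2 + e"] cantor_measure_null)
    then show "Inf ?S \<le> ennreal (1 / 2) + ennreal e" using \<open>e > 0\<close> by (simp add: ennreal_plus)
  qed
  show "ennreal (1 / 2) \<le> Inf ?S"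
  proof (rule Inf_greatest)
    fix x assume "x \<in> ?S"
    then obtain s where "x = ennreal s" "0 < s" "hausdorff_measure s (cantor (1 / 4)) = 0" by blast
    moreover from this have "1 / 2 \<le> s" using cantor_measure_not_null[of s] not_less by blast
    ultimately show "ennreal (1 / 2) \<le> x" by (simp only: ennreal_leI)
  qed
qed

subsection \<open>Symmetry of second derivatives\<close>

text \<open>The direction precedes the point, so that \<open>D f u\<close> is again a map on the
  same space and differentiation can be iterated, as in \<open>D (D f u) v\<close>.\<close>

abbreviation D :: "('a::euclidean_space \<Rightarrow> 'b::euclidean_space) \<Rightarrow> 'a \<Rightarrow> 'a \<Rightarrow> 'b" where
  "D f u \<equiv> \<lambda>x. frechet_derivative f (at x) u"

lemma Ck_on_inner_const: "open U \<Longrightarrow> Ck_on k f U \<Longrightarrow> Ck_on k (\<lambda>x. f x \<bullet> b) U"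
  by (intro Ck_on_inner Ck_on_const)

lemma DERIV_along_line:
  fixes f :: "'a::euclidean_space \<Rightarrow> real"
  assumes "f differentiable (at (x + t *\<^sub>R u))"
  shows "((\<lambda>t. f (x + t *\<^sub>R u)) has_real_derivative frechet_derivative f (at (x + t *\<^sub>R u)) u) (at t)"
proof -
  have "((\<lambda>t. f (x + t *\<^sub>R u)) has_derivative
      (\<lambda>s. frechet_derivative f (at (x + t *\<^sub>R u)) (0 + s *\<^sub>R u))) (at t)"
    by (rule has_derivative_compose[where f="\<lambda>t. x + t *\<^sub>R u" and g=f])
      (use assms in \<open>auto intro!: derivative_eq_intros simp: frechet_derivative_works\<close>)
  then show ?thesis
    by (simp add: has_field_derivative_def linear_scale[OF linear_frechet_derivative[OF assms]] mult_commute_abs)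
qed

text \<open>Both iterated derivatives are values of the same second difference quotient, by applying the
  mean value theorem in the two possible orders.\<close>

lemma second_difference_eq:
  fixes f :: "'a::euclidean_space \<Rightarrow> real"
  assumes f: "Ck_on 2 f (ball x r)" and s: "0 < s" "s * (norm u + norm v) < r"
  obtains a b where "0 < a" "a < s" "0 < b" "b < s"
    "f (x + s *\<^sub>R u + s *\<^sub>R v) - f (x + s *\<^sub>R u) - f (x + s *\<^sub>R v) + f x
      = s * s * D (D f u) v (x + a *\<^sub>R u + b *\<^sub>R v)"
proof -
  have inb: "x + a *\<^sub>R u + b *\<^sub>R v \<in> ball x r" if "0 \<le> a" "a \<le> s" "0 \<le> b" "b \<le> s" for a b
  proof -
    have "norm (a *\<^sub>R u + b *\<^sub>R v) \<le> a * norm u + b * norm v"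
      using norm_triangle_ineq[of "a *\<^sub>R u" "b *\<^sub>R v"] that by simp
    also have "\<dots> \<le> s * (norm u + norm v)"
      using that by (simp add: distrib_left add_mono mult_right_mono)
    finally have "norm (a *\<^sub>R u + b *\<^sub>R v) < r" using s by simp
    then show ?thesis by (simp add: dist_norm algebra_simps flip: norm_minus_cancel[of "a *\<^sub>R u + b *\<^sub>R v"])
  qed
  have d1: "f differentiable (at y)" "D f u differentiable (at y)" if "y \<in> ball x r" for y u
    using f that by (auto simp: numeral_2_eq_2)
  define g where "g t = f (x + s *\<^sub>R v + t *\<^sub>R u) - f (x + t *\<^sub>R u)" for t
  have "\<exists>a. 0 < a \<and> a < s \<and> g s - g 0 = (s - 0) *
      (D f u (x + s *\<^sub>R v + a *\<^sub>R u) - D f u (x + a *\<^sub>R u))"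
  proof (rule MVT2[OF s(1)])
    fix t assume "0 \<le> t" "t \<le> s"
    then show "(g has_real_derivative (D f u (x + s *\<^sub>R v + t *\<^sub>R u) - D f u (x + t *\<^sub>R u))) (at t)"
      unfolding g_def using inb[of t s] inb[of t 0] s
      by (intro DERIV_diff DERIV_along_line d1) (auto simp: add_ac)
  qed
  then obtain a where a: "0 < a" "a < s" "g s - g 0 = s *
      (D f u (x + s *\<^sub>R v + a *\<^sub>R u) - D f u (x + a *\<^sub>R u))" by auto
  have "\<exists>b. 0 < b \<and> b < s \<and> D f u (x + a *\<^sub>R u + s *\<^sub>R v) - D f u (x + a *\<^sub>R u + 0 *\<^sub>R v)
      = (s - 0) * D (D f u) v (x + a *\<^sub>R u + b *\<^sub>R v)"
  proof (rule MVT2[OF s(1), where f="\<lambda>t. D f u (x + a *\<^sub>R u + t *\<^sub>R v)"])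
    fix t assume "0 \<le> t" "t \<le> s"
    then show "((\<lambda>t. D f u (x + a *\<^sub>R u + t *\<^sub>R v)) has_real_derivative
        D (D f u) v (x + a *\<^sub>R u + t *\<^sub>R v)) (at t)"
      using inb[of a t] a by (intro DERIV_along_line[where f="D f u"] d1) auto
  qed
  then obtain b where b: "0 < b" "b < s"
    "D f u (x + a *\<^sub>R u + s *\<^sub>R v) - D f u (x + a *\<^sub>R u) = s * D (D f u) v (x + a *\<^sub>R u + b *\<^sub>R v)"
    by auto
  show ?thesis
    by (rule that[OF a(1,2) b(1,2)]) (use a(3) b(3) in \<open>simp add: g_def add_ac mult.assoc\<close>)
qed

text \<open>The second difference does not change when \<open>u\<close> and \<open>v\<close> are
  exchanged. Close to \<open>x\<close>, its two expressions give one number within half the supposed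
  gap of both mixed derivatives, which is impossible.\<close>

lemma second_derivative_symmetric_real:
  fixes f :: "'a::euclidean_space \<Rightarrow> real"
  assumes f: "Ck_on 2 f U" and "open U" "x \<in> U"
  shows "D (D f u) v x = D (D f v) u x"
proof (rule ccontr)
  assume ne: "D (D f u) v x \<noteq> D (D f v) u x"
  define e where "e = \<bar>D (D f u) v x - D (D f v) u x\<bar> / 2"
  have e: "e > 0" using ne by (simp add: e_def)
  have "continuous_on U (D (D f u) v)" "continuous_on U (D (D f v) u)"
    using f by (auto simp: numeral_2_eq_2)
  then have "isCont (D (D f u) v) x" "isCont (D (D f v) u) x"
    using assms by (auto simp: continuous_on_eq_continuous_at)
  then obtain d1 d2 where d: "d1 > 0" "d2 > 0"
    "\<And>y. dist y x < d1 \<Longrightarrow> dist (D (D f u) v y) (D (D f u) v x) < e"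
    "\<And>y. dist y x < d2 \<Longrightarrow> dist (D (D f v) u y) (D (D f v) u x) < e"
    using e unfolding continuous_at_eps_delta by metis
  obtain d3 where d3: "d3 > 0" "ball x d3 \<subseteq> U" using assms openE by blast
  define r where "r = min d1 (min d2 d3)"
  have r: "r > 0" using d d3 by (simp add: r_def)
  have fr: "Ck_on 2 f (ball x r)" by (rule Ck_on_subset[OF f]) (use d3 in \<open>auto simp: r_def\<close>)
  \<comment> \<open>The summand 1 keeps \<open>N\<close> positive when \<open>u\<close> and
    \<open>v\<close> are both 0.\<close>
  define N where "N = norm u + norm v + 1"
  define s where "s = r / (2 * N)"
  have pos: "N > 0" by (simp add: add_nonneg_pos N_def)
  have s: "0 < s" using r pos by (simp add: s_def)
  have "s * (norm u + norm v) \<le> s * N" using s by (simp add: N_def)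
  also have "\<dots> = r / 2" using pos by (simp add: s_def)
  also have "\<dots> < r" using r by simp
  finally have sr: "s * (norm u + norm v) < r" .
  have near: "dist (x + a *\<^sub>R u + b *\<^sub>R v) x < r" if "0 < a" "a < s" "0 < b" "b < s" for a b
  proof -
    have "norm (a *\<^sub>R u + b *\<^sub>R v) \<le> a * norm u + b * norm v"
      using norm_triangle_ineq[of "a *\<^sub>R u" "b *\<^sub>R v"] that by simp
    also have "\<dots> \<le> s * (norm u + norm v)"
      using that by (simp add: distrib_left add_mono mult_right_mono)
    finally show ?thesis using sr by (simp add: dist_norm add.assoc)
  qed
  obtain a b where ab: "0 < a" "a < s" "0 < b" "b < s"
    "f (x + s *\<^sub>R u + s *\<^sub>R v) - f (x + s *\<^sub>R u) - f (x + s *\<^sub>R v) + f x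
      = s * s * D (D f u) v (x + a *\<^sub>R u + b *\<^sub>R v)"
    using second_difference_eq[OF fr s sr] .
  obtain a' b' where ab': "0 < a'" "a' < s" "0 < b'" "b' < s"
    "f (x + s *\<^sub>R v + s *\<^sub>R u) - f (x + s *\<^sub>R v) - f (x + s *\<^sub>R u) + f x
      = s * s * D (D f v) u (x + a' *\<^sub>R v + b' *\<^sub>R u)"
    using second_difference_eq[OF fr s, of v u] sr by (auto simp: add.commute)
  have "D (D f u) v (x + a *\<^sub>R u + b *\<^sub>R v) = D (D f v) u (x + a' *\<^sub>R v + b' *\<^sub>R u)"
  proof -
    have "f (x + s *\<^sub>R u + s *\<^sub>R v) = f (x + s *\<^sub>R v + s *\<^sub>R u)" by (simp add: add_ac)
    then have "s * s * D (D f u) v (x + a *\<^sub>R u + b *\<^sub>R v)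
        = s * s * D (D f v) u (x + a' *\<^sub>R v + b' *\<^sub>R u)"
      using ab(5) ab'(5) by linarith
    then show ?thesis using s by simp
  qed
  moreover have "\<bar>D (D f u) v (x + a *\<^sub>R u + b *\<^sub>R v) - D (D f u) v x\<bar> < e"
    using near[OF ab(1-4)] d(3) by (simp add: r_def dist_real_def)
  moreover have "\<bar>D (D f v) u (x + a' *\<^sub>R v + b' *\<^sub>R u) - D (D f v) u x\<bar> < e"
    using near[OF ab'(3,4,1,2)] d(4) by (simp add: r_def dist_real_def add_ac)
  moreover have "False" if "X = Y" "\<bar>X - A\<bar> < \<bar>A - B\<bar> / 2" "\<bar>Y - B\<bar> < \<bar>A - B\<bar> / 2" for X Y A B :: real
    using that by (auto simp: abs_if split: if_splits)
  ultimately show False unfolding e_def by blast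
qed

lemma frechet_derivative_inner_const:
  assumes "f differentiable (at x)"
  shows "D (\<lambda>x. f x \<bullet> b) u x = D f u x \<bullet> b"
proof -
  have "((\<lambda>x. f x \<bullet> b) has_derivative (\<lambda>u. D f u x \<bullet> b)) (at x)"
    using assms by (auto intro!: has_derivative_inner_left simp: frechet_derivative_works)
  from frechet_derivative_at[OF this] show ?thesis by metis
qed

lemma second_derivative_symmetric:
  fixes f :: "'a::euclidean_space \<Rightarrow> 'b::euclidean_space"
  assumes f: "Ck_on 2 f U" and U: "open U" "x \<in> U"
  shows "D (D f u) v x = D (D f v) u x"
proof (rule euclidean_eqI)
  fix b :: 'b
  have "D (D f u) v x \<bullet> b = D (D (\<lambda>x. f x \<bullet> b) u) v x" for u v
  proof -
    have "D f u differentiable (at x)" using f U by (auto simp: numeral_2_eq_2)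
    then have "D (D f u) v x \<bullet> b = D (\<lambda>x. D f u x \<bullet> b) v x"
      by (rule frechet_derivative_inner_const[symmetric])
    also have "\<dots> = D (D (\<lambda>x. f x \<bullet> b) u) v x"
    proof (rule fun_cong[OF frechet_derivative_transform_within_open])
      show "(\<lambda>x. D f u x \<bullet> b) differentiable (at x)"
        using \<open>D f u differentiable (at x)\<close> by (intro differentiable_inner) auto
      show "D f u y \<bullet> b = D (\<lambda>x. f x \<bullet> b) u y" if "y \<in> U" for y
        using f that by (intro frechet_derivative_inner_const[symmetric]) (auto simp: numeral_2_eq_2)
    qed (use U in auto)
    finally show ?thesis .
  qed
  then show "D (D f u) v x \<bullet> b = D (D f v) u x \<bullet> b"
    using second_derivative_symmetric_real[OF Ck_on_inner_const[OF U(1) f] U, of b u v] by simp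
qed

subsection \<open>The Gauss equation\<close>

lemma Ck_on_prod:
  fixes f :: "'i \<Rightarrow> 'a::euclidean_space \<Rightarrow> real"
  assumes "open U" "\<And>i. i \<in> I \<Longrightarrow> Ck_on k (f i) U"
  shows "Ck_on k (\<lambda>x. \<Prod>i\<in>I. f i x) U"
  using assms(2) by (induction I rule: infinite_finite_induct)
    (auto intro: Ck_on_mult Ck_on_const assms(1))

lemma Ck_on_det:
  fixes f :: "'n::finite \<Rightarrow> 'n \<Rightarrow> 'a::euclidean_space \<Rightarrow> real"
  assumes "open U" "\<And>i j. Ck_on k (f i j) U"
  shows "Ck_on k (\<lambda>x. det (\<chi> i j. f i j x)) U"
  unfolding det_def by (simp, intro Ck_on_sum Ck_on_mult Ck_on_prod Ck_on_const assms)

lemma Ck_on_vec: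
  fixes f :: "'n::finite \<Rightarrow> 'a::euclidean_space \<Rightarrow> real"
  assumes "open U" "\<And>i. Ck_on k (f i) U"
  shows "Ck_on k (\<lambda>x. \<chi> i. f i x) U"
proof -
  have "(\<chi> i. f i x) = (\<Sum>i\<in>UNIV. f i x *\<^sub>R axis i 1)" for x
    by (simp add: vec_eq_iff axis_def if_distrib sum.delta cong: if_cong)
  then show ?thesis
    by (simp, intro Ck_on_sum Ck_on_scaleR Ck_on_const assms)
qed

locale immersion =
  fixes \<phi> :: "real ^ 'm::finite \<Rightarrow> 'a::euclidean_space" and U
  assumes open_U: "open U" and Ck_phi: "\<And>k. Ck_on k \<phi> U"
    and inj_deriv: "\<And>x. x \<in> U \<Longrightarrow> inj (frechet_derivative \<phi> (at x))"
begin

abbreviation E :: "real ^ 'm \<Rightarrow> real ^ 'm \<Rightarrow> 'a" where "E u \<equiv> D \<phi> u"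
abbreviation B :: "real ^ 'm \<Rightarrow> real ^ 'm \<Rightarrow> real ^ 'm \<Rightarrow> 'a" where "B u v \<equiv> D (E u) v"
abbreviation g where "g \<equiv> induced_metric \<phi>"
abbreviation \<Gamma> where "\<Gamma> u v \<equiv> \<lambda>x. christoffel g x u v"

lemma Ck_E: "Ck_on k (E u) U" and Ck_B: "Ck_on k (B u v) U"
  using Ck_phi[of "Suc k"] Ck_phi[of "Suc (Suc k)"] by auto

lemma differentiable_phi: "x \<in> U \<Longrightarrow> \<phi> differentiable (at x)"
  and differentiable_E: "x \<in> U \<Longrightarrow> E u differentiable (at x)"
  and differentiable_B: "x \<in> U \<Longrightarrow> B u v differentiable (at x)"
  using Ck_phi[of "Suc 0"] Ck_E[of "Suc 0"] Ck_B[of "Suc 0"] by auto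

lemma linear_E: "x \<in> U \<Longrightarrow> linear (\<lambda>u. E u x)"
  using linear_frechet_derivative[OF differentiable_phi] .

lemma B_sym: "x \<in> U \<Longrightarrow> B u v x = B v u x"
  using second_derivative_symmetric[OF Ck_phi open_U] .

lemma E_eq_0: "x \<in> U \<Longrightarrow> E u x = 0 \<Longrightarrow> u = 0"
  using linear_injective_0[OF linear_E] inj_deriv by blast

lemma inner_E_derivative:
  assumes "x \<in> U"
  shows "D (\<lambda>y. E u y \<bullet> E v y) w x = B u w x \<bullet> E v x + E u x \<bullet> B v w x"
proof -
  have "((\<lambda>y. E u y \<bullet> E v y) has_derivative (\<lambda>w. E u x \<bullet> B v w x + B u w x \<bullet> E v x)) (at x)"
    using differentiable_E[OF assms] by (intro has_derivative_inner) (simp_all add: frechet_derivative_works)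
  from fun_cong[OF frechet_derivative_at[OF this], of w] show ?thesis by simp
qed

text \<open>Each derivative of the metric is a sum of two products of the form
  \<open>B \<bullet> E\<close>. By symmetry of \<open>B\<close>, four of the six terms cancel and
  two coincide. Hence the Christoffel symbol represents the tangential part of the second
  derivative.\<close>

lemma koszul:
  assumes "x \<in> U"
  shows "(D (\<lambda>y. g y v z) u x + D (\<lambda>y. g y u z) v x - D (\<lambda>y. g y u v) z x) / 2 = B u v x \<bullet> E z x"
  unfolding induced_metric_def inner_E_derivative[OF assms]
  using B_sym[OF assms, of u v] B_sym[OF assms, of u z] B_sym[OF assms, of v z]
  by (simp add: inner_commute)

text \<open>Cramer's rule makes the dependence of the Christoffel symbols on the point explicit.\<close>

definition gram :: "real ^ 'm \<Rightarrow> real ^ 'm ^ 'm" where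
  "gram x = (\<chi> i j. E (axis i 1) x \<bullet> E (axis j 1) x)"

lemma gram_mult:
  assumes "x \<in> U"
  shows "(gram x *v w) $ i = E (axis i 1) x \<bullet> E w x"
proof -
  have "E w x = (\<Sum>j\<in>UNIV. w $ j *\<^sub>R E (axis j 1) x)"
    using linear_E[OF assms] by (subst basis_expansion[of w, symmetric])
      (simp add: linear_sum linear_scale scalar_mult_eq_scaleR)
  then show ?thesis
    by (simp add: gram_def matrix_vector_mult_def inner_sum_right mult.commute)
qed

text \<open>If \<open>w\<close> is in the kernel, then \<open>E w x\<close> is orthogonal to all
  vectors spanning the tangent space, hence to itself, and injectivity of the derivative gives
  \<open>w = 0\<close>.\<close>

lemma det_gram:
  assumes x: "x \<in> U"
  shows "det (gram x) \<noteq> 0"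
proof -
  have "w = 0" if "gram x *v w = 0" for w
  proof -
    have "E (axis i 1) x \<bullet> E w x = 0" for i
      using gram_mult[OF x, of w i] that by simp
    then have "(\<Sum>i\<in>UNIV. w $ i *\<^sub>R E (axis i 1) x) \<bullet> E w x = 0"
      by (simp add: inner_sum_left)
    also have "(\<Sum>i\<in>UNIV. w $ i *\<^sub>R E (axis i 1) x) = E w x"
      using linear_E[OF x] by (subst (2) basis_expansion[of w, symmetric])
        (simp add: linear_sum linear_scale scalar_mult_eq_scaleR)
    finally show ?thesis using E_eq_0[OF x] by simp
  qed
  then have "invertible (gram x)"
    unfolding invertible_left_inverse matrix_left_invertible_ker by blast
  then show ?thesis by (simp add: invertible_det_nz)
qed

text \<open>Testing against the basis vectors turns the defining condition of
  \<open>christoffel\<close> into a linear system with the Gram matrix. Its unique solvability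
  justifies the definite description there.\<close>

lemma christoffel_cramer:
  assumes x: "x \<in> U"
  shows "\<Gamma> u v x = (\<chi> k. det (\<chi> i j. if j = k then B u v x \<bullet> E (axis i 1) x
      else E (axis i 1) x \<bullet> E (axis j 1) x) / det (gram x))" (is "_ = ?w")
    and inner_christoffel: "E (\<Gamma> u v x) x \<bullet> E z x = B u v x \<bullet> E z x"
proof -
  have iff: "(\<forall>z. E w x \<bullet> E z x = B u v x \<bullet> E z x) \<longleftrightarrow> w = ?w" for w
  proof -
    have "(\<forall>z. E w x \<bullet> E z x = B u v x \<bullet> E z x) \<longleftrightarrow>
        (\<forall>i. E w x \<bullet> E (axis i 1) x = B u v x \<bullet> E (axis i 1) x)"
    proof (intro iffI allI)
      fix z assume *: "\<forall>i. E w x \<bullet> E (axis i 1) x = B u v x \<bullet> E (axis i 1) x"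
      have "E z x = (\<Sum>i\<in>UNIV. z $ i *\<^sub>R E (axis i 1) x)"
        using linear_E[OF x] by (subst basis_expansion[of z, symmetric])
          (simp add: linear_sum linear_scale scalar_mult_eq_scaleR)
      then show "E w x \<bullet> E z x = B u v x \<bullet> E z x" using * by (simp add: inner_sum_right)
    qed auto
    also have "\<dots> \<longleftrightarrow> gram x *v w = (\<chi> i. B u v x \<bullet> E (axis i 1) x)"
      by (simp add: vec_eq_iff gram_mult[OF x] inner_commute)
    also have "\<dots> \<longleftrightarrow> w = ?w"
      unfolding cramer[OF det_gram[OF x]] by (simp add: gram_def cong: if_cong)
    finally show ?thesis .
  qed
  have "\<Gamma> u v x = (THE w. \<forall>z. E w x \<bullet> E z x = B u v x \<bullet> E z x)"
    unfolding christoffel_def koszul[OF x] by (simp add: induced_metric_def)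
  then show *: "\<Gamma> u v x = ?w" unfolding iff by simp
  show "E (\<Gamma> u v x) x \<bullet> E z x = B u v x \<bullet> E z x" using iff[of "\<Gamma> u v x"] * by blast
qed

lemma differentiable_christoffel:
  assumes x: "x \<in> U"
  shows "\<Gamma> u v differentiable (at x)"
proof -
  have entry: "Ck_on 1 (\<lambda>x. if j = k then B u v x \<bullet> E (axis i 1) x
      else E (axis i 1) x \<bullet> E (axis j 1) x) U" for i j k
    by (cases "j = k") (simp_all del: One_nat_def add: Ck_on_inner open_U Ck_E Ck_B)
  have "Ck_on 1 (\<lambda>x. \<chi> k. det (\<chi> i j. if j = k then B u v x \<bullet> E (axis i 1) x
      else E (axis i 1) x \<bullet> E (axis j 1) x) * inverse (det (gram x))) U"
    unfolding gram_def
    by (intro Ck_on_vec Ck_on_mult Ck_on_inverse Ck_on_det open_U entry Ck_on_inner Ck_E)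
      (use det_gram in \<open>simp add: gram_def\<close>)
  then have "Ck_on 1 (\<Gamma> u v) U"
    by (rule Ck_on_cong[OF open_U]) (simp add: christoffel_cramer divide_inverse)
  then show ?thesis using x by simp
qed

text \<open>Obtained by differentiating the identity \<open>inner_christoffel\<close> along
  \<open>u\<close>. The vector \<open>\<Gamma> v w\<close> moves with the point, so it is expanded
  in the constant basis before the product rule is used; the resulting term with
  \<open>B u (c x) x\<close> is tangentially the one with
  \<open>\<Gamma> u (\<Gamma> v w x)\<close>.\<close>

lemma inner_deriv_christoffel:
  assumes x: "x \<in> U"
  shows "E (D (\<Gamma> v w) u x + \<Gamma> u (\<Gamma> v w x) x) x \<bullet> E z x
    = D (B v w) u x \<bullet> E z x + (B v w x - E (\<Gamma> v w x) x) \<bullet> B z u x"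
proof -
  define c where "c = \<Gamma> v w"
  have dc: "(c has_derivative (\<lambda>u. D c u x)) (at x)"
    using differentiable_christoffel[OF x] by (simp add: c_def frechet_derivative_works)
  have expand: "E p y = (\<Sum>b\<in>Basis. (p \<bullet> b) *\<^sub>R E b y)" if "y \<in> U" for p y
    using frechet_derivative_eq_sum_Basis[OF differentiable_phi[OF that]] .
  have B_expand: "(\<Sum>b\<in>Basis. (p \<bullet> b) *\<^sub>R B b u x) = B u p x" for p
    using frechet_derivative_eq_sum_Basis[OF differentiable_E[OF x], of u p] by (simp add: B_sym[OF x])
  have dE: "(E b has_derivative (\<lambda>u. B b u x)) (at x)" for b
    using differentiable_E[OF x] by (simp add: frechet_derivative_works)
  have "((\<lambda>y. \<Sum>b\<in>Basis. (c y \<bullet> b) *\<^sub>R E b y) has_derivative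
      (\<lambda>u. \<Sum>b\<in>Basis. (c x \<bullet> b) *\<^sub>R B b u x + (D c u x \<bullet> b) *\<^sub>R E b x)) (at x)"
    by (intro has_derivative_sum has_derivative_scaleR has_derivative_inner_left dc dE)
  then have "((\<lambda>y. E (c y) y) has_derivative
      (\<lambda>u. \<Sum>b\<in>Basis. (c x \<bullet> b) *\<^sub>R B b u x + (D c u x \<bullet> b) *\<^sub>R E b x)) (at x)"
    by (rule has_derivative_transform_within_open[OF _ open_U x]) (rule expand[symmetric])
  then have "((\<lambda>y. E (c y) y \<bullet> E z y) has_derivative (\<lambda>u. E (c x) x \<bullet> B z u x +
      (\<Sum>b\<in>Basis. (c x \<bullet> b) *\<^sub>R B b u x + (D c u x \<bullet> b) *\<^sub>R E b x) \<bullet> E z x)) (at x)"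
    by (intro has_derivative_inner dE)
  then have "((\<lambda>y. B v w y \<bullet> E z y) has_derivative (\<lambda>u. E (c x) x \<bullet> B z u x +
      (\<Sum>b\<in>Basis. (c x \<bullet> b) *\<^sub>R B b u x + (D c u x \<bullet> b) *\<^sub>R E b x) \<bullet> E z x)) (at x)"
    by (rule has_derivative_transform_within_open[OF _ open_U x]) (simp add: c_def inner_christoffel)
  moreover have "((\<lambda>y. B v w y \<bullet> E z y) has_derivative
      (\<lambda>u. B v w x \<bullet> B z u x + D (B v w) u x \<bullet> E z x)) (at x)"
    using differentiable_B[OF x] by (intro has_derivative_inner dE) (simp add: frechet_derivative_works)
  ultimately have "(\<lambda>u. E (c x) x \<bullet> B z u x +
      (\<Sum>b\<in>Basis. (c x \<bullet> b) *\<^sub>R B b u x + (D c u x \<bullet> b) *\<^sub>R E b x) \<bullet> E z x)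
      = (\<lambda>u. B v w x \<bullet> B z u x + D (B v w) u x \<bullet> E z x)"
    by (rule has_derivative_unique)
  from fun_cong[OF this, of u]
  have "E (c x) x \<bullet> B z u x + (B u (c x) x + E (D c u x) x) \<bullet> E z x
      = B v w x \<bullet> B z u x + D (B v w) u x \<bullet> E z x"
    by (simp add: sum.distrib B_expand flip: expand[OF x])
  moreover have "E (\<Gamma> u (c x) x) x \<bullet> E z x = B u (c x) x \<bullet> E z x" by (rule inner_christoffel[OF x])
  ultimately show ?thesis
    by (simp add: c_def linear_add[OF linear_E[OF x]] inner_add_left inner_diff_left)
qed

text \<open>Symmetry of third derivatives, which makes them cancel in the curvature tensor.\<close>

lemma D_B_sym:
  assumes x: "x \<in> U"
  shows "D (B v v) u x = D (B u v) v x"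
proof -
  have "D (B v v) u x = D (B v u) v x"
    using second_derivative_symmetric[OF Ck_E open_U x] .
  also have "\<dots> = D (B u v) v x"
    by (rule fun_cong[OF frechet_derivative_transform_within_open[OF differentiable_B[OF x] open_U x]])
      (rule B_sym)
  finally show ?thesis .
qed

text \<open>The difference \<open>B u v x - E (\<Gamma> u v x) x\<close> is the second fundamental
  form, normal by \<open>normal_christoffel\<close>. Pairing it with a full second derivative is
  therefore the same as pairing it with the normal part.\<close>

theorem gauss_equation:
  assumes x: "x \<in> U"
  shows "g x (riemann_curvature g x u v v) u
    = (B v v x - E (\<Gamma> v v x) x) \<bullet> B u u x - (B u v x - E (\<Gamma> u v x) x) \<bullet> B u v x"
proof -
  have "g x (riemann_curvature g x u v v) u
      = E (D (\<Gamma> v v) u x + \<Gamma> u (\<Gamma> v v x) x) x \<bullet> E u x - E (D (\<Gamma> u v) v x + \<Gamma> v (\<Gamma> u v x) x) x \<bullet> E u x"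
    unfolding induced_metric_def[of \<phi> x] riemann_curvature_def
    by (simp add: linear_add[OF linear_E[OF x]] linear_diff[OF linear_E[OF x]] algebra_simps)
  then show ?thesis unfolding inner_deriv_christoffel[OF x] D_B_sym[OF x] by simp
qed

lemma normal_christoffel:
  assumes "x \<in> U"
  shows "(B u v x - E (\<Gamma> u v x) x) \<bullet> E z x = 0"
  using inner_christoffel[OF assms] by (simp add: inner_diff_left)

end

subsection \<open>Sectional curvature of level sets\<close>

text \<open>The Gauss formula for a level set with gradient \<open>n\<close> and Hessian
  \<open>A\<close>: along the unit normal the second fundamental form is -A / |n|, and its two
  factors produce the division by \<open>n \<bullet> n\<close>.\<close>

definition plane_curvature :: "'a::euclidean_space \<Rightarrow> ('a \<Rightarrow> 'a) \<Rightarrow> 'a \<Rightarrow> 'a \<Rightarrow> real" where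
  "plane_curvature n A u v = ((A u \<bullet> u) * (A v \<bullet> v) - (A u \<bullet> v)\<^sup>2) / ((n \<bullet> n) * ((u \<bullet> u) * (v \<bullet> v) - (u \<bullet> v)\<^sup>2))"

section \<open>Quadratic forms on two-planes\<close>

lemma span_pair: "span {u, v} = {a *\<^sub>R u + b *\<^sub>R v | a b. True}"
proof -
  have "\<exists>a b. x = a *\<^sub>R u + b *\<^sub>R v" if x: "x \<in> span {u, v}" for x
  proof -
    obtain a where "x - a *\<^sub>R u \<in> span {v}" using x by (auto simp: span_insert[of u])
    then obtain b where "x - a *\<^sub>R u = b *\<^sub>R v" by (auto simp: span_singleton)
    then show ?thesis by (metis add.commute diff_add_cancel)
  qed
  moreover have "a *\<^sub>R u + b *\<^sub>R v \<in> span {u, v}" for a b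
    by (intro span_add span_scale span_base) auto
  ultimately show ?thesis by blast
qed

lemma dim_span_pair_eq_2_iff:
  fixes u v :: "'a::euclidean_space"
  shows "dim (span {u, v}) = 2 \<longleftrightarrow> (\<forall>a b. a *\<^sub>R u + b *\<^sub>R v = 0 \<longrightarrow> a = 0 \<and> b = 0)"
proof
  assume L: "dim (span {u, v}) = 2"
  have small: "u' \<notin> span {v'}" if "{u', v'} = {u, v}" for u' v'
  proof
    assume "u' \<in> span {v'}"
    then have "span {u, v} = span {v'}" using span_redundant[of u' "{v'}"] that by simp
    then show False using L dim_le_card'[of "{v'}"] by simp
  qed
  show "\<forall>a b. a *\<^sub>R u + b *\<^sub>R v = 0 \<longrightarrow> a = 0 \<and> b = 0"
  proof (intro allI impI, rule ccontr)
    fix a b assume 0: "a *\<^sub>R u + b *\<^sub>R v = 0" and "\<not> (a = 0 \<and> b = 0)"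
    then consider "a \<noteq> 0" | "b \<noteq> 0" by blast
    then show False
    proof cases
      case 1
      have "a *\<^sub>R u = (- b) *\<^sub>R v" using 0 by (simp add: eq_neg_iff_add_eq_0)
      then have "u = (- b / a) *\<^sub>R v" using 1
        by (metis divide_inverse_commute scaleR_one scaleR_scaleR left_inverse)
      then have "u \<in> span {v}" by (metis span_base span_scale singletonI)
      then show False using small[of u v] by simp
    next
      case 2
      have "b *\<^sub>R v = (- a) *\<^sub>R u" using 0 by (simp add: eq_neg_iff_add_eq_0 add.commute)
      then have "v = (- a / b) *\<^sub>R u" using 2
        by (metis divide_inverse_commute scaleR_one scaleR_scaleR left_inverse)
      then have "v \<in> span {u}" by (metis span_base span_scale singletonI)
      then show False using small[of v u] by (simp add: insert_commute)
    qed
  qed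
next
  assume R: "\<forall>a b. a *\<^sub>R u + b *\<^sub>R v = 0 \<longrightarrow> a = 0 \<and> b = 0"
  have "v \<noteq> 0" using R[rule_format, of 0 1] by auto
  moreover have "u \<notin> span {v}"
  proof
    assume "u \<in> span {v}"
    then obtain k where "u = k *\<^sub>R v" by (auto simp: span_singleton)
    then show False using R[rule_format, of 1 "- k"] by simp
  qed
  ultimately have "independent {u, v}" "u \<noteq> v"
    by (auto simp: independent_insert span_base)
  then show "dim (span {u, v}) = 2" using dim_eq_card_independent[of "{u, v}"] by simp
qed

lemma form_det_nonneg:
  fixes A :: "'a::euclidean_space \<Rightarrow> 'a"
  assumes "linear A" "A u \<bullet> v = A v \<bullet> u"
    and nonneg: "\<And>a b. A (a *\<^sub>R u + b *\<^sub>R v) \<bullet> (a *\<^sub>R u + b *\<^sub>R v) \<ge> 0"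
  shows "(A u \<bullet> u) * (A v \<bullet> v) - (A u \<bullet> v)\<^sup>2 \<ge> 0"
proof -
  define p q r where "p = A u \<bullet> u" and "q = A u \<bullet> v" and "r = A v \<bullet> v"
  have form: "A (a *\<^sub>R u + b *\<^sub>R v) \<bullet> (a *\<^sub>R u + b *\<^sub>R v) = a * a * p + 2 * a * b * q + b * b * r" for a b
    by (simp add: p_def q_def r_def linear_add[OF assms(1)] linear_scale[OF assms(1)]
        inner_add_left inner_add_right assms(2) algebra_simps)
  have f: "a * a * p + 2 * a * b * q + b * b * r \<ge> 0" for a b using nonneg[of a b] form by simp
  have "r \<ge> 0" using f[of 0 1] by simp
  have "p * r - q\<^sup>2 \<ge> 0"
  proof (cases "r = 0")
    case True
    have "q = 0"
    proof (rule ccontr)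
      assume q: "q \<noteq> 0"
      \<comment> \<open>For \<open>r = 0\<close> the form at (1, b) is p + 2 b q, and this
        \<open>b\<close> makes it -1.\<close>
      show False using f[of 1 "- (p + 1) / (2 * q)"] q True by (simp add: field_simps)
    qed
    then show ?thesis using True by simp
  next
    case False
    \<comment> \<open>With first coefficient \<open>r\<close>, the form is smallest at second
      coefficient \<open>- q\<close>, where it equals r (p r - q^2).\<close>
    have "r * (p * r - q\<^sup>2) \<ge> 0" using f[of r "- q"] by (simp add: algebra_simps power2_eq_square)
    then show ?thesis using False \<open>r \<ge> 0\<close> by (simp add: zero_le_mult_iff)
  qed
  then show ?thesis by (simp add: p_def q_def r_def)
qed

lemma form_det_pos:
  fixes A :: "'a::euclidean_space \<Rightarrow> 'a"
  assumes "linear A" "A u \<bullet> v = A v \<bullet> u" "dim (span {u, v}) = 2"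
    and pos: "\<And>w. w \<in> span {u, v} \<Longrightarrow> w \<noteq> 0 \<Longrightarrow> A w \<bullet> w > 0"
  shows "(A u \<bullet> u) * (A v \<bullet> v) - (A u \<bullet> v)\<^sup>2 > 0"
proof -
  define p q r where "p = A u \<bullet> u" and "q = A u \<bullet> v" and "r = A v \<bullet> v"
  have form: "A (a *\<^sub>R u + b *\<^sub>R v) \<bullet> (a *\<^sub>R u + b *\<^sub>R v) = a * a * p + 2 * a * b * q + b * b * r" for a b
    by (simp add: p_def q_def r_def linear_add[OF assms(1)] linear_scale[OF assms(1)]
        inner_add_left inner_add_right assms(2) algebra_simps)
  have ind: "a *\<^sub>R u + b *\<^sub>R v \<noteq> 0" if "a \<noteq> 0 \<or> b \<noteq> 0" for a b
    using assms(3) that unfolding dim_span_pair_eq_2_iff by blast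
  have f: "a * a * p + 2 * a * b * q + b * b * r > 0" if "a \<noteq> 0 \<or> b \<noteq> 0" for a b
    unfolding form[symmetric] using ind[OF that] by (intro pos) (auto simp: span_pair)
  have "r > 0" using f[of 0 1] by simp
  then have "r * (p * r - q\<^sup>2) > 0" using f[of r "- q"] by (simp add: algebra_simps power2_eq_square)
  then show ?thesis using \<open>r > 0\<close> by (simp add: p_def q_def r_def zero_less_mult_iff)
qed

lemma gram_pos:
  fixes u v :: "'a::euclidean_space"
  assumes "dim (span {u, v}) = 2"
  shows "(u \<bullet> u) * (v \<bullet> v) - (u \<bullet> v)\<^sup>2 > 0"
  using form_det_pos[of "\<lambda>x. x", OF linear_ident] assms by (simp add: inner_commute)

lemma form_det_change_of_basis:
  fixes A :: "'a::euclidean_space \<Rightarrow> 'a"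
  assumes "linear A" "A u \<bullet> v = A v \<bullet> u" "u' = a *\<^sub>R u + b *\<^sub>R v" "v' = c *\<^sub>R u + d *\<^sub>R v"
  shows "(A u' \<bullet> u') * (A v' \<bullet> v') - (A u' \<bullet> v')\<^sup>2
    = (a * d - b * c)\<^sup>2 * ((A u \<bullet> u) * (A v \<bullet> v) - (A u \<bullet> v)\<^sup>2)"
proof -
  define p q r where "p = A u \<bullet> u" and "q = A u \<bullet> v" and "r = A v \<bullet> v"
  have form: "A (a *\<^sub>R u + b *\<^sub>R v) \<bullet> (c *\<^sub>R u + d *\<^sub>R v)
      = a * c * p + (a * d + b * c) * q + b * d * r" for a b c d
    by (simp add: p_def q_def r_def linear_add[OF assms(1)] linear_scale[OF assms(1)]
        inner_add_left inner_add_right assms(2) algebra_simps)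
  show ?thesis unfolding assms(3,4) form unfolding p_def[symmetric] q_def[symmetric] r_def[symmetric]
    by (simp add: algebra_simps power2_eq_square)
qed

text \<open>A change of basis multiplies the determinant of every symmetric form on the plane by the
  square of its own determinant. Numerator and Gram determinant carry the same factor, nonzero
  because the new pair is again a basis.\<close>

lemma plane_curvature_cong:
  fixes A :: "'a::euclidean_space \<Rightarrow> 'a"
  assumes A: "linear A" "A u \<bullet> v = A v \<bullet> u"
    and span: "span {u, v} = span {u', v'}" and dim: "dim (span {u, v}) = 2"
  shows "plane_curvature n A u' v' = plane_curvature n A u v"
proof -
  have "u' \<in> span {u, v}" "v' \<in> span {u, v}" unfolding span by (auto intro: span_base)
  then obtain a b c d where u': "u' = a *\<^sub>R u + b *\<^sub>R v" and v': "v' = c *\<^sub>R u + d *\<^sub>R v"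
    unfolding span_pair by blast
  have id: "(u' \<bullet> u') * (v' \<bullet> v') - (u' \<bullet> v')\<^sup>2 = (a * d - b * c)\<^sup>2 * ((u \<bullet> u) * (v \<bullet> v) - (u \<bullet> v)\<^sup>2)"
    using form_det_change_of_basis[of "\<lambda>x. x", OF linear_ident inner_commute u' v'] .
  moreover have "(u' \<bullet> u') * (v' \<bullet> v') - (u' \<bullet> v')\<^sup>2 > 0" using gram_pos span dim by metis
  ultimately have "(a * d - b * c)\<^sup>2 \<noteq> 0" by auto
  then show ?thesis
    unfolding plane_curvature_def id form_det_change_of_basis[OF A u' v']
    by (simp add: mult.left_commute[of "n \<bullet> n"])
qed

locale level_set =
  fixes G :: "'a::euclidean_space \<Rightarrow> real" and n :: "'a \<Rightarrow> 'a" and A :: "'a \<Rightarrow> 'a \<Rightarrow> 'a"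
    and c :: real and S :: "'a set" and T :: "(real ^ 'm::finite) itself"
  assumes S_subset: "\<And>p. p \<in> S \<Longrightarrow> G p = c"
    and G_deriv: "\<And>p. (G has_derivative (\<lambda>v. n p \<bullet> v)) (at p)"
    and n_deriv: "\<And>p. (n has_derivative A p) (at p)"
    and A_sym: "\<And>p u v. A p u \<bullet> v = A p v \<bullet> u"
    and n_nonzero: "\<And>p. p \<in> S \<Longrightarrow> n p \<noteq> 0"
    and codim_1: "DIM('a) = CARD('m) + 1"
    and embedded: "embedded_submanifold T S"
begin

lemma linear_A: "linear (A p)"
  using n_deriv has_derivative_linear by blast

context
  fixes \<phi> :: "real ^ 'm \<Rightarrow> 'a" and U
  assumes param: "local_parametrization \<phi> U S"
begin

interpretation immersion \<phi> U
  using param unfolding local_parametrization_def smooth_on_open_def by unfold_locales auto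

lemma phi_in_S: "x \<in> U \<Longrightarrow> \<phi> x \<in> S"
  using param openin_imp_subset unfolding local_parametrization_def by blast

lemma phi_deriv: "x \<in> U \<Longrightarrow> (\<phi> has_derivative (\<lambda>u. D \<phi> u x)) (at x)"
  using differentiable_phi by (simp add: frechet_derivative_works)

lemma n_inner_E:
  assumes x: "x \<in> U"
  shows "n (\<phi> x) \<bullet> D \<phi> u x = 0"
proof -
  have "((\<lambda>x. G (\<phi> x)) has_derivative (\<lambda>u. n (\<phi> x) \<bullet> D \<phi> u x)) (at x)"
    by (rule has_derivative_compose[OF phi_deriv[OF x] G_deriv])
  moreover have "((\<lambda>x. G (\<phi> x)) has_derivative (\<lambda>u. 0)) (at x)"
    by (rule has_derivative_transform_within_open[OF has_derivative_const[of c] open_U x])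
      (simp add: S_subset phi_in_S)
  ultimately show ?thesis using has_derivative_unique by (metis (no_types))
qed

text \<open>The product rule applied to the orthogonality \<open>n_inner_E\<close>: the normal part
  of the second derivative is read off from the Hessian.\<close>

lemma n_inner_B:
  assumes x: "x \<in> U"
  shows "n (\<phi> x) \<bullet> D (D \<phi> u) v x = - (A (\<phi> x) (D \<phi> u x) \<bullet> D \<phi> v x)"
proof -
  have "((\<lambda>y. n (\<phi> y)) has_derivative (\<lambda>v. A (\<phi> x) (D \<phi> v x))) (at x)"
    by (rule has_derivative_compose[OF phi_deriv[OF x] n_deriv])
  moreover have "(D \<phi> u has_derivative (\<lambda>v. D (D \<phi> u) v x)) (at x)"
    using differentiable_E[OF x] by (simp add: frechet_derivative_works)
  ultimately have "((\<lambda>y. n (\<phi> y) \<bullet> D \<phi> u y) has_derivative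
      (\<lambda>v. n (\<phi> x) \<bullet> D (D \<phi> u) v x + A (\<phi> x) (D \<phi> v x) \<bullet> D \<phi> u x)) (at x)"
    by (rule has_derivative_inner)
  moreover have "((\<lambda>y. n (\<phi> y) \<bullet> D \<phi> u y) has_derivative (\<lambda>v. 0)) (at x)"
    by (rule has_derivative_transform_within_open[OF has_derivative_const[of 0] open_U x])
      (simp add: n_inner_E)
  ultimately have "(\<lambda>v. n (\<phi> x) \<bullet> D (D \<phi> u) v x + A (\<phi> x) (D \<phi> v x) \<bullet> D \<phi> u x) = (\<lambda>v. 0)"
    by (rule has_derivative_unique)
  from fun_cong[OF this, of v] show ?thesis using A_sym[of "\<phi> x" "D \<phi> v x" "D \<phi> u x"] by simp
qed

text \<open>Tangent vectors are orthogonal to the gradient, and both spaces have dimension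
  \<open>CARD('m)\<close>.\<close>

lemma range_E:
  assumes x: "x \<in> U"
  shows "range (\<lambda>u. D \<phi> u x) = {v. n (\<phi> x) \<bullet> v = 0}"
proof (rule subspace_dim_equal)
  show "subspace (range (\<lambda>u. D \<phi> u x))" using linear_E[OF x] by (simp add: linear_subspace_image)
  show "subspace {v. n (\<phi> x) \<bullet> v = 0}" by (rule subspace_hyperplane)
  show "range (\<lambda>u. D \<phi> u x) \<subseteq> {v. n (\<phi> x) \<bullet> v = 0}" using n_inner_E[OF x] by auto
  have "dim (range (\<lambda>u. D \<phi> u x)) = dim (UNIV :: (real ^ 'm) set)"
    using inj_deriv[OF x] by (intro dim_image_eq linear_E[OF x]) simp
  moreover have "dim {v. n (\<phi> x) \<bullet> v = 0} = DIM('a) - 1"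
    by (rule dim_hyperplane) (use n_nonzero phi_in_S x in blast)
  ultimately show "dim {v. n (\<phi> x) \<bullet> v = 0} \<le> dim (range (\<lambda>u. D \<phi> u x))"
    using codim_1 by simp
qed

text \<open>The left side is orthogonal to the tangent space, whose complement is the line of
  \<open>n (\<phi> x)\<close>; so it is a multiple of the gradient, with coefficient given by
  \<open>n_inner_B\<close>.\<close>

lemma normal_component:
  assumes x: "x \<in> U"
  shows "D (D \<phi> u) v x - D \<phi> (christoffel (induced_metric \<phi>) x u v) x
    = - (A (\<phi> x) (D \<phi> u x) \<bullet> D \<phi> v x / (n (\<phi> x) \<bullet> n (\<phi> x))) *\<^sub>R n (\<phi> x)"
proof -
  define N where "N = n (\<phi> x)"
  define w where "w = D (D \<phi> u) v x - D \<phi> (christoffel (induced_metric \<phi>) x u v) x"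
  have N: "N \<bullet> N \<noteq> 0" using n_nonzero[OF phi_in_S[OF x]] by (simp add: N_def)
  define t where "t = w - (w \<bullet> N / (N \<bullet> N)) *\<^sub>R N"
  have "N \<bullet> t = 0" using N by (simp add: t_def inner_diff_right inner_commute)
  then obtain z where z: "t = D \<phi> z x" using range_E[OF x] by (auto simp: N_def)
  have "w \<bullet> t = 0" using normal_christoffel[OF x, of u v z] by (simp add: w_def z)
  then have "t \<bullet> t = 0" using \<open>N \<bullet> t = 0\<close> by (simp add: t_def inner_diff_left)
  then have "w = (w \<bullet> N / (N \<bullet> N)) *\<^sub>R N" by (simp add: t_def)
  moreover have "w \<bullet> N = - (A (\<phi> x) (D \<phi> u x) \<bullet> D \<phi> v x)"
    by (subst inner_commute)
      (simp add: w_def N_def inner_diff_right n_inner_B[OF x] n_inner_E[OF x])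
  ultimately show ?thesis by (simp add: w_def N_def)
qed

lemma coord_sectional_curvature_eq:
  assumes x: "x \<in> U"
  shows "coord_sectional_curvature (induced_metric \<phi>) x u v
    = plane_curvature (n (\<phi> x)) (A (\<phi> x)) (D \<phi> u x) (D \<phi> v x)"
proof -
  have N: "n (\<phi> x) \<bullet> n (\<phi> x) \<noteq> 0" using n_nonzero[OF phi_in_S[OF x]] by simp
  have "induced_metric \<phi> x (riemann_curvature (induced_metric \<phi>) x u v v) u
      = ((A (\<phi> x) (D \<phi> u x) \<bullet> D \<phi> u x) * (A (\<phi> x) (D \<phi> v x) \<bullet> D \<phi> v x)
        - (A (\<phi> x) (D \<phi> u x) \<bullet> D \<phi> v x)\<^sup>2) / (n (\<phi> x) \<bullet> n (\<phi> x))"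
    unfolding gauss_equation[OF x] normal_component[OF x] inner_scaleR_left n_inner_B[OF x]
    by (simp add: diff_divide_distrib power2_eq_square mult.commute)
  then show ?thesis
    unfolding coord_sectional_curvature_def plane_curvature_def
    by (simp add: induced_metric_def)
qed

end

lemma parametrization_exists:
  assumes "p \<in> S"
  obtains \<phi> :: "real ^ 'm \<Rightarrow> 'a" and U x where "local_parametrization \<phi> U S" "x \<in> U" "\<phi> x = p"
proof -
  have "\<exists>(\<phi> :: real ^ 'm \<Rightarrow> 'a) U. local_parametrization \<phi> U S \<and> p \<in> \<phi> ` U"
    using embedded assms unfolding embedded_submanifold_def by (rule bspec)
  then show ?thesis using that by (elim exE conjE imageE) metis
qed

lemma tangent_space_eq:
  assumes p: "p \<in> S"
  shows "tangent_space T S p = {v. n p \<bullet> v = 0}"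
proof -
  obtain \<phi> :: "real ^ 'm \<Rightarrow> 'a" and U x where \<phi>: "local_parametrization \<phi> U S" "x \<in> U" "\<phi> x = p"
    using parametrization_exists[OF p] .
  show ?thesis
  proof
    show "tangent_space T S p \<subseteq> {v. n p \<bullet> v = 0}"
      unfolding tangent_space_def using n_inner_E by auto
    show "{v. n p \<bullet> v = 0} \<subseteq> tangent_space T S p"
    proof
      fix v assume "v \<in> {v. n p \<bullet> v = 0}"
      then obtain u where "v = D \<phi> u x" using range_E[OF \<phi>(1,2)] \<phi>(3) by auto
      then show "v \<in> tangent_space T S p" unfolding tangent_space_def using \<phi> by blast
    qed
  qed
qed

text \<open>Every chart and every basis of the plane produce the value of
  \<open>plane_curvature\<close>, which depends on the plane alone. This is what the definite
  description in \<open>sectional_curvature\<close> requires.\<close>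

lemma sectional_curvature_eq:
  assumes p: "p \<in> S" and P: "P \<in> tangent_planes T S p" "P = span {u, v}"
  shows "sectional_curvature T S p P = plane_curvature (n p) (A p) u v"
  unfolding sectional_curvature_def
proof (rule the_equality)
  have dim: "dim (span {u, v}) = 2" using P by (auto simp: tangent_planes_def)
  obtain \<phi> :: "real ^ 'm \<Rightarrow> 'a" and U x where \<phi>: "local_parametrization \<phi> U S" "x \<in> U" "\<phi> x = p"
    using parametrization_exists[OF p] .
  have "u \<in> P" "v \<in> P" unfolding P(2) by (simp_all add: span_base)
  then have "u \<in> tangent_space T S p" "v \<in> tangent_space T S p" using P(1) by (auto simp: tangent_planes_def)
  then have "u \<in> range (\<lambda>u. D \<phi> u x)" "v \<in> range (\<lambda>u. D \<phi> u x)"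
    unfolding range_E[OF \<phi>(1,2)] tangent_space_eq[OF p] \<phi>(3) .
  then obtain u' v' where uv: "u = D \<phi> u' x" "v = D \<phi> v' x" by blast
  show "\<exists>(\<phi> :: real ^ 'm \<Rightarrow> 'a) U x u' v'. local_parametrization \<phi> U S \<and> x \<in> U \<and> \<phi> x = p
      \<and> span {D \<phi> u' x, D \<phi> v' x} = P
      \<and> plane_curvature (n p) (A p) u v = coord_sectional_curvature (induced_metric \<phi>) x u' v'"
    using \<phi> uv P coord_sectional_curvature_eq[OF \<phi>(1,2), of u' v'] by metis
  fix s assume "\<exists>(\<phi> :: real ^ 'm \<Rightarrow> 'a) U x u' v'. local_parametrization \<phi> U S \<and> x \<in> U \<and> \<phi> x = p
      \<and> span {D \<phi> u' x, D \<phi> v' x} = P \<and> s = coord_sectional_curvature (induced_metric \<phi>) x u' v'"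
  then obtain \<phi> :: "real ^ 'm \<Rightarrow> 'a" and U x u' v' where *: "local_parametrization \<phi> U S" "x \<in> U" "\<phi> x = p"
    "span {D \<phi> u' x, D \<phi> v' x} = P" "s = coord_sectional_curvature (induced_metric \<phi>) x u' v'" by blast
  have "s = plane_curvature (n p) (A p) (D \<phi> u' x) (D \<phi> v' x)"
    using coord_sectional_curvature_eq[OF *(1,2)] * by simp
  also have "\<dots> = plane_curvature (n p) (A p) u v"
    using *(4) P(2) dim by (intro plane_curvature_cong linear_A A_sym) auto
  finally show "s = plane_curvature (n p) (A p) u v" .
qed

lemma tangent_plane_basis:
  assumes p: "p \<in> S" and P: "P \<in> tangent_planes T S p"
  obtains u v where "P = span {u, v}" "dim (span {u, v}) = 2"
    "\<And>w. w \<in> span {u, v} \<Longrightarrow> n p \<bullet> w = 0"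
proof -
  have sub: "subspace P" "dim P = 2" "P \<subseteq> {v. n p \<bullet> v = 0}"
    using P by (auto simp: tangent_planes_def tangent_space_eq[OF p])
  obtain B where B: "B \<subseteq> P" "independent B" "P \<subseteq> span B" "card B = 2"
    using basis_exists[of P] sub(2) by metis
  then obtain u v where "B = {u, v}" by (meson card_2_iff)
  moreover have "span B = P" using B sub(1) by (simp add: span_minimal subset_antisym)
  ultimately show ?thesis using that[of u v] sub by auto
qed

lemma tangent_plane_span:
  assumes p: "p \<in> S" and "dim (span {u, v}) = 2" "n p \<bullet> u = 0" "n p \<bullet> v = 0"
  shows "span {u, v} \<in> tangent_planes T S p"
  using assms span_minimal[OF _ subspace_hyperplane, of "{u, v}" "n p"]
  by (auto simp: tangent_planes_def tangent_space_eq[OF p])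

lemma sectional_curvature_nonneg:
  assumes p: "p \<in> S" and P: "P \<in> tangent_planes T S p"
    and nonneg: "\<And>w. n p \<bullet> w = 0 \<Longrightarrow> A p w \<bullet> w \<ge> 0"
  shows "sectional_curvature T S p P \<ge> 0"
proof -
  obtain u v where uv: "P = span {u, v}" "dim (span {u, v}) = 2"
    "\<And>w. w \<in> span {u, v} \<Longrightarrow> n p \<bullet> w = 0" using tangent_plane_basis[OF p P] by metis
  have "(A p u \<bullet> u) * (A p v \<bullet> v) - (A p u \<bullet> v)\<^sup>2 \<ge> 0"
    using uv(3) by (intro form_det_nonneg linear_A A_sym nonneg) (auto simp: span_pair)
  then show ?thesis
    unfolding sectional_curvature_eq[OF p P uv(1)] plane_curvature_def
    using gram_pos[OF uv(2)] by simp
qed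

lemma sectional_curvature_pos:
  assumes p: "p \<in> S" and P: "P \<in> tangent_planes T S p"
    and pos: "\<And>w. n p \<bullet> w = 0 \<Longrightarrow> w \<noteq> 0 \<Longrightarrow> A p w \<bullet> w > 0"
  shows "sectional_curvature T S p P > 0"
proof -
  obtain u v where uv: "P = span {u, v}" "dim (span {u, v}) = 2"
    "\<And>w. w \<in> span {u, v} \<Longrightarrow> n p \<bullet> w = 0" using tangent_plane_basis[OF p P] by metis
  have "(A p u \<bullet> u) * (A p v \<bullet> v) - (A p u \<bullet> v)\<^sup>2 > 0"
    using uv(2,3) by (intro form_det_pos linear_A A_sym pos) auto
  then show ?thesis
    unfolding sectional_curvature_eq[OF p P uv(1)] plane_curvature_def
    using gram_pos[OF uv(2)] n_nonzero[OF p] by simp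
qed

text \<open>Any plane through a kernel vector has vanishing determinant. A second tangent direction
  orthogonal to \<open>w\<close> exists because the ambient dimension is at least 3.\<close>

lemma zero_curvature_if_kernel:
  assumes p: "p \<in> S" and w: "n p \<bullet> w = 0" "w \<noteq> 0" "\<And>v. A p w \<bullet> v = 0" and m: "CARD('m) \<ge> 2"
  shows "p \<in> zero_curvature_locus T S"
proof -
  have "\<exists>v. n p \<bullet> v = 0 \<and> w \<bullet> v = 0 \<and> v \<noteq> 0"
  proof -
    have "dim (span {n p, w}) < DIM('a)"
      using dim_le_card'[of "{n p, w}"] card_insert_le_m1[of 2 "{w}" "n p"] codim_1 m by simp
    then obtain v where "v \<noteq> 0" "\<And>y. y \<in> span {n p, w} \<Longrightarrow> orthogonal v y"
      using orthogonal_to_subspace_exists[of "span {n p, w}"] by (auto simp: span_span)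
    then show ?thesis by (metis insertI1 insertI2 inner_commute orthogonal_def span_base)
  qed
  then obtain v where v: "n p \<bullet> v = 0" "w \<bullet> v = 0" "v \<noteq> 0" by blast
  have vw: "v \<bullet> w = 0" using v(2) by (simp add: inner_commute)
  have "dim (span {w, v}) = 2"
    unfolding dim_span_pair_eq_2_iff
  proof (intro allI impI)
    fix a b assume "a *\<^sub>R w + b *\<^sub>R v = 0"
    then have "(a *\<^sub>R w + b *\<^sub>R v) \<bullet> w = 0" "(a *\<^sub>R w + b *\<^sub>R v) \<bullet> v = 0" by simp_all
    then show "a = 0 \<and> b = 0" using v w vw by (simp add: inner_add_left)
  qed
  then have P: "span {w, v} \<in> tangent_planes T S p" using v w by (intro tangent_plane_span p)
  have "sectional_curvature T S p (span {w, v}) = 0"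
    unfolding sectional_curvature_eq[OF p P refl] plane_curvature_def using w(3) by simp
  then show ?thesis unfolding zero_curvature_locus_def using P p by blast
qed

end

subsection \<open>Images of the sphere under ambient diffeomorphisms\<close>

locale ambient_diffeomorphism =
  fixes \<Phi> \<Psi> :: "'a::euclidean_space \<Rightarrow> 'a" and T :: "(real ^ 'm::finite) itself"
  assumes Ck_Phi: "\<And>k. Ck_on k \<Phi> UNIV" and Ck_Psi: "\<And>k. Ck_on k \<Psi> UNIV"
    and Psi_Phi: "\<And>x. \<Psi> (\<Phi> x) = x" and Phi_Psi: "\<And>x. \<Phi> (\<Psi> x) = x"
    and dim: "DIM('a) = CARD('m) + 1"
begin

lemma diffeomorphic_sphere: "diffeomorphic (\<Psi> ` sphere 0 1) (sphere (0 :: 'a) 1)"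
proof -
  have "homeomorphism (\<Psi> ` sphere 0 1) (sphere 0 1) \<Phi> \<Psi>"
    using Ck_on_continuous[OF Ck_Phi] Ck_on_continuous[OF Ck_Psi]
    by (auto simp: homeomorphism_def Psi_Phi Phi_Psi image_image intro: continuous_on_subset)
  moreover have "smooth_map_on \<Phi> X" "smooth_map_on \<Psi> X" for X
    using Ck_Phi Ck_Psi by (auto simp: smooth_map_on_def smooth_on_open_def intro!: exI[of _ UNIV])
  ultimately show ?thesis
    unfolding diffeomorphic_def by blast
qed

text \<open>Around \<open>\<Psi> P\<close> the chart is the image under \<open>\<Psi>\<close> of the
  hemisphere with pole \<open>P\<close>, written as a graph over the hyperplane orthogonal to
  \<open>P\<close>. Its left inverse, \<open>\<Phi>\<close> followed by a projection, is smooth on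
  the whole space; this gives the continuous inverse and, by the chain rule, injectivity of the
  derivative. No implicit function theorem enters.\<close>

lemma embedded_sphere: "embedded_submanifold T (\<Psi> ` sphere 0 1)"
  unfolding embedded_submanifold_def
proof
  let ?S = "\<Psi> ` sphere 0 1"
  fix p assume "p \<in> ?S"
  then obtain P where P: "norm P = 1" "p = \<Psi> P" by auto
  have PP: "P \<bullet> P = 1" using P by (simp add: dot_square_norm)
  have deq: "dim (UNIV :: (real ^ 'm) set) = dim {v. P \<bullet> v = 0}"
    using dim_hyperplane[of P] P dim by force
  obtain L :: "real ^ 'm \<Rightarrow> 'a" and M' where L: "linear L" "linear M'" "L ` UNIV = {v. P \<bullet> v = 0}"
    "\<And>u. norm (L u) = norm u" "\<And>u. M' (L u) = u"
    "\<And>v. v \<in> {v. P \<bullet> v = 0} \<Longrightarrow> L (M' v) = v"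
    by (rule isometries_subspaces[OF subspace_UNIV subspace_hyperplane deq]) (simp only: UNIV_I)
  have PL: "P \<bullet> L u = 0" for u using L(3) by blast
  have LP: "L u \<bullet> P = 0" for u using PL by (simp add: inner_commute)
  define U where "U = ball (0 :: real ^ 'm) 1"
  define \<sigma> where "\<sigma> u = L u + sqrt (1 + - (u \<bullet> u)) *\<^sub>R P" for u
  define \<phi> where "\<phi> u = \<Psi> (\<sigma> u)" for u
  define M where "M v = M' (v - (v \<bullet> P) *\<^sub>R P)" for v
  define \<psi> where "\<psi> x = M (\<Phi> x)" for x
  have U_iff: "u \<in> U \<longleftrightarrow> u \<bullet> u < 1" for u
    by (simp add: U_def norm_eq_sqrt_inner)
  have op: "open U" by (simp add: U_def)
  have bl: "bounded_linear L" "bounded_linear M'" using L by (simp_all add: linear_linear)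
  have Ms: "M (\<sigma> u) = u" for u
    using L(5) PP by (simp add: M_def \<sigma>_def inner_add_left LP PL)
  have Ck_sigma: "Ck_on k \<sigma> U" for k
    unfolding \<sigma>_def[abs_def]
    by (intro Ck_on_add Ck_on_bounded_linear Ck_on_scaleR Ck_on_sqrt Ck_on_minus Ck_on_inner
        Ck_on_const op bl bounded_linear_ident) (simp add: U_iff)
  have Ck_phi: "Ck_on k \<phi> U" for k
    unfolding \<phi>_def[abs_def] by (rule Ck_on_compose[OF op open_UNIV Ck_sigma Ck_Psi]) simp
  have "bounded_linear (\<lambda>v. v - (v \<bullet> P) *\<^sub>R P)"
    unfolding linear_conv_bounded_linear[symmetric]
    by (rule linearI) (simp_all add: algebra_simps inner_add_left)
  then have blM: "bounded_linear M"
    unfolding M_def[abs_def] by (rule bounded_linear_compose[OF bl(2)])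
  have Ck_psi: "Ck_on k \<psi> UNIV" for k
    unfolding \<psi>_def[abs_def] by (rule Ck_on_linear_compose[OF open_UNIV blM Ck_Phi])
  have psi_phi: "\<psi> (\<phi> u) = u" for u by (simp add: \<psi>_def \<phi>_def Phi_Psi Ms)
  have sphere: "norm (\<sigma> u) = 1" if "u \<in> U" for u
  proof -
    have "\<sigma> u \<bullet> \<sigma> u = L u \<bullet> L u + (sqrt (1 + - (u \<bullet> u)))\<^sup>2"
      using PP by (simp add: \<sigma>_def inner_add_left inner_add_right LP PL power2_eq_square)
    also have "L u \<bullet> L u = u \<bullet> u" by (simp add: dot_square_norm L(4))
    finally have "\<sigma> u \<bullet> \<sigma> u = 1" using that by (simp add: U_iff)
    then show ?thesis by (simp add: norm_eq_sqrt_inner)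
  qed
  have image: "\<phi> ` U = ?S \<inter> {x. \<Phi> x \<bullet> P > 0}"
  proof
    show "\<phi> ` U \<subseteq> ?S \<inter> {x. \<Phi> x \<bullet> P > 0}"
    proof
      fix x assume "x \<in> \<phi> ` U"
      then obtain u where u: "u \<in> U" "x = \<phi> u" by blast
      have "\<sigma> u \<bullet> P = sqrt (1 + - (u \<bullet> u))"
        using PP by (simp add: \<sigma>_def inner_add_left LP PL)
      then show "x \<in> ?S \<inter> {x. \<Phi> x \<bullet> P > 0}"
        using sphere[OF u(1)] u by (auto simp: \<phi>_def Phi_Psi U_iff)
    qed
    show "?S \<inter> {x. \<Phi> x \<bullet> P > 0} \<subseteq> \<phi> ` U"
    proof
      fix x assume "x \<in> ?S \<inter> {x. \<Phi> x \<bullet> P > 0}"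
      then obtain s where s: "norm s = 1" "x = \<Psi> s" "s \<bullet> P > 0" by (auto simp: Phi_Psi)
      define c where "c = s \<bullet> P"
      define u where "u = M s"
      have "P \<bullet> (s - c *\<^sub>R P) = 0" by (simp add: inner_diff_right PP c_def inner_commute)
      then have Lu: "L u = s - c *\<^sub>R P" using L(6) by (simp add: u_def M_def c_def)
      have "u \<bullet> u = L u \<bullet> L u" by (simp add: dot_square_norm L(4))
      also have "\<dots> = 1 - c\<^sup>2"
        using PP s(1) by (simp add: Lu inner_diff_left inner_diff_right inner_commute[of P s]
            norm_eq_1 power2_eq_square flip: c_def)
      finally have uu: "u \<bullet> u = 1 - c\<^sup>2" .
      have "\<sigma> u = s" using s(3) by (simp add: \<sigma>_def uu Lu c_def)
      moreover have "u \<in> U" using s(3) by (simp add: U_iff uu c_def)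
      ultimately show "x \<in> \<phi> ` U" using s(2) by (force simp: \<phi>_def)
    qed
  qed
  have "local_parametrization \<phi> U ?S"
    unfolding local_parametrization_def
  proof (intro conjI ballI exI)
    show "smooth_on_open \<phi> U" using Ck_phi op by (simp add: smooth_on_open_def)
    show "homeomorphism U (\<phi> ` U) \<phi> \<psi>"
      using Ck_on_continuous[OF Ck_phi] Ck_on_continuous[OF Ck_psi] psi_phi
      by (auto simp: homeomorphism_def image_image intro: continuous_on_subset)
    have "open {x. \<Phi> x \<bullet> P > 0}"
      using Ck_on_continuous[OF Ck_Phi] by (intro open_Collect_less continuous_intros) auto
    then show "openin (top_of_set ?S) (\<phi> ` U)" unfolding image by (rule openin_open_Int)
    fix x assume x: "x \<in> U"
    have d1: "(\<phi> has_derivative frechet_derivative \<phi> (at x)) (at x)"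
      using Ck_on_has_derivative[OF Ck_phi x] .
    have d2: "(\<psi> has_derivative frechet_derivative \<psi> (at (\<phi> x))) (at (\<phi> x))"
      using Ck_on_has_derivative[OF Ck_psi UNIV_I] .
    have "((\<lambda>u. u) has_derivative (\<lambda>v. frechet_derivative \<psi> (at (\<phi> x)) (frechet_derivative \<phi> (at x) v))) (at x)"
      using has_derivative_compose[OF d1 d2] by (simp add: psi_phi)
    then have "(\<lambda>v. frechet_derivative \<psi> (at (\<phi> x)) (frechet_derivative \<phi> (at x) v)) = (\<lambda>v. v)"
      using has_derivative_ident has_derivative_unique by blast
    then show "inj (frechet_derivative \<phi> (at x))" by (metis injI)
  qed
  moreover have "p \<in> \<phi> ` U"
    unfolding image using P PP by (auto simp: Phi_Psi)
  ultimately show "\<exists>(\<phi> :: real ^ 'm \<Rightarrow> 'a) U. local_parametrization \<phi> U ?S \<and> p \<in> \<phi> ` U"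
    by blast
qed

end

subsection \<open>The hypersurface\<close>

text \<open>The second derivative 1/50 provides positivity along \<open>e\<close> where
  \<open>Y x\<close> is nonzero. The coefficient is small enough that the mixed Hessian factor t/25
  stays below the geometric mean of 1/50 and 2 for |t| < 3.\<close>

definition warp :: "real \<Rightarrow> real" where "warp t = 1 + t * t / 100"

lemma warp_pos: "warp t > 0"
  by (simp add: warp_def add_pos_nonneg)

lemma Ck_on_warp: "Ck_on k warp UNIV"
proof -
  have "Ck_on k (\<lambda>t::real. 1 + t * t * (1 / 100)) UNIV"
    by (intro Ck_on_add Ck_on_mult Ck_on_const Ck_on_bounded_linear) auto
  then show ?thesis by (simp add: warp_def[abs_def])
qed

lemma Ck_coordinate:
  assumes "Ck_on k g UNIV"
  shows "Ck_on k (\<lambda>x. g (x \<bullet> b)) UNIV"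
  by (rule Ck_on_compose[OF open_UNIV open_UNIV _ assms])
    (auto intro: Ck_on_bounded_linear bounded_linear_inner_left)

lemma real_has_derivative_inner:
  assumes "\<And>t. (g has_real_derivative g' t) (at t)"
  shows "((\<lambda>x. g (x \<bullet> b)) has_derivative (\<lambda>u. g' (x \<bullet> b) * (u \<bullet> b))) (at x)"
proof -
  have "((\<lambda>x. x \<bullet> b) has_derivative (\<lambda>u. u \<bullet> b)) (at x)"
    by (auto intro!: derivative_eq_intros)
  from has_derivative_compose[OF this assms[unfolded has_field_derivative_def]] show ?thesis .
qed

text \<open>The upper end 3/4 keeps \<open>h\<close> at most 9/16 on \<open>K\<close>, so that the
  remaining 1 - h t is a value of \<open>l\<close> on the half-line \<open>L\<close>. The lower end
  1/2 keeps \<open>K\<close> away from the quadratic part of \<open>h\<close>.\<close>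

locale hypersurface = P: profile K h h' w + Q: profile L l l' r
  for K h h' w L l l' r +
  fixes e f :: "'a::euclidean_space" and T :: "(real ^ 'm::finite) itself"
  assumes K: "K \<subseteq> {1 / 2..3 / 4}" "closed K" and L: "L = {1 / 2..}"
    and e: "e \<bullet> e = 1" and f: "f \<bullet> f = 1" and ef: "e \<bullet> f = 0"
    and dim: "DIM('a) = CARD('m) + 1" and m: "CARD('m) \<ge> 2"
begin

lemma fe: "f \<bullet> e = 0" using ef by (simp add: inner_commute)

definition Y :: "'a \<Rightarrow> 'a" where "Y x = x - (x \<bullet> e) *\<^sub>R e - (x \<bullet> f) *\<^sub>R f"

definition G :: "'a \<Rightarrow> real" where
  "G x = h (x \<bullet> e) + warp (x \<bullet> e) * (Y x \<bullet> Y x) + l (x \<bullet> f)"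

definition n :: "'a \<Rightarrow> 'a" where
  "n x = (h' (x \<bullet> e) + (x \<bullet> e) / 50 * (Y x \<bullet> Y x)) *\<^sub>R e + (2 * warp (x \<bullet> e)) *\<^sub>R Y x
    + l' (x \<bullet> f) *\<^sub>R f"

definition A :: "'a \<Rightarrow> 'a \<Rightarrow> 'a" where
  "A x u = ((w (x \<bullet> e) + (Y x \<bullet> Y x) / 50) * (u \<bullet> e) + (x \<bullet> e) / 25 * (Y x \<bullet> u)) *\<^sub>R e
    + ((x \<bullet> e) / 25 * (u \<bullet> e)) *\<^sub>R Y x + (2 * warp (x \<bullet> e)) *\<^sub>R Y u
    + (r (x \<bullet> f) * (u \<bullet> f)) *\<^sub>R f"

definition \<Phi> :: "'a \<Rightarrow> 'a" where
  "\<Phi> x = P.k (x \<bullet> e) *\<^sub>R e + sqrt (warp (x \<bullet> e)) *\<^sub>R Y x + Q.k (x \<bullet> f) *\<^sub>R f"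

definition \<Psi> :: "'a \<Rightarrow> 'a" where
  "\<Psi> s = P.a (s \<bullet> e) *\<^sub>R e + inverse (sqrt (warp (P.a (s \<bullet> e)))) *\<^sub>R Y s + Q.a (s \<bullet> f) *\<^sub>R f"

definition S :: "'a set" where "S = \<Psi> ` sphere 0 1"

section \<open>Coordinates and the ambient diffeomorphism\<close>

lemma bounded_linear_Y: "bounded_linear Y"
  unfolding linear_conv_bounded_linear[symmetric]
  by (rule linearI) (simp_all add: Y_def algebra_simps inner_add_left)

lemma linear_Y: "linear Y"
  using bounded_linear_Y by (simp add: linear_conv_bounded_linear)

lemma Y_orth: "Y x \<bullet> e = 0" "Y x \<bullet> f = 0" "e \<bullet> Y x = 0" "f \<bullet> Y x = 0"
  by (simp_all add: Y_def inner_diff_left inner_diff_right e f ef fe inner_commute[of _ x])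

lemma Y_basis: "Y e = 0" "Y f = 0"
  by (simp_all add: Y_def e f ef fe)

lemmas Y_simps = Y_orth Y_basis

lemma Y_Y: "Y (Y x) = Y x"
  using Y_orth[of x] by (simp add: Y_def[of "Y x"])

lemma Y_inner: "Y x \<bullet> Y y = Y x \<bullet> y" "Y x \<bullet> Y y = x \<bullet> Y y"
proof -
  show "Y x \<bullet> Y y = Y x \<bullet> y"
    by (simp only: Y_def[of y] inner_diff_right inner_scaleR_right Y_orth diff_zero mult_zero_right)
  show "Y x \<bullet> Y y = x \<bullet> Y y"
    by (simp only: Y_def[of x] inner_diff_left inner_scaleR_left Y_orth diff_zero mult_zero_right)
qed

lemma decomp: "x = (x \<bullet> e) *\<^sub>R e + Y x + (x \<bullet> f) *\<^sub>R f"
  by (simp add: Y_def)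

lemma coords:
  "(a *\<^sub>R e + b *\<^sub>R Y x + c *\<^sub>R f) \<bullet> e = a" "(a *\<^sub>R e + b *\<^sub>R Y x + c *\<^sub>R f) \<bullet> f = c"
  "Y (a *\<^sub>R e + b *\<^sub>R Y x + c *\<^sub>R f) = b *\<^sub>R Y x"
  by (simp_all add: inner_add_left Y_simps e f ef fe linear_add[OF linear_Y] linear_scale[OF linear_Y] Y_Y)

lemma Phi_Psi: "\<Phi> (\<Psi> s) = s"
proof -
  have "sqrt (warp (P.a (s \<bullet> e))) \<noteq> 0" using warp_pos[of "P.a (s \<bullet> e)"] by simp
  then show ?thesis
    unfolding \<Phi>_def \<Psi>_def coords by (simp add: P.k_a Q.k_a flip: decomp)
qed

lemma Psi_Phi: "\<Psi> (\<Phi> x) = x"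
proof -
  have "sqrt (warp (x \<bullet> e)) \<noteq> 0" using warp_pos[of "x \<bullet> e"] by simp
  then show ?thesis
    unfolding \<Phi>_def \<Psi>_def coords by (simp add: P.a_k Q.a_k flip: decomp)
qed

sublocale ambient_diffeomorphism \<Phi> \<Psi> T
proof
  show "Ck_on k \<Phi> UNIV" for k
    unfolding \<Phi>_def[abs_def]
    by (intro Ck_on_add Ck_on_scaleR Ck_coordinate[OF P.Ck_k] Ck_coordinate[OF Q.Ck_k]
        Ck_coordinate[OF Ck_on_warp] Ck_on_bounded_linear[OF _ bounded_linear_Y] Ck_on_const Ck_on_sqrt)
      (auto simp: warp_pos)
  have "Ck_on k (\<lambda>s. warp (P.a s)) UNIV" for k
    by (rule Ck_on_compose[OF open_UNIV open_UNIV P.Ck_a Ck_on_warp]) simp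
  note warp_a = Ck_coordinate[OF this, of _ e]
  show "Ck_on k \<Psi> UNIV" for k
    unfolding \<Psi>_def[abs_def]
    by (intro Ck_on_add Ck_on_scaleR Ck_coordinate[OF P.Ck_a] Ck_coordinate[OF Q.Ck_a] warp_a
        Ck_on_bounded_linear[OF _ bounded_linear_Y] Ck_on_const Ck_on_sqrt Ck_on_inverse)
      (auto simp: warp_pos less_imp_neq[OF warp_pos, symmetric])
qed (simp_all add: Phi_Psi Psi_Phi dim)

lemma Phi_norm: "\<Phi> x \<bullet> \<Phi> x = G x"
  unfolding \<Phi>_def G_def using warp_pos[of "x \<bullet> e"]
  by (simp add: inner_add_left inner_add_right Y_simps e f ef fe
      less_imp_le mult.assoc[symmetric] flip: P.k_squared Q.k_squared power2_eq_square)

lemma S_iff: "x \<in> S \<longleftrightarrow> G x = 1"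
proof -
  have "x \<in> S \<longleftrightarrow> norm (\<Phi> x) = 1"
    unfolding S_def by (metis Phi_Psi Psi_Phi imageE image_eqI mem_sphere_0)
  then show ?thesis by (simp add: Phi_norm norm_eq_1)
qed

lemma compact_S: "compact S"
  unfolding S_def using Ck_on_continuous[OF Ck_Psi]
  by (intro compact_continuous_image) (auto intro: continuous_on_subset)

section \<open>Gradient and Hessian of the defining function\<close>

lemma warp_deriv: "(warp has_real_derivative t / 50) (at t)"
  unfolding warp_def[abs_def] by (auto intro!: derivative_eq_intros)

lemma Y_deriv: "(Y has_derivative Y) (at x)"
  by (rule bounded_linear_imp_has_derivative[OF bounded_linear_Y])

lemma YY_deriv: "((\<lambda>x. Y x \<bullet> Y x) has_derivative (\<lambda>u. 2 * (Y x \<bullet> u))) (at x)"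
proof -
  have "Y h \<bullet> Y x = Y x \<bullet> h" for h by (metis Y_inner(1) inner_commute)
  then show ?thesis
    by (intro has_derivative_eq_rhs[OF has_derivative_inner[OF Y_deriv Y_deriv]])
      (simp add: Y_inner(1) fun_eq_iff)
qed

lemma G_deriv: "(G has_derivative (\<lambda>u. n x \<bullet> u)) (at x)"
  unfolding G_def[abs_def]
  by (rule has_derivative_eq_rhs, (rule has_derivative_add has_derivative_mult
      real_has_derivative_inner[OF P.DERIV_h] real_has_derivative_inner[OF Q.DERIV_h]
      real_has_derivative_inner[OF warp_deriv] YY_deriv)+)
    (auto simp: n_def fun_eq_iff inner_add_left inner_commute[of e] inner_commute[of f] algebra_simps)

lemma n_deriv: "(n has_derivative A x) (at x)"
proof -
  have d: "((\<lambda>t. t / 50) has_real_derivative 1 / 50) (at t)" for t :: real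
    by (auto intro!: derivative_eq_intros)
  have d': "((\<lambda>t. 2 * warp t) has_real_derivative t / 25) (at t)" for t
    using DERIV_cmult[OF warp_deriv, of 2] by simp
  have "(n has_derivative (\<lambda>u. ((w (x \<bullet> e) * (u \<bullet> e) + ((x \<bullet> e) / 50 * (2 * (Y x \<bullet> u))
      + 1 / 50 * (u \<bullet> e) * (Y x \<bullet> Y x))) *\<^sub>R e)
      + ((2 * warp (x \<bullet> e)) *\<^sub>R Y u + ((x \<bullet> e) / 25 * (u \<bullet> e)) *\<^sub>R Y x)
      + (r (x \<bullet> f) * (u \<bullet> f)) *\<^sub>R f)) (at x)"
    unfolding n_def[abs_def]
    by (intro has_derivative_add has_derivative_scaleR_left has_derivative_scaleR has_derivative_mult
      real_has_derivative_inner[OF P.DERIV_h'] real_has_derivative_inner[OF Q.DERIV_h']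
      real_has_derivative_inner[OF d] real_has_derivative_inner[OF d'] YY_deriv Y_deriv)
  then show ?thesis
    by (rule has_derivative_eq_rhs) (simp add: A_def fun_eq_iff algebra_simps)
qed

lemma A_inner: "A x u \<bullet> v = (w (x \<bullet> e) + (Y x \<bullet> Y x) / 50) * (u \<bullet> e) * (v \<bullet> e)
    + (x \<bullet> e) / 25 * ((Y x \<bullet> u) * (v \<bullet> e) + (u \<bullet> e) * (Y x \<bullet> v))
    + 2 * warp (x \<bullet> e) * (Y u \<bullet> Y v) + r (x \<bullet> f) * (u \<bullet> f) * (v \<bullet> f)"
  by (simp add: A_def inner_add_left Y_inner(1)[of u v] inner_commute[of e v] inner_commute[of f v]
      algebra_simps)

lemma on_S:
  assumes "x \<in> S"
  shows "\<bar>x \<bullet> e\<bar> < 3" "h (x \<bullet> e) + warp (x \<bullet> e) * (Y x \<bullet> Y x) + l (x \<bullet> f) = 1"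
proof -
  show 1: "h (x \<bullet> e) + warp (x \<bullet> e) * (Y x \<bullet> Y x) + l (x \<bullet> f) = 1"
    using assms by (simp add: S_iff G_def)
  have "warp (x \<bullet> e) * (Y x \<bullet> Y x) \<ge> 0" using warp_pos[of "x \<bullet> e"] by simp
  then have "h (x \<bullet> e) \<le> 1" using 1 Q.h_nonneg[of "x \<bullet> f"] by linarith
  then show "\<bar>x \<bullet> e\<bar> < 3" by (rule P.bounded_if_h_le_1)
qed

text \<open>On \<open>S\<close> the mixed term is dominated because the coordinate along \<open>e\<close> is smaller than \<open>3\<close>.\<close>

lemma A_lower_bound:
  assumes "x \<in> S"
  shows "A x u \<bullet> u \<ge> w (x \<bullet> e) * (u \<bullet> e)\<^sup>2 + r (x \<bullet> f) * (u \<bullet> f)\<^sup>2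
    + (norm (Y x) * \<bar>u \<bullet> e\<bar> - 6 * norm (Y u))\<^sup>2 / 50 + (norm (Y u))\<^sup>2"
proof -
  define t a y p where "t = x \<bullet> e" and "a = u \<bullet> e" and "y = norm (Y x)" and "p = norm (Y u)"
  have t: "\<bar>t\<bar> < 3" using on_S[OF assms] by (simp add: t_def)
  have "\<bar>Y x \<bullet> u\<bar> \<le> y * p"
    using Cauchy_Schwarz_ineq2[of "Y x" "Y u"] by (simp add: Y_inner y_def p_def)
  then have "\<bar>t\<bar> * (\<bar>Y x \<bullet> u\<bar> * \<bar>a\<bar>) \<le> 3 * (y * p * \<bar>a\<bar>)"
    using t by (intro mult_mono) auto
  then have "- (t * ((Y x \<bullet> u) * a)) \<le> 3 * (y * p * \<bar>a\<bar>)"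
    using abs_ge_minus_self[of "t * ((Y x \<bullet> u) * a)"] by (simp add: abs_mult)
  moreover have "2 * warp t * p\<^sup>2 \<ge> 2 * p\<^sup>2"
    by (simp add: warp_def distrib_right)
  moreover have "A x u \<bullet> u = w t * a\<^sup>2 + y\<^sup>2 * a\<^sup>2 / 50 + 2 / 25 * (t * ((Y x \<bullet> u) * a))
      + 2 * warp t * p\<^sup>2 + r (x \<bullet> f) * (u \<bullet> f)\<^sup>2"
    unfolding A_inner by (simp add: t_def a_def y_def p_def power2_norm_eq_inner power2_eq_square[of "u \<bullet> _"]
        algebra_simps)
  \<comment> \<open>The mixed term is at least -12/50 of y p |a|. Completing the square costs 36/50
    of p^2, and the 2 p^2 available leaves more than p^2.\<close>
  moreover have "(y * \<bar>a\<bar> - 6 * p)\<^sup>2 = y\<^sup>2 * a\<^sup>2 - 12 * (y * p * \<bar>a\<bar>) + 36 * p\<^sup>2"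
    by (simp add: power2_diff power_mult_distrib)
  ultimately show ?thesis
    unfolding t_def[symmetric] a_def[symmetric] y_def[symmetric] p_def[symmetric]
    using zero_le_power2[of p] by argo
qed

lemma A_nonneg:
  assumes "x \<in> S"
  shows "A x u \<bullet> u \<ge> 0"
  by (rule order_trans[OF _ A_lower_bound[OF assms]]) (simp add: P.w_nonneg Q.w_nonneg)

lemma l'_eq_0: "l' t = 0 \<Longrightarrow> r t \<noteq> 0"
  using Q.h'_eq_0_iff[of t] Q.w_eq_2[of 0] by simp

lemma h'_eq_0: "h' t = 0 \<Longrightarrow> w t \<noteq> 0"
  using P.h'_eq_0_iff[of t] P.w_eq_2[of 0] by simp

lemma n_inner: "n x \<bullet> u = (h' (x \<bullet> e) + (x \<bullet> e) / 50 * (Y x \<bullet> Y x)) * (u \<bullet> e)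
    + 2 * warp (x \<bullet> e) * (Y x \<bullet> Y u) + l' (x \<bullet> f) * (u \<bullet> f)"
  by (simp add: n_def inner_add_left Y_inner(1)[of x u] inner_commute[of e u] inner_commute[of f u])

text \<open>If the form is not positive, every summand of the lower bound is 0. Then
  \<open>u\<close> lies in the plane of \<open>e\<close> and \<open>f\<close>, and unless the
  excluded degeneracy occurs it is a multiple of one of them. Tangency would make \<open>h'\<close>
  or \<open>l'\<close> vanish where the matching second derivative does, but these first derivatives
  vanish only at 0.\<close>

lemma A_pos:
  assumes x: "x \<in> S" and u: "n x \<bullet> u = 0" "u \<noteq> 0"
    and nd: "\<not> (Y x = 0 \<and> x \<bullet> e \<in> K \<and> x \<bullet> f \<in> L)"
  shows "A x u \<bullet> u > 0"
proof (rule ccontr)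
  assume "\<not> A x u \<bullet> u > 0"
  then have sum: "w (x \<bullet> e) * (u \<bullet> e)\<^sup>2 + r (x \<bullet> f) * (u \<bullet> f)\<^sup>2
    + (norm (Y x) * \<bar>u \<bullet> e\<bar> - 6 * norm (Y u))\<^sup>2 / 50 + (norm (Y u))\<^sup>2 \<le> 0"
    using A_lower_bound[OF x, of u] by linarith
  have "w (x \<bullet> e) * (u \<bullet> e)\<^sup>2 \<ge> 0" "r (x \<bullet> f) * (u \<bullet> f)\<^sup>2 \<ge> 0"
    "(norm (Y x) * \<bar>u \<bullet> e\<bar> - 6 * norm (Y u))\<^sup>2 \<ge> 0" "(norm (Y u))\<^sup>2 \<ge> 0"
    by (simp_all add: P.w_nonneg Q.w_nonneg)
  then have "w (x \<bullet> e) * (u \<bullet> e)\<^sup>2 = 0" "r (x \<bullet> f) * (u \<bullet> f)\<^sup>2 = 0"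
    "(norm (Y x) * \<bar>u \<bullet> e\<bar> - 6 * norm (Y u))\<^sup>2 = 0" "(norm (Y u))\<^sup>2 = 0"
    using sum by linarith+
  then have wa: "w (x \<bullet> e) = 0 \<or> u \<bullet> e = 0" and rb: "r (x \<bullet> f) = 0 \<or> u \<bullet> f = 0"
    and Yu: "Y u = 0" and Ya: "Y x = 0 \<or> u \<bullet> e = 0" by auto
  have nu: "(h' (x \<bullet> e) + (x \<bullet> e) / 50 * (Y x \<bullet> Y x)) * (u \<bullet> e) + l' (x \<bullet> f) * (u \<bullet> f) = 0"
    using u(1) by (simp add: n_inner Yu)
  have ab: "u \<bullet> e \<noteq> 0 \<or> u \<bullet> f \<noteq> 0" using decomp[of u] u(2) Yu by auto
  show False
  proof (cases "u \<bullet> e = 0")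
    case True
    then show ?thesis using ab rb nu l'_eq_0[of "x \<bullet> f"] by auto
  next
    case False
    then have "Y x = 0" "w (x \<bullet> e) = 0" using Ya wa by auto
    then have "u \<bullet> f = 0" using nd rb P.w_eq_0_iff Q.w_eq_0_iff by auto
    then show ?thesis using nu False \<open>Y x = 0\<close> \<open>w (x \<bullet> e) = 0\<close> h'_eq_0[of "x \<bullet> e"] by auto
  qed
qed

text \<open>The only critical point of \<open>G\<close> is the origin, where \<open>G\<close> is 0
  and not 1.\<close>

lemma n_nonzero:
  assumes x: "x \<in> S"
  shows "n x \<noteq> 0"
proof
  assume "n x = 0"
  then have "n x \<bullet> Y x = 0" "n x \<bullet> f = 0" "n x \<bullet> e = 0" by simp_all
  then have Y: "Y x = 0" and "l' (x \<bullet> f) = 0"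
    using warp_pos[of "x \<bullet> e"] by (simp_all add: n_inner Y_simps Y_Y e f ef fe)
  moreover have "h' (x \<bullet> e) = 0" using \<open>n x \<bullet> e = 0\<close> Y by (simp add: n_inner Y_simps e ef)
  ultimately have "x \<bullet> e = 0" "x \<bullet> f = 0" by (simp_all add: P.h'_eq_0_iff Q.h'_eq_0_iff)
  then show False using on_S(2)[OF x] Y by (simp add: P.h_0 Q.h_0)
qed

sublocale level_set G n A 1 S T
proof
  show "A x u \<bullet> v = A x v \<bullet> u" for x u v
    unfolding A_inner by (simp add: inner_commute[of "Y u" "Y v"] algebra_simps)
qed (simp_all add: S_iff[symmetric] G_deriv n_deriv n_nonzero dim embedded_sphere[folded S_def])

section \<open>The zero-curvature locus and its complement\<close>

definition Z :: "'a set" where "Z = {x \<in> S. Y x = 0 \<and> x \<bullet> e \<in> K \<and> x \<bullet> f \<in> L}"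

lemma sectional_curvature_pos_off_Z:
  "p \<in> S \<Longrightarrow> p \<notin> Z \<Longrightarrow> Pl \<in> tangent_planes T S p \<Longrightarrow> sectional_curvature T S p Pl > 0"
  by (intro sectional_curvature_pos A_pos) (auto simp: Z_def)

lemma zero_curvature_locus_eq: "zero_curvature_locus T S = Z"
proof
  show "zero_curvature_locus T S \<subseteq> Z"
    using sectional_curvature_pos_off_Z unfolding zero_curvature_locus_def by fastforce
  show "Z \<subseteq> zero_curvature_locus T S"
  proof
    fix p assume "p \<in> Z"
    then have p: "p \<in> S" "Y p = 0" "p \<bullet> e \<in> K" "p \<bullet> f \<in> L" by (auto simp: Z_def)
    \<comment> \<open>The gradient of h t + l z in the plane of \<open>e\<close> and
      \<open>f\<close>, turned by a right angle: tangent to the level set and in the kernel of the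
      Hessian.\<close>
    define u where "u = l' (p \<bullet> f) *\<^sub>R e - h' (p \<bullet> e) *\<^sub>R f"
    have w0: "w (p \<bullet> e) = 0" "r (p \<bullet> f) = 0" using p P.w_eq_0_iff Q.w_eq_0_iff by auto
    have u: "u \<bullet> e = l' (p \<bullet> f)" "u \<bullet> f = - h' (p \<bullet> e)" "Y u = 0"
      by (simp_all add: u_def inner_diff_left e f ef fe linear_diff[OF linear_Y]
          linear_scale[OF linear_Y] Y_simps)
    show "p \<in> zero_curvature_locus T S"
    proof (rule zero_curvature_if_kernel[OF p(1) _ _ _ m])
      show "n p \<bullet> u = 0" by (simp add: n_inner u p(2))
      show "u \<noteq> 0" using u(1) l'_eq_0[of "p \<bullet> f"] w0 by auto
      show "A p u \<bullet> v = 0" for v by (simp add: A_inner u p(2) w0)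
    qed
  qed
qed

lemma closed_locus: "closed {x. Y x = 0 \<and> x \<bullet> e \<in> K \<and> x \<bullet> f \<in> L}"
proof -
  have closed_L: "closed L" by (simp add: L)
  have "closed {x. Y x = 0}"
    using bounded_linear_Y by (intro closed_Collect_eq continuous_intros linear_continuous_on)
  moreover have "closed {x. x \<bullet> b \<in> X}" if "closed X" for b and X :: "real set"
    using continuous_closed_vimage[OF that, of "\<lambda>x. x \<bullet> b"] by (auto simp: vimage_def)
  ultimately show ?thesis using K(2) closed_L by (intro closed_Collect_conj)
qed

lemma openin_regular: "openin (top_of_set S) (S - Z)"
proof -
  have "S - Z = S \<inter> - {x. Y x = 0 \<and> x \<bullet> e \<in> K \<and> x \<bullet> f \<in> L}" by (auto simp: Z_def)
  then show ?thesis using closed_locus by (simp add: openin_open_Int open_Compl)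
qed

text \<open>All of \<open>Z\<close> lies in the plane \<open>Y x = 0\<close>. On the sphere the
  image of such a point is moved along a great circle towards a unit vector \<open>b\<close>
  orthogonal to \<open>e\<close> and \<open>f\<close>. The component along \<open>b\<close> becomes
  nonzero at once, and \<open>\<Psi>\<close> preserves this.\<close>

lemma dense_regular: "S \<subseteq> closure (S - Z)"
proof
  fix p assume p: "p \<in> S"
  show "p \<in> closure (S - Z)"
  proof (cases "p \<in> Z")
    case False
    then show ?thesis using p by (intro subsetD[OF closure_subset]) simp
  next
    case True
    then obtain s where s: "norm s = 1" "p = \<Psi> s" using p by (auto simp: S_def)
    have "s = \<Phi> p" by (simp add: s Phi_Psi)
    then have Ys: "Y s = 0" using True by (simp add: \<Phi>_def Z_def linear_add[OF linear_Y] linear_scale[OF linear_Y] Y_simps)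
    have "dim (span {e, f}) < DIM('a)"
      using dim_le_card'[of "{e, f}"] card_insert_le_m1[of 2 "{f}" e] dim m by simp
    then obtain b' where b': "b' \<noteq> 0" "\<And>y. y \<in> span {e, f} \<Longrightarrow> orthogonal b' y"
      using orthogonal_to_subspace_exists[of "span {e, f}"] by (auto simp: span_span)
    define b where "b = b' /\<^sub>R norm b'"
    have be: "b \<bullet> e = 0" "b \<bullet> f = 0" and nb: "norm b = 1"
      using b'(1) b'(2)[of e] b'(2)[of f] by (auto simp: b_def orthogonal_def span_base)
    have Yb: "Y b = b" by (simp add: Y_def be)
    have sb: "s \<bullet> b = 0" using Y_inner(2)[of s b] by (simp add: Ys Yb)
    then have bs: "b \<bullet> s = 0" by (simp add: inner_commute)
    define \<gamma> where "\<gamma> \<delta> = \<Psi> (cos \<delta> *\<^sub>R s + sin \<delta> *\<^sub>R b)" for \<delta> :: real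
    have in_S: "\<gamma> \<delta> \<in> S" for \<delta>
    proof -
      have "(cos \<delta> *\<^sub>R s + sin \<delta> *\<^sub>R b) \<bullet> (cos \<delta> *\<^sub>R s + sin \<delta> *\<^sub>R b) = (cos \<delta>)\<^sup>2 + (sin \<delta>)\<^sup>2"
        using s(1) nb sb by (simp add: inner_add_left inner_add_right bs norm_eq_1 power2_eq_square)
      then have "norm (cos \<delta> *\<^sub>R s + sin \<delta> *\<^sub>R b) = 1" by (simp add: norm_eq_1)
      then show ?thesis by (simp add: \<gamma>_def S_def)
    qed
    have not_Z: "\<gamma> \<delta> \<notin> Z" if "0 < \<delta>" "\<delta> < pi" for \<delta>
    proof -
      have "Y (cos \<delta> *\<^sub>R s + sin \<delta> *\<^sub>R b) = sin \<delta> *\<^sub>R b"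
        by (simp add: linear_add[OF linear_Y] linear_scale[OF linear_Y] Ys Yb)
      moreover have "sin \<delta> > 0" using that by (rule sin_gt_zero)
      moreover have "b \<noteq> 0" using nb by auto
      ultimately have "Y (\<gamma> \<delta>) \<noteq> 0"
        unfolding \<gamma>_def \<Psi>_def coords using less_imp_neq[OF warp_pos, symmetric] by auto
      then show ?thesis by (simp add: Z_def)
    qed
    have "isCont \<gamma> 0"
      unfolding \<gamma>_def[abs_def]
      by (rule isCont_o2[where g=\<Psi>], intro continuous_intros)
        (use Ck_on_continuous[OF Ck_Psi] in \<open>simp add: continuous_on_eq_continuous_within\<close>)
    moreover have "(\<lambda>i. 1 / real (Suc i)) \<longlonglongrightarrow> 0" by (rule lim_1_over_n[THEN LIMSEQ_Suc])
    ultimately have lim: "(\<lambda>i. \<gamma> (1 / real (Suc i))) \<longlonglongrightarrow> \<gamma> 0" by (rule isCont_tendsto_compose)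
    have "\<gamma> 0 = p" by (simp add: \<gamma>_def s)
    have mem: "\<gamma> (1 / real (Suc i)) \<in> S - Z" for i
    proof -
      have "1 / real (Suc i) \<le> 1" by simp
      then have "1 / real (Suc i) < pi" using pi_gt3 by linarith
      then show ?thesis using in_S not_Z[of "1 / real (Suc i)"] by simp
    qed
    show ?thesis
      unfolding closure_sequential \<open>\<gamma> 0 = p\<close>[symmetric]
      by (rule exI[of _ "\<lambda>i. \<gamma> (1 / real (Suc i))"]) (use mem lim in blast)
  qed
qed

section \<open>Bi-Lipschitz equivalence of the locus with the Cantor set\<close>

lemma Z_iff: "x \<in> Z \<longleftrightarrow> (\<exists>t z. x = t *\<^sub>R e + z *\<^sub>R f \<and> t \<in> K \<and> 1 / 2 \<le> z \<and> h t + l z = 1)"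
proof
  assume "x \<in> Z"
  show "\<exists>t z. x = t *\<^sub>R e + z *\<^sub>R f \<and> t \<in> K \<and> 1 / 2 \<le> z \<and> h t + l z = 1"
  proof (rule exI[of _ "x \<bullet> e"], intro exI[of _ "x \<bullet> f"] conjI)
    have x: "x \<in> S" "Y x = 0" "x \<bullet> e \<in> K" "x \<bullet> f \<in> L" using \<open>x \<in> Z\<close> by (simp_all add: Z_def)
    show "x = (x \<bullet> e) *\<^sub>R e + (x \<bullet> f) *\<^sub>R f" using decomp[of x] x(2) by simp
    show "h (x \<bullet> e) + l (x \<bullet> f) = 1" using on_S(2)[OF x(1)] x(2) by simp
    show "x \<bullet> e \<in> K" by (rule x)
    show "1 / 2 \<le> x \<bullet> f" using x(4) L by simp
  qed
next
  assume "\<exists>t z. x = t *\<^sub>R e + z *\<^sub>R f \<and> t \<in> K \<and> 1 / 2 \<le> z \<and> h t + l z = 1"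
  then obtain t z where x: "x = t *\<^sub>R e + z *\<^sub>R f" "t \<in> K" "1 / 2 \<le> z" "h t + l z = 1" by blast
  then have "x \<bullet> e = t" "x \<bullet> f = z" "Y x = 0" using coords[of t 0 0 z] by simp_all
  moreover from this have "x \<bullet> f \<in> L" using x(3) by (simp only: L atLeast_iff)
  ultimately show "x \<in> Z" using x by (simp add: Z_def S_iff G_def)
qed

lemma l_expanding:
  assumes "1 / 2 \<le> y" "1 / 2 \<le> z"
  shows "\<bar>z - y\<bar> \<le> 2 * \<bar>l z - l y\<bar>"
proof -
  have "v - u \<le> 2 * (l v - l u)" if "1 / 2 \<le> u" "u \<le> v" for u v
    using Q.h_expanding[of u v] that by simp
  from this[of y z] this[of z y] show ?thesis using assms by (cases "y \<le> z") auto
qed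

lemma h_Lipschitz_on_K:
  assumes "s \<in> K" "t \<in> K"
  shows "2 * \<bar>h t - h s\<bar> \<le> 3 * \<bar>t - s\<bar>"
proof -
  have *: "2 * \<bar>h t - h s\<bar> \<le> 3 * \<bar>t - s\<bar>" if "0 \<le> s" "s \<le> t" "t \<le> 3 / 4" for s t
  proof -
    have "2 * t * (t - s) \<le> 3 / 2 * (t - s)" using that by (intro mult_right_mono) auto
    moreover have "\<bar>h t - h s\<bar> = h t - h s" "\<bar>t - s\<bar> = t - s"
      using P.h_Lipschitz(2)[OF that(1,2)] that by simp_all
    ultimately show ?thesis using P.h_Lipschitz(1)[OF that(1,2)] by simp
  qed
  have "0 \<le> s" "s \<le> 3 / 4" "0 \<le> t" "t \<le> 3 / 4" using subsetD[OF K(1)] assms by force+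
  then show ?thesis using *[of s t] *[of t s] by (cases "s \<le> t") (auto simp: abs_minus_commute)
qed

lemma Z_over_K:
  assumes t: "t \<in> K"
  shows "\<exists>z\<ge>1 / 2. h t + l z = 1"
proof -
  have t': "1 / 2 \<le> t" "t \<le> 3 / 4" using subsetD[OF K(1) t] by auto
  have "h t \<le> t\<^sup>2" using P.h_le t' by simp
  also have "\<dots> \<le> (3 / 4)\<^sup>2" using t' by (intro power_mono) auto
  finally have h: "h t \<le> 9 / 16" by (simp add: power2_eq_square)
  \<comment> \<open>At 1/2, \<open>l\<close> is at most 1/4, below 1 - 9/16. At 5/2 it is at least
    (5/2 - 1/2) / 2 = 1 by expansion.\<close>
  have "\<exists>z\<ge>1 / 2. z \<le> 5 / 2 \<and> l z = 1 - h t"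
  proof (rule IVT)
    show "l (1 / 2) \<le> 1 - h t" using Q.h_le[of "1 / 2"] h by (simp add: power2_eq_square)
    show "1 - h t \<le> l (5 / 2)"
      using Q.h_expanding[of "1 / 2" "5 / 2"] Q.h_nonneg[of "1 / 2"] P.h_nonneg[of t] by simp
  qed (use Q.DERIV_h DERIV_isCont in auto)
  then show ?thesis by (metis add.commute diff_add_cancel)
qed

text \<open>The locus is a graph over \<open>K\<close>, and projection to the
  \<open>e\<close>-coordinate is Lipschitz. Conversely |z - v| \<le> 2 |h t - h s| \<le> 3 |t - s|,
  since \<open>l\<close> expands by at least 1/2 on the half-line and \<open>h\<close> has slope at
  most 3/2 up to 3/4. So distances on the graph are at most 4 |t - s|, which the rescaling by 4
  turns into Lipschitz constant 1.\<close>

lemma bilipschitz_Z: "bilipschitz_equivalent Z ((\<lambda>t. 4 * t - 2) ` K)"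
proof -
  define \<tau> where "\<tau> x = 4 * (x \<bullet> e) - 2" for x
  have dist_Z: "dist x y \<le> 1 * dist (\<tau> x) (\<tau> y)" if xy: "x \<in> Z" "y \<in> Z" for x y
  proof -
    obtain t z where x: "x = t *\<^sub>R e + z *\<^sub>R f" "t \<in> K" "1 / 2 \<le> z" "h t + l z = 1"
      using xy(1) unfolding Z_iff by blast
    obtain s v where y: "y = s *\<^sub>R e + v *\<^sub>R f" "s \<in> K" "1 / 2 \<le> v" "h s + l v = 1"
      using xy(2) unfolding Z_iff by blast
    have "\<bar>z - v\<bar> \<le> 2 * \<bar>l z - l v\<bar>" by (rule l_expanding[OF y(3) x(3)])
    also have "\<bar>l z - l v\<bar> = \<bar>h t - h s\<bar>" using x(4) y(4) by linarith
    also have "2 * \<bar>h t - h s\<bar> \<le> 3 * \<bar>t - s\<bar>" by (rule h_Lipschitz_on_K[OF y(2) x(2)])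
    finally have zv: "\<bar>z - v\<bar> \<le> 3 * \<bar>t - s\<bar>" .
    have "x - y = (t - s) *\<^sub>R e + (z - v) *\<^sub>R f" by (simp add: x y algebra_simps)
    then have "dist x y \<le> norm ((t - s) *\<^sub>R e) + norm ((z - v) *\<^sub>R f)"
      by (metis dist_norm norm_triangle_ineq)
    also have "\<dots> = \<bar>t - s\<bar> + \<bar>z - v\<bar>" using e f by (simp flip: norm_eq_1)
    also have "\<dots> \<le> 4 * \<bar>t - s\<bar>" using zv by simp
    also have "\<dots> = dist (\<tau> x) (\<tau> y)"
      using e fe by (simp add: \<tau>_def x y inner_add_left dist_real_def abs_if)
    finally show ?thesis by simp
  qed
  have inj: "inj_on \<tau> Z" by (rule inj_onI) (use dist_Z in force)
  have image: "\<tau> ` Z = (\<lambda>t. 4 * t - 2) ` K"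
  proof
    show "\<tau> ` Z \<subseteq> (\<lambda>t. 4 * t - 2) ` K" by (auto simp: \<tau>_def Z_def)
    show "(\<lambda>t. 4 * t - 2) ` K \<subseteq> \<tau> ` Z"
    proof
      fix y assume "y \<in> (\<lambda>t. 4 * t - 2) ` K"
      then obtain t where t: "t \<in> K" "y = 4 * t - 2" by blast
      obtain z where "1 / 2 \<le> z" "h t + l z = 1" using Z_over_K[OF t(1)] by blast
      then have "t *\<^sub>R e + z *\<^sub>R f \<in> Z" using t unfolding Z_iff by blast
      moreover have "\<tau> (t *\<^sub>R e + z *\<^sub>R f) = y" using e fe t by (simp add: \<tau>_def inner_add_left)
      ultimately show "y \<in> \<tau> ` Z" by blast
    qed
  qed
  have "4-lipschitz_on Z \<tau>"
  proof (rule lipschitz_onI)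
    fix x y
    have "\<bar>(x - y) \<bullet> e\<bar> \<le> norm (x - y) * norm e" by (rule Cauchy_Schwarz_ineq2)
    then show "dist (\<tau> x) (\<tau> y) \<le> 4 * dist x y"
      using e by (simp add: \<tau>_def dist_real_def dist_norm inner_diff_left flip: norm_eq_1)
  qed simp
  moreover have "1-lipschitz_on (\<tau> ` Z) (inv_into Z \<tau>)"
    by (rule lipschitz_onI) (use dist_Z inj in \<open>auto simp: inv_into_f_f\<close>)
  ultimately show ?thesis
    unfolding bilipschitz_equivalent_def image[symmetric] using inj inj_on_imp_bij_betw by blast
qed

end

theorem theorem1p1:
  fixes m :: nat
  assumes "m \<ge> 3"
    and "CARD('m::finite) = m"
    and "CARD('n::finite) = m + 1"
  shows "\<exists>S :: (real ^ 'n) set.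
    compact S \<and>
    embedded_submanifold TYPE(real ^ 'm) S \<and>
    diffeomorphic S (sphere (0 :: real ^ 'n) 1) \<and>
    (\<forall>p\<in>S. \<forall>P\<in>tangent_planes TYPE(real ^ 'm) S p.
       sectional_curvature TYPE(real ^ 'm) S p P \<ge> 0) \<and>
    openin (top_of_set S) (S - zero_curvature_locus TYPE(real ^ 'm) S) \<and>
    S \<subseteq> closure (S - zero_curvature_locus TYPE(real ^ 'm) S) \<and>
    (\<forall>p\<in>S - zero_curvature_locus TYPE(real ^ 'm) S. \<forall>P\<in>tangent_planes TYPE(real ^ 'm) S p.
       sectional_curvature TYPE(real ^ 'm) S p P > 0) \<and>
    hausdorff_dim (zero_curvature_locus TYPE(real ^ 'm) S) = ennreal (1 / 2) \<and>
    (\<exists>C :: real set. self_similar_cantor_set C \<and> hausdorff_dim C = ennreal (1 / 2) \<and>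
       bilipschitz_equivalent (zero_curvature_locus TYPE(real ^ 'm) S) C)"
proof -
  \<comment> \<open>An affine copy of the Cantor set inside [1/2, 3/4]. The map
    \<open>4 * t - 2\<close> undoes it, so the bi-Lipschitz image of the locus is the self-similar
    set itself.\<close>
  define K where "K = (\<lambda>x. x / 4 + 1 / 2) ` cantor (1 / 4)"
  have K: "K \<subseteq> {1 / 2..3 / 4}" "closed K" and CK: "(\<lambda>t. 4 * t - 2) ` K = cantor (1 / 4)"
  proof -
    show "K \<subseteq> {1 / 2..3 / 4}" using cantor_subset[of "1 / 4"] by (force simp: K_def)
    have "compact (cantor (1 / 4))" by (rule cantor_compact) auto
    then show "closed K" unfolding K_def
      by (intro compact_imp_closed compact_continuous_image continuous_intros) auto
    show "(\<lambda>t. 4 * t - 2) ` K = cantor (1 / 4)" by (simp add: K_def image_image)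
  qed
  obtain h h' w where "profile K h h' w" using profile_exists[OF K(2)] K(1) by force
  moreover obtain l l' r where "profile {1 / 2..} l l' r" using profile_exists[of "{1 / 2..}"] by auto
  moreover obtain i j :: 'n where "i \<noteq> j"
    using assms card_le_Suc0_iff_eq[of "UNIV :: 'n set"] by force
  ultimately interpret hypersurface K h h' w "{1 / 2..}" l l' r "axis i 1 :: real ^ 'n" "axis j 1"
      "TYPE(real ^ 'm)"
    using K assms by (auto simp: hypersurface_def hypersurface_axioms_def inner_axis_axis)
  show ?thesis
  proof (intro exI[of _ S] conjI ballI)
    show "embedded_submanifold TYPE(real ^ 'm) S" by (rule embedded)
    show "diffeomorphic S (sphere (0 :: real ^ 'n) 1)" unfolding S_def by (rule diffeomorphic_sphere)
    show "sectional_curvature TYPE(real ^ 'm) S p P \<ge> 0"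
      if "p \<in> S" "P \<in> tangent_planes TYPE(real ^ 'm) S p" for p P
      using that by (intro sectional_curvature_nonneg A_nonneg)
    show "\<exists>C :: real set. self_similar_cantor_set C \<and> hausdorff_dim C = ennreal (1 / 2) \<and>
       bilipschitz_equivalent (zero_curvature_locus TYPE(real ^ 'm) S) C"
      using bilipschitz_Z cantor_self_similar hausdorff_dim_cantor
      unfolding zero_curvature_locus_eq CK by blast
    show "hausdorff_dim (zero_curvature_locus TYPE(real ^ 'm) S) = ennreal (1 / 2)"
      using hausdorff_dim_bilipschitz[OF bilipschitz_Z] hausdorff_dim_cantor
      by (simp add: zero_curvature_locus_eq CK)
  qed (use compact_S openin_regular dense_regular sectional_curvature_pos_off_Z in
      \<open>auto simp: zero_curvature_locus_eq\<close>)
qed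

end
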